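(* Let $k$ be a power of $2$ and $1/\varepsilon^2$ an integer. Let $\Pi$ be the transcript of any randomized blackboard protocol for $k$-BTX on input distribution $\nu$ with error probability $\delta$, for a sufficiently small constant $\delta$. Then $I(X,Y;\Pi\mid M,D)=\Omega(1/\varepsilon^2)$, where the information is measured with respect to the uniform distribution on $(X,Y)$.
   Context: Each of $k$ sites holds $1/\varepsilon^2$ blocks of $n$ bits; inputs communicate in the blackboard model (every message seen by all sites). $k$-XOR on one block: equals $1$ if there is a coordinate $j\in[n]$ in which exactly $k/2$ sites have a $1$, and $0$ otherwise. $k$-BTX: equals $1$ if $|\sum_{j}k\text{-XOR}(\text{block }j)-\frac{1}{2\varepsilon^2}|\ge2/\varepsilon$, equals $0$ if this quantity is $\le1/\varepsilon$, arbitrary otherwise. Distribution $\nu$: blocks independent, each drawn as follows: for each coordinate $\ell\in[n]$ choose $D^j_\ell$ uniformly from $[k]$; site $D^j_\ell$ gets a uniform bit, others $0$; then choose a special coordinate $M^j$ uniformly in $[n]$ and replace it: with probability $1/2$ all of the first $k/2$ sites get $0$ there, else all get $1$; independently the same for the last $k/2$ sites. $D=(D^j_\ell)$, $M=(M^1,\dots,M^{1/\varepsilon^2})$, $X^j=1$ iff the first $k/2$ sites all have $1$ in coordinate $M^j$ of block $j$, $Y^j$ likewise for the last $k/2$ sites; $X=(X^j)_j$, $Y=(Y^j)_j$.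
   Formalization: The formal statement takes k to be a power of 2 with k ≥ 4: for k = 1, k/2 is not an integer, and for k = 2 with n ≥ 2 the claim fails, since always answering 1 has vanishing error and reveals nothing; Ω is read as holding for all ε below an absolute constant. *)

theory Defs
  imports "HOL-Probability.Probability" "HOL-Library.Monad_Syntax"
begin

text \<open>
  Sites are \<open>0, \<dots>, k - 1\<close> (the first \<open>k/2\<close> of them being \<open>i < k div 2\<close>), blocks are
  \<open>0, \<dots>, N - 1\<close> with \<open>N = 1/\<epsilon>\<^sup>2\<close>, coordinates are \<open>0, \<dots>, n - 1\<close>.
  An input is indexed by site, block, coordinate.
\<close>

type_synonym site_input = "nat \<Rightarrow> nat \<Rightarrow> bool"
type_synonym inputs = "nat \<Rightarrow> site_input"

section \<open>The problems k-XOR and k-BTX\<close>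

definition kXOR :: "nat \<Rightarrow> nat \<Rightarrow> (nat \<Rightarrow> nat \<Rightarrow> bool) \<Rightarrow> bool" where
  "kXOR k n b \<longleftrightarrow> (\<exists>l<n. card {i. i < k \<and> b i l} = k div 2)"

text \<open>The value \<open>None\<close> means that every answer is admissible.\<close>

definition kBTX :: "real \<Rightarrow> nat \<Rightarrow> nat \<Rightarrow> nat \<Rightarrow> inputs \<Rightarrow> bool option" where
  "kBTX \<epsilon> k n N B =
     (let dev = \<bar>(\<Sum>j<N. of_bool (kXOR k n (\<lambda>i. B i j))) - 1 / (2 * \<epsilon>\<^sup>2)\<bar>
      in if dev \<ge> 2 / \<epsilon> then Some True
         else if dev \<le> 1 / \<epsilon> then Some False
         else None)"

section \<open>The input distribution\<close>

record block =
  Dir :: "nat \<Rightarrow> nat"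
  Special :: nat
  Bits :: "nat \<Rightarrow> nat \<Rightarrow> bool"

definition block_dist :: "nat \<Rightarrow> nat \<Rightarrow> block pmf" where
  "block_dist k n = do {
     d \<leftarrow> Pi_pmf {..<n} 0 (\<lambda>_. pmf_of_set {..<k});
     u \<leftarrow> Pi_pmf {..<n} False (\<lambda>_. bernoulli_pmf (1/2));
     m \<leftarrow> pmf_of_set {..<n};
     x \<leftarrow> bernoulli_pmf (1/2);
     y \<leftarrow> bernoulli_pmf (1/2);
     return_pmf \<lparr> Dir = d, Special = m,
       Bits = (\<lambda>i l. if l = m then (if i < k div 2 then x else y)
                     else i = d l \<and> u l) \<rparr> }"

definition nu :: "nat \<Rightarrow> nat \<Rightarrow> nat \<Rightarrow> (nat \<Rightarrow> block) pmf" where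
  "nu k n N = Pi_pmf {..<N} \<lparr> Dir = (\<lambda>_. 0), Special = 0, Bits = (\<lambda>_ _. False) \<rparr>
                (\<lambda>_. block_dist k n)"

definition inputs_of :: "(nat \<Rightarrow> block) \<Rightarrow> inputs" where
  "inputs_of w = (\<lambda>i j l. Bits (w j) i l)"

text \<open>
  The random variables below are encoded as lists so that they take values in countable types;
  on these, \<^term>\<open>count_space UNIV\<close> is sigma-finite, as the library's notions of information need.
\<close>

definition Dvar :: "nat \<Rightarrow> nat \<Rightarrow> (nat \<Rightarrow> block) \<Rightarrow> nat list list" where
  "Dvar n N w = map (\<lambda>j. map (Dir (w j)) [0..<n]) [0..<N]"

definition Mvar :: "nat \<Rightarrow> (nat \<Rightarrow> block) \<Rightarrow> nat list" where
  "Mvar N w = map (\<lambda>j. Special (w j)) [0..<N]"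

definition Xvar :: "nat \<Rightarrow> nat \<Rightarrow> (nat \<Rightarrow> block) \<Rightarrow> bool list" where
  "Xvar k N w = map (\<lambda>j. \<forall>i<k div 2. Bits (w j) i (Special (w j))) [0..<N]"

definition Yvar :: "nat \<Rightarrow> nat \<Rightarrow> (nat \<Rightarrow> block) \<Rightarrow> bool list" where
  "Yvar k N w = map (\<lambda>j. \<forall>i\<in>{k div 2..<k}. Bits (w j) i (Special (w j))) [0..<N]"

section \<open>Randomized blackboard protocols\<close>

text \<open>
  At a node \<open>Speak i f t\<^sub>0 t\<^sub>1\<close>, site \<open>i\<close> writes on the blackboard the bit that \<open>f\<close> computes
  from its own input and its own private coins. The node is determined by the bits written so
  far, so \<open>i\<close> and \<open>f\<close> may depend on everything on the blackboard.
\<close>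

datatype ptree =
    Output bool
  | Speak nat "site_input \<Rightarrow> nat \<Rightarrow> bool" ptree ptree

primrec speakers :: "ptree \<Rightarrow> nat set" where
  "speakers (Output v) = {}"
| "speakers (Speak i f t\<^sub>0 t\<^sub>1) = insert i (speakers t\<^sub>0 \<union> speakers t\<^sub>1)"

primrec board :: "ptree \<Rightarrow> inputs \<Rightarrow> (nat \<Rightarrow> nat) \<Rightarrow> bool list" where
  "board (Output v) B r = []"
| "board (Speak i f t\<^sub>0 t\<^sub>1) B r =
     (if f (B i) (r i) then True # board t\<^sub>1 B r else False # board t\<^sub>0 B r)"

primrec answer :: "ptree \<Rightarrow> inputs \<Rightarrow> (nat \<Rightarrow> nat) \<Rightarrow> bool" where
  "answer (Output v) B r = v"
| "answer (Speak i f t\<^sub>0 t\<^sub>1) B r =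
     (if f (B i) (r i) then answer t\<^sub>1 B r else answer t\<^sub>0 B r)"

text \<open>
  Public coins select the protocol tree; \<open>Private i\<close> is the distribution of the coins of site
  \<open>i\<close>. Coins of an arbitrary discrete distribution are encoded as natural numbers.
\<close>

record protocol =
  Public :: "nat pmf"
  Private :: "nat \<Rightarrow> nat pmf"
  Tree :: "nat \<Rightarrow> ptree"

definition blackboard_protocol :: "nat \<Rightarrow> protocol \<Rightarrow> bool" where
  "blackboard_protocol k P \<longleftrightarrow> (\<forall>s. speakers (Tree P s) \<subseteq> {..<k})"

type_synonym outcome = "(nat \<Rightarrow> block) \<times> nat \<times> (nat \<Rightarrow> nat)"

definition execution :: "nat \<Rightarrow> nat \<Rightarrow> nat \<Rightarrow> protocol \<Rightarrow> outcome pmf" where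
  "execution k n N P =
     pair_pmf (nu k n N) (pair_pmf (Public P) (Pi_pmf {..<k} 0 (Private P)))"

text \<open>
  The transcript contains the public coins. (If it did not, publicly shared one-time pads could
  make it independent of the input.)
\<close>

definition transcript :: "protocol \<Rightarrow> outcome \<Rightarrow> nat \<times> bool list" where
  "transcript P = (\<lambda>(w, s, r). (s, board (Tree P s) (inputs_of w) r))"

definition error_prob :: "real \<Rightarrow> nat \<Rightarrow> nat \<Rightarrow> nat \<Rightarrow> protocol \<Rightarrow> real" where
  "error_prob \<epsilon> k n N P =
     measure_pmf.prob (execution k n N P)
       {(w, s, r). kBTX \<epsilon> k n N (inputs_of w) = Some (\<not> answer (Tree P s) (inputs_of w) r)}"

section \<open>Information revealed by the transcript\<close>

text \<open>\<open>I(X, Y; \<Pi> | M, D)\<close>, in bits.\<close>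

definition transcript_information :: "nat \<Rightarrow> nat \<Rightarrow> nat \<Rightarrow> protocol \<Rightarrow> real" where
  "transcript_information k n N P =
     prob_space.conditional_mutual_information (measure_pmf (execution k n N P)) 2
       (count_space UNIV) (count_space UNIV) (count_space UNIV)
       (\<lambda>(w, s, r). (Xvar k N w, Yvar k N w))
       (transcript P)
       (\<lambda>(w, s, r). (Mvar N w, Dvar n N w))"

end

theory Submission
  imports Defs
begin

text \<open>
  Write \<open>X\<close> and \<open>Y\<close> as sign vectors. A block contributes to the \<open>k\<close>-BTX sum iff \<open>X\<^sup>j \<noteq> Y\<^sup>j\<close>, so a correct
  protocol decides whether \<open>\<bar>\<langle>X, Y\<rangle>\<bar>\<close> is at least \<open>4 \<surd>N\<close> or at most \<open>2 \<surd>N\<close>. Given \<open>M\<close>, \<open>D\<close> and the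
  public coins, the inputs of the two halves of the sites are independent, hence the probability of
  a transcript \<open>t\<close> factors as \<open>a t x * b t y\<close>.

  Compare the uniform law \<open>P\<close> of \<open>(X, Y)\<close> with the law \<open>Q\<close> under which the pairs \<open>(X\<^sup>j, Y\<^sup>j)\<close> are
  independent with correlation \<open>\<rho> = 8 / \<surd>N\<close>. The density of \<open>Q\<close> has bounded second moment, so a small
  error under \<open>P\<close> remains small under \<open>Q\<close>; by Chebyshev the answer is mostly ``no'' under \<open>P\<close> and
  mostly ``yes'' under \<open>Q\<close>. Therefore the laws of the transcript under \<open>Q\<close> and \<open>P\<close> have divergence
  bounded away from zero. On the other hand this divergence is at most \<open>8 \<rho>\<^sup>2\<close> times the information
  revealed under \<open>Q\<close>, which is at most a constant times the one revealed under \<open>P\<close>, plus a small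
  multiple of \<open>N\<close>. Since \<open>\<rho>\<^sup>2 = 64 / N\<close>, the information is of order \<open>N\<close>.

  The bound \<open>8 \<rho>\<^sup>2\<close> is obtained coordinate by coordinate: given \<open>t\<close> and \<open>W\<^sub>i = (x\<^bsub><i\<^esub>, y\<^bsub>>i\<^esub>)\<close>, the pair
  \<open>(x\<^sub>i, y\<^sub>i)\<close> has under \<open>Q\<close> a law proportional to \<open>(1 + p x) (1 + q y) (1 + \<rho> x y)\<close>. The first-order
  contributions \<open>\<rho> p q\<close> cancel on average because \<open>x\<^sub>i y\<^sub>i\<close> has mean \<open>\<rho>\<close> under \<open>Q\<close>, and the remaining
  \<open>\<rho>\<^sup>2 (p\<^sup>2 + q\<^sup>2)\<close> is paid for by the information about \<open>x\<^sub>i\<close> and \<open>y\<^sub>i\<close>.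
\<close>

section \<open>Correlated sign vectors\<close>

definition cube :: "nat \<Rightarrow> bool list set" where
  "cube N = {x. length x = N}"

definition pm :: "bool \<Rightarrow> real" where
  "pm b = (if b then 1 else -1)"

text \<open>The density, relative to the uniform law on pairs of vectors of equal length, of the law
  under which the sign pairs are independent with unbiased entries and correlation
  \<open>\<rho>\<close>. Recursion on the lists lets identities be proved by peeling off the first
  coordinate.\<close>

fun tilt :: "real \<Rightarrow> bool list \<Rightarrow> bool list \<Rightarrow> real" where
  "tilt \<rho> (a # x) (b # y) = (1 + \<rho> * pm a * pm b) * tilt \<rho> x y"
| "tilt \<rho> _ _ = 1"

fun corr :: "bool list \<Rightarrow> bool list \<Rightarrow> real" where
  "corr (a # x) (b # y) = pm a * pm b + corr x y"
| "corr _ _ = 0"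

lemma pm_simps [simp]: "pm True = 1" "pm False = -1"
  by (simp_all add: pm_def)

lemma cube_0 [simp]: "cube 0 = {[]}"
  by (auto simp: cube_def)

lemma finite_cube [simp]: "finite (cube N)"
  using finite_lists_length_eq[of "UNIV :: bool set" N] by (simp add: cube_def)

lemma sum_cube_Suc: "(\<Sum>x\<in>cube (Suc N). f x) = (\<Sum>a\<in>UNIV. \<Sum>x\<in>cube N. f (a # x))"
proof -
  have "cube (Suc N) = (\<lambda>(a, x). a # x) ` (UNIV \<times> cube N)"
    by (auto simp: cube_def length_Suc_conv image_iff)
  then have "(\<Sum>x\<in>cube (Suc N). f x) = (\<Sum>(a, x)\<in>UNIV \<times> cube N. f (a # x))"
    by (simp add: sum.reindex inj_on_def split_def)
  then show ?thesis
    by (simp add: sum.cartesian_product)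
qed

lemma card_cube: "card (cube N) = 2 ^ N"
  using card_lists_length_eq[of "UNIV :: bool set" N] by (simp add: cube_def)

lemma one_plus_tilt_pos: "\<bar>\<rho>\<bar> < 1 \<Longrightarrow> 1 + \<rho> * pm a * pm b > 0"
  by (cases a; cases b) auto

lemma tilt_pos: "\<bar>\<rho>\<bar> < 1 \<Longrightarrow> tilt \<rho> x y > 0"
  by (induction \<rho> x y rule: tilt.induct) (auto intro!: mult_pos_pos one_plus_tilt_pos)

lemma tilt_0 [simp]: "tilt 0 x y = 1"
  by (induction "0::real" x y rule: tilt.induct) auto

lemma sum_bool: "(\<Sum>a\<in>UNIV. f a) = f True + f False"
  by (simp add: UNIV_bool add.commute)

section \<open>Moments of the tilted law\<close>

lemma sum_tilt: "(\<Sum>x\<in>cube N. \<Sum>y\<in>cube N. tilt \<rho> x y) = 4 ^ N"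
proof (induction N)
  case (Suc N)
  have "(\<Sum>x\<in>cube (Suc N). \<Sum>y\<in>cube (Suc N). tilt \<rho> x y)
      = 4 * (\<Sum>x\<in>cube N. \<Sum>y\<in>cube N. tilt \<rho> x y)"
    unfolding sum_cube_Suc sum_bool sum.distrib[symmetric] sum_distrib_left
    by (intro sum.cong refl) (simp, algebra)
  with Suc show ?case by simp
qed simp

text \<open>The second moment of the density, which multiplies over the coordinates. It stays
  bounded for \<rho> of order 1 / sqrt N, which is what allows bounds to be carried from the uniform
  to the tilted law.\<close>

lemma sum_tilt_sq: "(\<Sum>x\<in>cube N. \<Sum>y\<in>cube N. (tilt \<rho> x y)\<^sup>2) = (4 * (1 + \<rho>\<^sup>2)) ^ N"
proof (induction N)
  case (Suc N)
  have "(\<Sum>x\<in>cube (Suc N). \<Sum>y\<in>cube (Suc N). (tilt \<rho> x y)\<^sup>2)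
      = (4 * (1 + \<rho>\<^sup>2)) * (\<Sum>x\<in>cube N. \<Sum>y\<in>cube N. (tilt \<rho> x y)\<^sup>2)"
    unfolding sum_cube_Suc sum_bool sum.distrib[symmetric] sum_distrib_left
    by (intro sum.cong refl) (simp, algebra)
  with Suc show ?case by simp
qed simp

lemma sum_tilt_corr: "(\<Sum>x\<in>cube N. \<Sum>y\<in>cube N. tilt \<rho> x y * (corr x y - real N * \<rho>)) = 0"
proof (induction N)
  case (Suc N)
  have "(\<Sum>x\<in>cube (Suc N). \<Sum>y\<in>cube (Suc N). tilt \<rho> x y * (corr x y - real (Suc N) * \<rho>))
      = 4 * (\<Sum>x\<in>cube N. \<Sum>y\<in>cube N. tilt \<rho> x y * (corr x y - real N * \<rho>))"
    unfolding sum_cube_Suc sum_bool sum.distrib[symmetric] sum_distrib_left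
    by (intro sum.cong refl) (simp, algebra)
  with Suc show ?case by simp
qed simp

text \<open>Under the tilted law the products of paired signs are independent with mean \<rho> and
  variance 1 - \<rho>^2, so the variances add up; the cross term of the peeled coordinate vanishes
  because its centred product has mean zero.\<close>

lemma sum_tilt_corr_sq:
  "(\<Sum>x\<in>cube N. \<Sum>y\<in>cube N. tilt \<rho> x y * (corr x y - real N * \<rho>)\<^sup>2) = 4 ^ N * (real N * (1 - \<rho>\<^sup>2))"
proof (induction N)
  case (Suc N)
  have "(\<Sum>x\<in>cube (Suc N). \<Sum>y\<in>cube (Suc N). tilt \<rho> x y * (corr x y - real (Suc N) * \<rho>)\<^sup>2)
      = (\<Sum>x\<in>cube N. \<Sum>y\<in>cube N. 4 * (tilt \<rho> x y * (corr x y - real N * \<rho>)\<^sup>2)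
           + 4 * (1 - \<rho>\<^sup>2) * tilt \<rho> x y)"
    unfolding sum_cube_Suc sum_bool sum.distrib[symmetric]
    by (intro sum.cong refl) (simp, algebra)
  also have "\<dots> = 4 * (\<Sum>x\<in>cube N. \<Sum>y\<in>cube N. tilt \<rho> x y * (corr x y - real N * \<rho>)\<^sup>2)
           + 4 * (1 - \<rho>\<^sup>2) * (\<Sum>x\<in>cube N. \<Sum>y\<in>cube N. tilt \<rho> x y)"
    by (simp add: sum.distrib sum_distrib_left)
  also have "\<dots> = 4 ^ Suc N * (real (Suc N) * (1 - \<rho>\<^sup>2))"
    by (simp only: Suc sum_tilt) (simp add: algebra_simps)
  finally show ?case .
qed simp

section \<open>Integrals over a single coordinate\<close>

text \<open>The mean of the sign under the normalized weight \<open>g\<close>. If \<open>g\<close>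
  vanishes, division by zero gives 0, so \<open>bias_eq\<close> and \<open>bias_bounds\<close> hold
  there as well.\<close>

definition bias :: "(bool \<Rightarrow> real) \<Rightarrow> real" where
  "bias g = (g True - g False) / (g True + g False)"

lemma bias_eq:
  assumes "g True \<ge> 0" "g False \<ge> 0"
  shows "g a = (g True + g False) / 2 * (1 + bias g * pm a)"
proof (cases "g True + g False = 0")
  case True
  with assms have "g True = 0" "g False = 0" by linarith+
  then show ?thesis by (cases a) auto
next
  case False
  then show ?thesis
    unfolding bias_def by (cases a) (auto simp: field_simps)
qed

lemma bias_bounds:
  assumes "g True \<ge> 0" "g False \<ge> 0"
  shows "\<bar>bias g\<bar> \<le> 1"
proof (cases "g True + g False = 0")
  case False
  then have "g True + g False > 0" using assms by linarith
  then show ?thesis using assms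
    by (simp add: bias_def abs_le_iff field_simps)
qed (simp add: bias_def)

lemma one_plus_bound:
  assumes "\<bar>\<rho>\<bar> < 1" "\<bar>p\<bar> \<le> 1"
  shows "1 + \<rho> * p * pm b > 0"
proof -
  have "\<bar>\<rho> * p\<bar> \<le> \<bar>\<rho>\<bar> * 1" unfolding abs_mult by (intro mult_left_mono assms) auto
  then show ?thesis using assms by (cases b) auto
qed

text \<open>The integral belonging to one coordinate: \<open>g\<close> and \<open>h\<close> are the
  weights of its two signs for fixed values of the other data, and \<open>\<phi>\<close> receives
  their biases besides the signs. The weights are left unnormalized so that such integrals can
  simply be added.\<close>

definition local_sum :: "real \<Rightarrow> (real \<Rightarrow> real \<Rightarrow> real \<Rightarrow> real \<Rightarrow> real)
    \<Rightarrow> (bool \<Rightarrow> real) \<Rightarrow> (bool \<Rightarrow> real) \<Rightarrow> real" where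
  "local_sum \<rho> \<phi> g h = (\<Sum>a\<in>UNIV. \<Sum>b\<in>UNIV.
     g a * h b * (1 + \<rho> * pm a * pm b) * \<phi> (bias g) (bias h) (pm a) (pm b))"

text \<open>\<open>local_sum\<close> for the weights 1 + p x and 1 + q y. It is not a mean: the
  total mass is 4 (1 + \<rho> p q).\<close>

definition avg4 :: "real \<Rightarrow> real \<Rightarrow> real \<Rightarrow> (real \<Rightarrow> real \<Rightarrow> real) \<Rightarrow> real" where
  "avg4 \<rho> p q \<phi> = (\<Sum>a\<in>UNIV. \<Sum>b\<in>UNIV.
     (1 + p * pm a) * (1 + q * pm b) * (1 + \<rho> * pm a * pm b) * \<phi> (pm a) (pm b))"

lemma local_sum_eq_avg4:
  assumes "\<And>a. g a \<ge> 0" "\<And>b. h b \<ge> 0"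
  shows "local_sum \<rho> \<phi> g h =
    (g True + g False) / 2 * ((h True + h False) / 2) * avg4 \<rho> (bias g) (bias h) (\<phi> (bias g) (bias h))"
  unfolding avg4_def local_sum_def sum_distrib_left
  by (intro sum.cong refl, subst bias_eq[OF assms(1,1)], subst bias_eq[OF assms(2,2)])
    (simp add: mult_ac)

text \<open>
  \<open>hybrid \<rho> \<phi> N \<alpha> \<beta>\<close> is the sum over the coordinates \<open>i\<close> of the integral of \<open>\<phi> p q x\<^sub>i y\<^sub>i\<close> against
  \<open>\<alpha> x * \<beta> y * tilt \<rho> x y\<close>, where \<open>p\<close> and \<open>q\<close> are the biases of \<open>x\<^sub>i\<close> and \<open>y\<^sub>i\<close> given \<open>W\<^sub>i\<close> before the
  factor \<open>1 + \<rho> x\<^sub>i y\<^sub>i\<close> is applied. The recursion peels off the first coordinate: for \<open>i > 0\<close>, \<open>x\<^sub>0\<close> belongs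
  to \<open>W\<^sub>i\<close> and \<open>y\<^sub>0\<close> is integrated out.
\<close>

primrec hybrid :: "real \<Rightarrow> (real \<Rightarrow> real \<Rightarrow> real \<Rightarrow> real \<Rightarrow> real) \<Rightarrow> nat
    \<Rightarrow> (bool list \<Rightarrow> real) \<Rightarrow> (bool list \<Rightarrow> real) \<Rightarrow> real" where
  "hybrid \<rho> \<phi> 0 \<alpha> \<beta> = 0"
| "hybrid \<rho> \<phi> (Suc N) \<alpha> \<beta> =
     (\<Sum>y\<in>cube N. local_sum \<rho> \<phi> (\<lambda>a. \<Sum>x\<in>cube N. \<alpha> (a # x) * tilt \<rho> x y) (\<lambda>b. \<beta> (b # y)))
   + (\<Sum>a\<in>UNIV. hybrid \<rho> \<phi> N (\<lambda>x. \<alpha> (a # x)) (\<lambda>y. \<Sum>b\<in>UNIV. \<beta> (b # y) * (1 + \<rho> * pm a * pm b)))"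

section \<open>Linearity, comparison and telescoping of the hybrid sums\<close>

lemma local_sum_add:
  "local_sum \<rho> (\<lambda>p q x y. \<phi> p q x y + \<psi> p q x y) g h = local_sum \<rho> \<phi> g h + local_sum \<rho> \<psi> g h"
  by (simp add: local_sum_def sum_bool algebra_simps)

lemma local_sum_scale: "local_sum \<rho> (\<lambda>p q x y. c * \<phi> p q x y) g h = c * local_sum \<rho> \<phi> g h"
  by (simp add: local_sum_def sum_bool algebra_simps)

lemma hybrid_add:
  "hybrid \<rho> (\<lambda>p q x y. \<phi> p q x y + \<psi> p q x y) N \<alpha> \<beta> = hybrid \<rho> \<phi> N \<alpha> \<beta> + hybrid \<rho> \<psi> N \<alpha> \<beta>"
  by (induction N arbitrary: \<alpha> \<beta>) (simp_all add: sum.distrib local_sum_add)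

lemma hybrid_scale: "hybrid \<rho> (\<lambda>p q x y. c * \<phi> p q x y) N \<alpha> \<beta> = c * hybrid \<rho> \<phi> N \<alpha> \<beta>"
  by (induction N arbitrary: \<alpha> \<beta>) (simp_all add: sum_distrib_left distrib_left local_sum_scale)

text \<open>Every \<open>local_sum\<close> is a nonnegative multiple of an \<open>avg4\<close>.
  Hence a comparison on average over one coordinate, for all biases, carries over to the sum even
  where it fails pointwise.\<close>

lemma hybrid_mono:
  assumes "\<bar>\<rho>\<bar> < 1" "\<And>x. \<alpha> x \<ge> 0" "\<And>y. \<beta> y \<ge> 0"
    and le: "\<And>p q. \<bar>p\<bar> \<le> 1 \<Longrightarrow> \<bar>q\<bar> \<le> 1 \<Longrightarrow> avg4 \<rho> p q (\<phi> p q) \<le> avg4 \<rho> p q (\<psi> p q)"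
  shows "hybrid \<rho> \<phi> N \<alpha> \<beta> \<le> hybrid \<rho> \<psi> N \<alpha> \<beta>"
  using assms(2,3)
proof (induction N arbitrary: \<alpha> \<beta>)
  case (Suc N)
  have "local_sum \<rho> \<phi> g h \<le> local_sum \<rho> \<psi> g h" if "\<And>a. g a \<ge> 0" "\<And>b. h b \<ge> 0" for g h
    using that
    by (simp add: local_sum_eq_avg4, intro mult_left_mono le bias_bounds) auto
  moreover have "(\<Sum>x\<in>cube N. \<alpha> (a # x) * tilt \<rho> x y) \<ge> 0" for a y
    using Suc.prems tilt_pos[OF assms(1)] by (intro sum_nonneg mult_nonneg_nonneg) (auto intro: less_imp_le)
  ultimately show ?case
    unfolding hybrid.simps using Suc.prems
    by (intro add_mono sum_mono Suc.IH)
      (auto intro!: sum_nonneg mult_nonneg_nonneg less_imp_le[OF one_plus_tilt_pos[OF assms(1)]])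
qed simp

text \<open>The induction step shared by the telescoping lemmas. If peeling splits \<open>u\<close>
  into a part \<open>f\<close> free of the tail of \<open>x\<close> and a part \<open>v\<close> free
  of the head of \<open>y\<close>, the two resulting sums are those in the recursion of
  \<open>hybrid\<close>. The splitting is asked for only at points of nonzero weight, since the
  rules for logarithms fail at zero.\<close>

lemma sum_cube_peel:
  assumes "\<And>a b x y. x \<in> cube N \<Longrightarrow> y \<in> cube N \<Longrightarrow> \<alpha> (a # x) \<noteq> 0 \<Longrightarrow> \<beta> (b # y) \<noteq> 0 \<Longrightarrow>
      u (a # x) (b # y) = f a b y + v a x y"
  shows "(\<Sum>x\<in>cube (Suc N). \<Sum>y\<in>cube (Suc N). \<alpha> x * \<beta> y * tilt \<rho> x y * u x y) =
    (\<Sum>y\<in>cube N. \<Sum>a\<in>UNIV. \<Sum>b\<in>UNIV.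
       (\<Sum>x\<in>cube N. \<alpha> (a # x) * tilt \<rho> x y) * \<beta> (b # y) * (1 + \<rho> * pm a * pm b) * f a b y)
    + (\<Sum>a\<in>UNIV. \<Sum>x\<in>cube N. \<Sum>y\<in>cube N.
       \<alpha> (a # x) * (\<Sum>b\<in>UNIV. \<beta> (b # y) * (1 + \<rho> * pm a * pm b)) * tilt \<rho> x y * v a x y)"
proof -
  have "(\<Sum>x\<in>cube (Suc N). \<Sum>y\<in>cube (Suc N). \<alpha> x * \<beta> y * tilt \<rho> x y * u x y) =
    (\<Sum>a\<in>UNIV. \<Sum>x\<in>cube N. \<Sum>b\<in>UNIV. \<Sum>y\<in>cube N.
       \<alpha> (a # x) * tilt \<rho> x y * (\<beta> (b # y) * (1 + \<rho> * pm a * pm b)) * (f a b y + v a x y))"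
    unfolding sum_cube_Suc
  proof (intro sum.cong refl)
    fix a b x y assume "x \<in> cube N" "y \<in> cube N"
    then show "\<alpha> (a # x) * \<beta> (b # y) * tilt \<rho> (a # x) (b # y) * u (a # x) (b # y) =
      \<alpha> (a # x) * tilt \<rho> x y * (\<beta> (b # y) * (1 + \<rho> * pm a * pm b)) * (f a b y + v a x y)"
      using assms[of x y a b] by (cases "\<alpha> (a # x) = 0"; cases "\<beta> (b # y) = 0") auto
  qed
  also have "\<dots> = (\<Sum>a\<in>UNIV. \<Sum>x\<in>cube N. \<Sum>b\<in>UNIV. \<Sum>y\<in>cube N.
       \<alpha> (a # x) * tilt \<rho> x y * (\<beta> (b # y) * (1 + \<rho> * pm a * pm b)) * f a b y)
     + (\<Sum>a\<in>UNIV. \<Sum>x\<in>cube N. \<Sum>b\<in>UNIV. \<Sum>y\<in>cube N.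
       \<alpha> (a # x) * tilt \<rho> x y * (\<beta> (b # y) * (1 + \<rho> * pm a * pm b)) * v a x y)"
    by (simp only: distrib_left[of "_ * (_ * _)"] sum.distrib)
  also have "(\<Sum>a\<in>UNIV. \<Sum>x\<in>cube N. \<Sum>b\<in>UNIV. \<Sum>y\<in>cube N.
       \<alpha> (a # x) * tilt \<rho> x y * (\<beta> (b # y) * (1 + \<rho> * pm a * pm b)) * f a b y) =
     (\<Sum>y\<in>cube N. \<Sum>a\<in>UNIV. \<Sum>b\<in>UNIV. \<Sum>x\<in>cube N.
       \<alpha> (a # x) * tilt \<rho> x y * (\<beta> (b # y) * (1 + \<rho> * pm a * pm b)) * f a b y)"
    by (subst sum.swap[of _ "cube N" UNIV], subst sum.swap[of _ "cube N" "cube N"],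
        subst sum.swap[of _ UNIV "cube N"], subst sum.swap[of _ UNIV "cube N"]) simp
  also have "\<dots> = (\<Sum>y\<in>cube N. \<Sum>a\<in>UNIV. \<Sum>b\<in>UNIV.
       (\<Sum>x\<in>cube N. \<alpha> (a # x) * tilt \<rho> x y) * \<beta> (b # y) * (1 + \<rho> * pm a * pm b) * f a b y)"
    by (simp only: sum_distrib_right mult.assoc)
  also have "(\<Sum>a\<in>UNIV. \<Sum>x\<in>cube N. \<Sum>b\<in>UNIV. \<Sum>y\<in>cube N.
       \<alpha> (a # x) * tilt \<rho> x y * (\<beta> (b # y) * (1 + \<rho> * pm a * pm b)) * v a x y) =
     (\<Sum>a\<in>UNIV. \<Sum>x\<in>cube N. \<Sum>y\<in>cube N. \<Sum>b\<in>UNIV.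
       \<alpha> (a # x) * tilt \<rho> x y * (\<beta> (b # y) * (1 + \<rho> * pm a * pm b)) * v a x y)"
    by (subst sum.swap[of _ "cube N" UNIV]) simp
  also have "\<dots> = (\<Sum>a\<in>UNIV. \<Sum>x\<in>cube N. \<Sum>y\<in>cube N.
       \<alpha> (a # x) * (\<Sum>b\<in>UNIV. \<beta> (b # y) * (1 + \<rho> * pm a * pm b)) * tilt \<rho> x y * v a x y)"
    by (intro sum.cong refl) (simp add: sum_bool algebra_simps)
  finally show ?thesis .
qed

lemma hybrid_corr:
  "hybrid \<rho> (\<lambda>p q x y. x * y - \<rho>) N \<alpha> \<beta> =
     (\<Sum>x\<in>cube N. \<Sum>y\<in>cube N. \<alpha> x * \<beta> y * tilt \<rho> x y * (corr x y - real N * \<rho>))"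
proof (induction N arbitrary: \<alpha> \<beta>)
  case (Suc N)
  show ?case
    by (subst sum_cube_peel[where f="\<lambda>a b y. pm a * pm b - \<rho>" and v="\<lambda>a x y. corr x y - real N * \<rho>"])
      (simp_all add: Suc local_sum_def algebra_simps)
qed simp

lemma sum_bool_one_plus:
  assumes "\<And>a. g a \<ge> 0"
  shows "(\<Sum>a\<in>UNIV. g a * (1 + \<rho> * pm a * pm b)) = (g True + g False) * (1 + \<rho> * bias g * pm b)"
    and "(\<Sum>a\<in>UNIV. g a * (1 + \<rho> * pm b * pm a)) = (g True + g False) * (1 + \<rho> * bias g * pm b)"
proof -
  show "(\<Sum>a\<in>UNIV. g a * (1 + \<rho> * pm a * pm b)) = (g True + g False) * (1 + \<rho> * bias g * pm b)"
    using bias_eq[of g True, OF assms assms] bias_eq[of g False, OF assms assms]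
    by (simp add: sum_bool) algebra
  then show "(\<Sum>a\<in>UNIV. g a * (1 + \<rho> * pm b * pm a)) = (g True + g False) * (1 + \<rho> * bias g * pm b)"
    by (simp add: mult_ac)
qed

lemma sum_cube_tilt_pos:
  assumes "\<bar>\<rho>\<bar> < 1" "\<And>x. \<alpha> x \<ge> 0" "\<alpha> x0 \<noteq> 0" "x0 \<in> cube N"
  shows "(\<Sum>x\<in>cube N. \<alpha> x * tilt \<rho> x y) > 0" "(\<Sum>x\<in>cube N. \<alpha> x * tilt \<rho> y x) > 0"
  using assms(2,3,4) tilt_pos[OF assms(1)]
  by (auto intro!: sum_pos2[of _ x0] mult_pos_pos mult_nonneg_nonneg less_imp_le[of 0 "tilt _ _ _"]
      order.not_eq_order_implies_strict[of 0 "\<alpha> x0"])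

text \<open>Chain rule for what a transcript tells about \<open>x\<close> when \<open>y\<close> is
  known. The quotient (1 + p x) / (1 + \<rho> p y) is the posterior-to-prior ratio of x_i given y_i,
  the earlier signs of \<open>x\<close> and the later signs of \<open>y\<close>; the product of
  these ratios is the ratio for all of \<open>x\<close>.\<close>

lemma hybrid_left:
  assumes \<rho>: "\<bar>\<rho>\<bar> < 1" and "\<And>x. \<alpha> x \<ge> 0" "\<And>y. \<beta> y \<ge> 0"
  shows "hybrid \<rho> (\<lambda>p q x y. ln (1 + p * x) - ln (1 + \<rho> * p * y)) N \<alpha> \<beta> =
     (\<Sum>x\<in>cube N. \<Sum>y\<in>cube N. \<alpha> x * \<beta> y * tilt \<rho> x y *
        ln (2 ^ N * \<alpha> x / (\<Sum>x\<in>cube N. \<alpha> x * tilt \<rho> x y)))"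
  using assms(2,3)
proof (induction N arbitrary: \<alpha> \<beta>)
  case (Suc N)
  define g where "g y a = (\<Sum>x\<in>cube N. \<alpha> (a # x) * tilt \<rho> x y)" for a y
  have g_eq: "g y = (\<lambda>a. \<Sum>x\<in>cube N. \<alpha> (a # x) * tilt \<rho> x y)" for y
    by (simp add: g_def fun_eq_iff)
  have gnn: "g y a \<ge> 0" for y a
    unfolding g_def using Suc.prems tilt_pos[OF \<rho>] by (intro sum_nonneg mult_nonneg_nonneg) (auto intro: less_imp_le)
  have IH: "hybrid \<rho> (\<lambda>p q x y. ln (1 + p * x) - ln (1 + \<rho> * p * y)) N (\<lambda>x. \<alpha> (a # x))
        (\<lambda>y. \<Sum>b\<in>UNIV. \<beta> (b # y) * (1 + \<rho> * pm a * pm b)) =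
     (\<Sum>x\<in>cube N. \<Sum>y\<in>cube N. \<alpha> (a # x) * (\<Sum>b\<in>UNIV. \<beta> (b # y) * (1 + \<rho> * pm a * pm b)) * tilt \<rho> x y *
        ln (2 ^ N * \<alpha> (a # x) / g y a))" for a
    unfolding g_def using Suc.prems
    by (intro Suc.IH sum_nonneg mult_nonneg_nonneg less_imp_le[OF one_plus_tilt_pos[OF \<rho>]]) auto
  show ?case
    unfolding hybrid.simps local_sum_def IH
  proof (subst sum_cube_peel[where f="\<lambda>a b y. ln (1 + bias (g y) * pm a) - ln (1 + \<rho> * bias (g y) * pm b)"
        and v="\<lambda>a x y. ln (2 ^ N * \<alpha> (a # x) / g y a)"])
    fix a b x y assume xy: "x \<in> cube N" "y \<in> cube N" "\<alpha> (a # x) \<noteq> 0" "\<beta> (b # y) \<noteq> 0"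
    have pos: "\<alpha> (a # x) > 0" using xy Suc.prems by (simp add: less_le)
    have ga: "g y a > 0"
      unfolding g_def using sum_cube_tilt_pos(1)[of \<rho> "\<lambda>x. \<alpha> (a # x)" x N y] xy \<rho> Suc.prems by simp
    have s: "g y True + g y False > 0"
      using ga gnn[of y True] gnn[of y False] by (cases a) (auto intro: add_pos_nonneg add_nonneg_pos)
    have p: "1 + \<rho> * bias (g y) * pm b > 0"
      by (intro one_plus_bound \<rho> bias_bounds gnn)
    have eq: "g y a = (g y True + g y False) / 2 * (1 + bias (g y) * pm a)"
      by (rule bias_eq; rule gnn)
    then have pa: "1 + bias (g y) * pm a > 0"
      using ga s by (metis divide_pos_pos zero_less_mult_pos zero_less_numeral)
    have "(\<Sum>x\<in>cube (Suc N). \<alpha> x * tilt \<rho> x (b # y)) = (\<Sum>a\<in>UNIV. g y a * (1 + \<rho> * pm a * pm b))"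
      by (simp add: sum_cube_Suc g_def sum_distrib_right sum_distrib_left mult_ac)
    also have "\<dots> = (g y True + g y False) * (1 + \<rho> * bias (g y) * pm b)"
      by (rule sum_bool_one_plus(1)) (rule gnn)
    finally have S: "(\<Sum>x\<in>cube (Suc N). \<alpha> x * tilt \<rho> x (b # y)) = \<dots>" .
    have "2 ^ Suc N * \<alpha> (a # x) / (\<Sum>x\<in>cube (Suc N). \<alpha> x * tilt \<rho> x (b # y))
      = (1 + bias (g y) * pm a) / (1 + \<rho> * bias (g y) * pm b) * (2 ^ N * \<alpha> (a # x) / g y a)"
      unfolding S eq using s p pa by (simp add: divide_simps)
    then show "ln (2 ^ Suc N * \<alpha> (a # x) / (\<Sum>x\<in>cube (Suc N). \<alpha> x * tilt \<rho> x (b # y))) =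
      ln (1 + bias (g y) * pm a) - ln (1 + \<rho> * bias (g y) * pm b) + ln (2 ^ N * \<alpha> (a # x) / g y a)"
      using s p pa ga pos by (simp add: ln_mult ln_div del: power_Suc)
  qed (simp add: g_eq)
qed simp

text \<open>The same chain rule for \<open>y\<close> when \<open>x\<close> is known, with the signs
  of \<open>y\<close> revealed from the last to the first. The head of \<open>y\<close> is therefore
  summed out, into \<open>t\<close>, before the tail is treated.\<close>

lemma hybrid_right:
  assumes \<rho>: "\<bar>\<rho>\<bar> < 1" and "\<And>x. \<alpha> x \<ge> 0" "\<And>y. \<beta> y \<ge> 0"
  shows "hybrid \<rho> (\<lambda>p q x y. ln (1 + q * y) - ln (1 + \<rho> * q * x)) N \<alpha> \<beta> =
     (\<Sum>x\<in>cube N. \<Sum>y\<in>cube N. \<alpha> x * \<beta> y * tilt \<rho> x y *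
        ln (2 ^ N * \<beta> y / (\<Sum>y\<in>cube N. \<beta> y * tilt \<rho> x y)))"
  using assms(2,3)
proof (induction N arbitrary: \<alpha> \<beta>)
  case (Suc N)
  define h where "h y b = \<beta> (b # y)" for b y
  have h_eq: "h y = (\<lambda>b. \<beta> (b # y))" for y
    by (simp add: h_def fun_eq_iff)
  have hnn: "h y b \<ge> 0" for y b
    unfolding h_def using Suc.prems by simp
  define t where "t a y = (\<Sum>b\<in>UNIV. \<beta> (b # y) * (1 + \<rho> * pm a * pm b))" for a y
  have tnn: "t a y \<ge> 0" for a y
    unfolding t_def using Suc.prems
    by (intro sum_nonneg mult_nonneg_nonneg less_imp_le[OF one_plus_tilt_pos[OF \<rho>]]) auto
  have IH: "hybrid \<rho> (\<lambda>p q x y. ln (1 + q * y) - ln (1 + \<rho> * q * x)) N (\<lambda>x. \<alpha> (a # x)) (t a) =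
     (\<Sum>x\<in>cube N. \<Sum>y\<in>cube N. \<alpha> (a # x) * t a y * tilt \<rho> x y *
        ln (2 ^ N * t a y / (\<Sum>y\<in>cube N. t a y * tilt \<rho> x y)))" for a
    using Suc.prems tnn by (intro Suc.IH) auto
  show ?case
    unfolding hybrid.simps local_sum_def t_def[symmetric] IH
  proof (subst sum_cube_peel[where f="\<lambda>a b y. ln (1 + bias (h y) * pm b) - ln (1 + \<rho> * bias (h y) * pm a)"
        and v="\<lambda>a x y. ln (2 ^ N * t a y / (\<Sum>y\<in>cube N. t a y * tilt \<rho> x y))"])
    fix a b x y assume xy: "x \<in> cube N" "y \<in> cube N" "\<alpha> (a # x) \<noteq> 0" "\<beta> (b # y) \<noteq> 0"
    have pos: "h y b > 0" using xy Suc.prems by (simp add: less_le h_def)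
    have s: "h y True + h y False > 0"
      using pos hnn[of y True] hnn[of y False] by (cases b) (auto intro: add_pos_nonneg add_nonneg_pos)
    have p: "1 + \<rho> * bias (h y) * pm a > 0"
      by (intro one_plus_bound \<rho> bias_bounds hnn)
    have eq: "h y b = (h y True + h y False) / 2 * (1 + bias (h y) * pm b)"
      by (rule bias_eq; rule hnn)
    then have pa: "1 + bias (h y) * pm b > 0"
      using pos s by (metis divide_pos_pos zero_less_mult_pos zero_less_numeral)
    have t: "t a y = (h y True + h y False) * (1 + \<rho> * bias (h y) * pm a)"
      unfolding t_def h_def[symmetric] by (rule sum_bool_one_plus(2)) (rule hnn)
    then have tpos: "t a y > 0" using s p by simp
    have S: "(\<Sum>y\<in>cube (Suc N). \<beta> y * tilt \<rho> (a # x) y) = (\<Sum>y\<in>cube N. t a y * tilt \<rho> x y)"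
      unfolding sum_cube_Suc
      by (subst sum.swap) (simp add: t_def sum_distrib_right sum_distrib_left mult_ac)
    have Spos: "(\<Sum>y\<in>cube N. t a y * tilt \<rho> x y) > 0"
      using sum_cube_tilt_pos(2)[of \<rho> "t a" y N x] \<rho> tnn tpos xy by simp
    have "2 ^ Suc N * \<beta> (b # y) / (\<Sum>y\<in>cube (Suc N). \<beta> y * tilt \<rho> (a # x) y)
      = (1 + bias (h y) * pm b) / (1 + \<rho> * bias (h y) * pm a) * (2 ^ N * t a y / (\<Sum>y\<in>cube N. t a y * tilt \<rho> x y))"
      unfolding S h_def[symmetric] eq t using s p pa by (simp add: divide_simps)
    then show "ln (2 ^ Suc N * \<beta> (b # y) / (\<Sum>y\<in>cube (Suc N). \<beta> y * tilt \<rho> (a # x) y)) =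
      ln (1 + bias (h y) * pm b) - ln (1 + \<rho> * bias (h y) * pm a)
        + ln (2 ^ N * t a y / (\<Sum>y\<in>cube N. t a y * tilt \<rho> x y))"
      using s p pa tpos Spos by (simp add: ln_mult ln_div del: power_Suc)
  qed (simp add: h_eq t_def)
qed simp

text \<open>Bounds the mean change of the log-ratio of tilted to plain mass when one coordinate is
  peeled off. With \<open>y\<close> summed out, \<open>x\<close> has the law \<open>r a / m\<close>
  under the tilted weights; putting it in place of \<open>c a / C\<close> inside the logarithm can
  only increase the mean, by Gibbs' inequality.\<close>

lemma local_sum_gibbs:
  assumes \<rho>: "\<bar>\<rho>\<bar> < 1" and g: "\<And>a. g a \<ge> 0" and h: "\<And>b. h b \<ge> 0"
    and c: "\<And>a. c a \<ge> 0" "\<And>a. g a > 0 \<Longrightarrow> c a > 0"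
  shows "(\<Sum>a\<in>UNIV. \<Sum>b\<in>UNIV. g a * h b * (1 + \<rho> * pm a * pm b) *
      (ln ((g True + g False) * (1 + \<rho> * bias g * pm b) / (c True + c False)) - ln (g a / c a)))
    \<le> local_sum \<rho> (\<lambda>p q x y. ln (1 + \<rho> * p * y) + ln (1 + \<rho> * q * x) - ln (1 + \<rho> * p * q)) g h"
proof -
  define p where "p = bias g"
  define q where "q = bias h"
  define s where "s = g True + g False"
  define t where "t = h True + h False"
  define C where "C = c True + c False"
  define r where "r a = (1 + p * pm a) * (1 + \<rho> * q * pm a)" for a
  define m where "m = 2 * (1 + \<rho> * p * q)"
  have p1: "\<bar>p\<bar> \<le> 1" and q1: "\<bar>q\<bar> \<le> 1"
    unfolding p_def q_def by (intro bias_bounds g h)+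
  have rq: "1 + \<rho> * q * pm a > 0" and rp: "1 + \<rho> * p * pm a > 0" for a
    using one_plus_bound[OF \<rho> p1] one_plus_bound[OF \<rho> q1] by auto
  have "\<bar>p * q\<bar> \<le> 1" using p1 q1 by (simp add: abs_mult mult_le_one)
  then have pq: "1 + \<rho> * p * q > 0"
    using one_plus_bound[OF \<rho>, of "p * q" True] by simp
  have ga: "g a = s / 2 * (1 + p * pm a)" and ht: "(\<Sum>b\<in>UNIV. h b * (1 + \<rho> * pm a * pm b)) = t * (1 + \<rho> * q * pm a)" for a
    unfolding s_def p_def t_def q_def using bias_eq[of g a, OF g g] sum_bool_one_plus(2)[of h \<rho> a, OF h] by auto
  have st: "s \<ge> 0" "t \<ge> 0" "C \<ge> 0" unfolding s_def t_def C_def using g h c by (auto intro: add_nonneg_nonneg)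
  have term_le: "g a * h b * (1 + \<rho> * pm a * pm b) * (ln (s * (1 + \<rho> * p * pm b) / C) - ln (g a / c a))
     \<le> g a * h b * (1 + \<rho> * pm a * pm b) *
        (ln (1 + \<rho> * p * pm b) + ln (1 + \<rho> * q * pm a) - ln (1 + \<rho> * p * q) + (c a / C * m / r a - 1))" for a b
  proof (cases "g a = 0")
    case False
    then have gp: "g a > 0" using g[of a] by simp
    have sp: "s > 0" using False ga st(1) by (cases "s = 0") auto
    have pa: "1 + p * pm a > 0"
      using gp ga[of a] sp by (metis divide_pos_pos zero_less_mult_pos zero_less_numeral)
    have cp: "c a > 0" using c(2) gp by blast
    have Cp: "C > 0" using cp c(1)[of True] c(1)[of False] unfolding C_def
      by (cases a) (auto intro: add_pos_nonneg add_nonneg_pos)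
    have rap: "r a > 0" unfolding r_def using pa rq by simp
    have mp: "m > 0" unfolding m_def using pq by simp
    have "ln (s * (1 + \<rho> * p * pm b) / C) - ln (g a / c a) =
        ln (1 + \<rho> * p * pm b) + ln (1 + \<rho> * q * pm a) - ln (1 + \<rho> * p * q) + ln (c a / C * m / r a)"
    proof -
      have "ln m = ln 2 + ln (1 + \<rho> * p * q)" unfolding m_def using pq by (subst ln_mult) auto
      moreover have "ln (r a) = ln (1 + p * pm a) + ln (1 + \<rho> * q * pm a)"
        unfolding r_def using pa rq[of a] by (subst ln_mult) auto
      moreover have "ln (g a) = ln s - ln 2 + ln (1 + p * pm a)"
        unfolding ga[of a] using pa sp by (subst ln_mult) (auto simp: ln_div)
      ultimately show ?thesis
        using sp cp Cp rap mp gp rp[of b] by (simp add: ln_mult ln_div)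
    qed
    also have "ln (c a / C * m / r a) \<le> c a / C * m / r a - 1"
      using cp Cp mp rap by (intro ln_le_minus_one) simp
    finally show ?thesis
      using g h less_imp_le[OF one_plus_tilt_pos[OF \<rho>]] by (intro mult_left_mono mult_nonneg_nonneg) auto
  qed simp
  have "(\<Sum>a\<in>UNIV. \<Sum>b\<in>UNIV. g a * h b * (1 + \<rho> * pm a * pm b) * (c a / C * m / r a - 1))
     = (\<Sum>a\<in>UNIV. g a * (c a / C * m / r a - 1) * (t * (1 + \<rho> * q * pm a)))"
    unfolding ht[symmetric] sum_distrib_left by (simp add: mult_ac)
  also have "\<dots> = s * t / 2 * (\<Sum>a\<in>UNIV. r a * (c a / C * m / r a - 1))"
    unfolding sum_distrib_left by (intro sum.cong refl, subst ga) (simp add: r_def mult_ac)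
  also have "(\<Sum>a\<in>UNIV. r a * (c a / C * m / r a - 1)) \<le> (\<Sum>a\<in>UNIV. c a / C * m - r a)"
  proof (intro sum_mono)
    fix a
    have "c a / C * m \<ge> 0" unfolding m_def using c(1)[of a] st pq by simp
    then show "r a * (c a / C * m / r a - 1) \<le> c a / C * m - r a"
      by (cases "r a = 0") (auto simp: field_simps)
  qed
  also have "\<dots> = (C / C) * m - m"
  proof -
    have "r True + r False = m" by (simp add: r_def m_def algebra_simps)
    moreover have "c True / C * m + c False / C * m = C / C * m"
      by (simp only: C_def flip: distrib_right add_divide_distrib)
    ultimately show ?thesis by (simp add: sum_bool)
  qed
  also have "\<dots> \<le> 0" unfolding m_def using pq by simp
  finally have le0: "(\<Sum>a\<in>UNIV. \<Sum>b\<in>UNIV. g a * h b * (1 + \<rho> * pm a * pm b) * (c a / C * m / r a - 1)) \<le> 0"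
    using st by (simp add: mult_left_mono mult_nonneg_nonpos)
  have "(\<Sum>a\<in>UNIV. \<Sum>b\<in>UNIV. g a * h b * (1 + \<rho> * pm a * pm b) *
      (ln (s * (1 + \<rho> * p * pm b) / C) - ln (g a / c a)))
    \<le> (\<Sum>a\<in>UNIV. \<Sum>b\<in>UNIV. g a * h b * (1 + \<rho> * pm a * pm b) *
        (ln (1 + \<rho> * p * pm b) + ln (1 + \<rho> * q * pm a) - ln (1 + \<rho> * p * q) + (c a / C * m / r a - 1)))"
    by (intro sum_mono term_le)
  also have "\<dots> = local_sum \<rho> (\<lambda>p q x y. ln (1 + \<rho> * p * y) + ln (1 + \<rho> * q * x) - ln (1 + \<rho> * p * q)) g h
     + (\<Sum>a\<in>UNIV. \<Sum>b\<in>UNIV. g a * h b * (1 + \<rho> * pm a * pm b) * (c a / C * m / r a - 1))"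
    unfolding local_sum_def p_def[symmetric] q_def[symmetric] sum.distrib[symmetric]
    by (intro sum.cong refl) (simp only: distrib_left)
  finally show ?thesis using le0 unfolding s_def p_def C_def by simp
qed

text \<open>The log-ratio on the left telescopes over the coordinates, and
  \<open>local_sum_gibbs\<close> bounds each increment. The resulting bound involves only biases and
  signs, so it can be compared one coordinate at a time.\<close>

lemma hybrid_entropy_bound:
  assumes \<rho>: "\<bar>\<rho>\<bar> < 1" and "\<And>x. \<alpha> x \<ge> 0" "\<And>y. \<beta> y \<ge> 0"
  shows "(\<Sum>x\<in>cube N. \<Sum>y\<in>cube N. \<alpha> x * \<beta> y * tilt \<rho> x y *
        ln ((\<Sum>x\<in>cube N. \<alpha> x * tilt \<rho> x y) / (\<Sum>x\<in>cube N. \<alpha> x)))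
     \<le> hybrid \<rho> (\<lambda>p q x y. ln (1 + \<rho> * p * y) + ln (1 + \<rho> * q * x) - ln (1 + \<rho> * p * q)) N \<alpha> \<beta>"
  using assms(2,3)
proof (induction N arbitrary: \<alpha> \<beta>)
  case (Suc N)
  define g where "g y a = (\<Sum>x\<in>cube N. \<alpha> (a # x) * tilt \<rho> x y)" for a y
  define c where "c a = (\<Sum>x\<in>cube N. \<alpha> (a # x))" for a
  have g_eq: "g y = (\<lambda>a. \<Sum>x\<in>cube N. \<alpha> (a # x) * tilt \<rho> x y)" for y
    by (simp add: g_def fun_eq_iff)
  have gnn: "g y a \<ge> 0" for y a
    unfolding g_def using Suc.prems tilt_pos[OF \<rho>] by (intro sum_nonneg mult_nonneg_nonneg) (auto intro: less_imp_le)
  have cnn: "c a \<ge> 0" for a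
    unfolding c_def using Suc.prems by (intro sum_nonneg) auto
  have gc: "c a > 0" if "g y a > 0" for y a
  proof (rule ccontr)
    assume "\<not> c a > 0"
    then have "c a = 0" using cnn[of a] by simp
    then have "\<forall>x\<in>cube N. \<alpha> (a # x) = 0"
      unfolding c_def using Suc.prems by (subst (asm) sum_nonneg_eq_0_iff) auto
    then show False using that by (simp add: g_def)
  qed
  have IH: "(\<Sum>x\<in>cube N. \<Sum>y\<in>cube N. \<alpha> (a # x) * (\<Sum>b\<in>UNIV. \<beta> (b # y) * (1 + \<rho> * pm a * pm b)) * tilt \<rho> x y *
        ln (g y a / c a)) \<le>
     hybrid \<rho> (\<lambda>p q x y. ln (1 + \<rho> * p * y) + ln (1 + \<rho> * q * x) - ln (1 + \<rho> * p * q)) N (\<lambda>x. \<alpha> (a # x))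
        (\<lambda>y. \<Sum>b\<in>UNIV. \<beta> (b # y) * (1 + \<rho> * pm a * pm b))" for a
    unfolding g_def c_def using Suc.prems
    by (intro Suc.IH sum_nonneg mult_nonneg_nonneg less_imp_le[OF one_plus_tilt_pos[OF \<rho>]]) auto
  have S: "(\<Sum>x\<in>cube (Suc N). \<alpha> x * tilt \<rho> x (b # y)) = (g y True + g y False) * (1 + \<rho> * bias (g y) * pm b)" for b y
  proof -
    have "(\<Sum>x\<in>cube (Suc N). \<alpha> x * tilt \<rho> x (b # y)) = (\<Sum>a\<in>UNIV. g y a * (1 + \<rho> * pm a * pm b))"
      by (simp add: sum_cube_Suc g_def sum_distrib_right sum_distrib_left mult_ac)
    also have "\<dots> = (g y True + g y False) * (1 + \<rho> * bias (g y) * pm b)"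
      by (rule sum_bool_one_plus(1)) (rule gnn)
    finally show ?thesis .
  qed
  have c: "(\<Sum>x\<in>cube (Suc N). \<alpha> x) = c True + c False"
    by (simp add: sum_cube_Suc sum_bool c_def)
  have "(\<Sum>x\<in>cube (Suc N). \<Sum>y\<in>cube (Suc N). \<alpha> x * \<beta> y * tilt \<rho> x y *
        ln ((\<Sum>x\<in>cube (Suc N). \<alpha> x * tilt \<rho> x y) / (\<Sum>x\<in>cube (Suc N). \<alpha> x))) =
    (\<Sum>y\<in>cube N. \<Sum>a\<in>UNIV. \<Sum>b\<in>UNIV. g y a * \<beta> (b # y) * (1 + \<rho> * pm a * pm b) *
       (ln ((g y True + g y False) * (1 + \<rho> * bias (g y) * pm b) / (c True + c False)) - ln (g y a / c a)))
    + (\<Sum>a\<in>UNIV. \<Sum>x\<in>cube N. \<Sum>y\<in>cube N.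
       \<alpha> (a # x) * (\<Sum>b\<in>UNIV. \<beta> (b # y) * (1 + \<rho> * pm a * pm b)) * tilt \<rho> x y * ln (g y a / c a))"
    unfolding g_def[symmetric]
    by (subst sum_cube_peel[where
          f="\<lambda>a b y. ln ((g y True + g y False) * (1 + \<rho> * bias (g y) * pm b) / (c True + c False)) - ln (g y a / c a)"
          and v="\<lambda>a x y. ln (g y a / c a)"]) (simp_all add: S c g_def)
  also have "\<dots> \<le> hybrid \<rho> (\<lambda>p q x y. ln (1 + \<rho> * p * y) + ln (1 + \<rho> * q * x) - ln (1 + \<rho> * p * q)) (Suc N) \<alpha> \<beta>"
    unfolding hybrid.simps g_eq[symmetric]
    by (intro add_mono sum_mono IH local_sum_gibbs \<rho> gnn Suc.prems cnn gc)
  finally show ?case .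
qed simp

section \<open>Logarithmic inequalities on one coordinate\<close>

text \<open>With r = sqrt (1 + t), the inequality ln r \<ge> 1 - 1 / r gives the lower bound t + (r
  - 1)^2, and (r - 1)^2 = t^2 / (r + 1)^2 with (r + 1)^2 \<le> 6.\<close>

lemma mult_ln_ge:
  fixes t :: real
  assumes "-1 \<le> t" "t \<le> 1"
  shows "(1 + t) * ln (1 + t) \<ge> t + t\<^sup>2 / 6"
proof (cases "t = -1")
  case False
  define r where "r = sqrt (1 + t)"
  have r: "r > 0" "r\<^sup>2 = 1 + t" using assms False by (auto simp: r_def)
  \<comment> \<open>1.42 is just above sqrt 2, and 2.42^2 is still below 6.\<close>
  have r2: "r \<le> 1.42"
    unfolding r_def using assms by (intro real_le_lsqrt) (auto simp: power2_eq_square)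
  have "ln (1 / r) \<le> 1 / r - 1" using r by (intro ln_le_minus_one) simp
  then have "ln r \<ge> 1 - 1 / r" using r by (simp add: ln_div)
  moreover have "ln (1 + t) = 2 * ln r"
    using r by (simp flip: r(2) add: ln_realpow)
  ultimately have "(1 + t) * ln (1 + t) \<ge> r\<^sup>2 * (2 * (1 - 1 / r))"
    unfolding r(2)[symmetric] by (intro mult_left_mono) auto
  also have "r\<^sup>2 * (2 * (1 - 1 / r)) = 2 * r\<^sup>2 - 2 * r"
    using r by (simp add: power2_eq_square field_simps)
  also have "2 * r\<^sup>2 - 2 * r = t + (r - 1)\<^sup>2"
    using r(2) by (simp add: power2_eq_square algebra_simps)
  finally have 1: "(1 + t) * ln (1 + t) \<ge> t + (r - 1)\<^sup>2" .
  have "t\<^sup>2 = (r - 1)\<^sup>2 * (r + 1)\<^sup>2"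
    using r(2) by (simp flip: power_mult_distrib) (simp add: power2_eq_square algebra_simps)
  also have "\<dots> \<le> (r - 1)\<^sup>2 * 6"
  proof (intro mult_left_mono)
    have "(r + 1)\<^sup>2 \<le> (1.42 + 1)\<^sup>2" using r r2 by (intro power_mono) auto
    also have "\<dots> \<le> (6::real)" by (simp add: power2_eq_square)
    finally show "(r + 1)\<^sup>2 \<le> 6" .
  qed simp
  finally show ?thesis using 1 by simp
qed simp

lemma mult_ln_le: "(1 + t) * ln (1 + t) \<le> t + t\<^sup>2" if "-1 \<le> t" for t :: real
proof (cases "t = -1")
  case False
  then have "ln (1 + t) \<le> t" using that ln_le_minus_one[of "1 + t"] by simp
  then have "(1 + t) * ln (1 + t) \<le> (1 + t) * t" using that by (intro mult_left_mono) auto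
  then show ?thesis by (simp add: power2_eq_square algebra_simps)
qed simp

lemma mult_ln_diff:
  fixes p :: real
  assumes "\<bar>p\<bar> \<le> 1"
  shows "\<bar>(1 + p) * ln (1 + p) - (1 - p) * ln (1 - p)\<bar> \<le> 3 * \<bar>p\<bar>"
proof -
  have "p\<^sup>2 \<le> \<bar>p\<bar>"
    using mult_left_le[of "\<bar>p\<bar>" "\<bar>p\<bar>"] assms by (simp add: power2_eq_square flip: abs_mult)
  moreover have "p\<^sup>2 \<ge> 0" by simp
  ultimately show ?thesis
    using mult_ln_ge[of p] mult_ln_ge[of "-p"] mult_ln_le[of p] mult_ln_le[of "-p"] assms
    by (simp add: abs_le_iff) linarith
qed

text \<open>Up to the factor 2, summing over the other sign leaves (1 + p) ln (1 + p) + (1 - p) ln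
  (1 - p), which is at least p^2 / 3, and a correction due to the correlation, of size at most 3
  \<rho> |p q|.\<close>

lemma avg4_ln_ge:
  assumes "0 \<le> \<rho>" "\<bar>p\<bar> \<le> 1" "\<bar>q\<bar> \<le> 1"
  shows "avg4 \<rho> p q (\<lambda>x y. ln (1 + p * x)) \<ge> 2 * (p\<^sup>2 / 3 - 3 * \<rho> * \<bar>p * q\<bar>)"
    and "avg4 \<rho> p q (\<lambda>x y. ln (1 + q * y)) \<ge> 2 * (q\<^sup>2 / 3 - 3 * \<rho> * \<bar>p * q\<bar>)"
proof -
  have *: "(1 + p) * ln (1 + p) + (1 - p) * ln (1 - p) + \<rho> * q * ((1 + p) * ln (1 + p) - (1 - p) * ln (1 - p))
      \<ge> p\<^sup>2 / 3 - 3 * \<rho> * \<bar>p * q\<bar>" if "\<bar>p\<bar> \<le> 1" "\<bar>q\<bar> \<le> 1" for p q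
  proof -
    have "\<bar>\<rho> * q * ((1 + p) * ln (1 + p) - (1 - p) * ln (1 - p))\<bar> \<le> \<bar>\<rho> * q\<bar> * (3 * \<bar>p\<bar>)"
      unfolding abs_mult[of "\<rho> * q"] by (intro mult_left_mono mult_ln_diff that) simp
    also have "\<dots> = 3 * \<rho> * \<bar>p * q\<bar>" using assms(1) by (simp add: abs_mult)
    finally show ?thesis
      using mult_ln_ge[of p] mult_ln_ge[of "-p"] that by (simp add: abs_le_iff)
  qed
  have "avg4 \<rho> p q (\<lambda>x y. ln (1 + p * x)) = 2 * ((1 + p) * ln (1 + p) + (1 - p) * ln (1 - p)
      + \<rho> * q * ((1 + p) * ln (1 + p) - (1 - p) * ln (1 - p)))"
    by (simp add: avg4_def sum_bool algebra_simps)
  then show "avg4 \<rho> p q (\<lambda>x y. ln (1 + p * x)) \<ge> 2 * (p\<^sup>2 / 3 - 3 * \<rho> * \<bar>p * q\<bar>)"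
    using *[OF assms(2,3)] by simp
  have "avg4 \<rho> p q (\<lambda>x y. ln (1 + q * y)) = 2 * ((1 + q) * ln (1 + q) + (1 - q) * ln (1 - q)
      + \<rho> * p * ((1 + q) * ln (1 + q) - (1 - q) * ln (1 - q)))"
    by (simp add: avg4_def sum_bool algebra_simps)
  then show "avg4 \<rho> p q (\<lambda>x y. ln (1 + q * y)) \<ge> 2 * (q\<^sup>2 / 3 - 3 * \<rho> * \<bar>p * q\<bar>)"
    using *[OF assms(3,2)] by (simp add: mult.commute[of q p])
qed

lemma avg4_mono:
  assumes "\<bar>\<rho>\<bar> < 1" "\<bar>p\<bar> \<le> 1" "\<bar>q\<bar> \<le> 1" "\<And>a b. \<phi> (pm a) (pm b) \<le> \<psi> (pm a) (pm b)"
  shows "avg4 \<rho> p q \<phi> \<le> avg4 \<rho> p q \<psi>"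
proof -
  have "1 + r * pm a \<ge> 0" if "\<bar>r\<bar> \<le> 1" for r a
    using that by (cases a) auto
  then show ?thesis
    unfolding avg4_def
    using assms(2,3)
    by (intro sum_mono mult_left_mono mult_nonneg_nonneg assms(1,4) less_imp_le[OF one_plus_tilt_pos]) auto
qed

lemma avg4_add: "avg4 \<rho> p q (\<lambda>x y. \<phi> x y + \<psi> x y) = avg4 \<rho> p q \<phi> + avg4 \<rho> p q \<psi>"
  unfolding avg4_def by (simp only: distrib_left[of "_ * (1 + \<rho> * pm _ * pm _)"] sum.distrib)

lemma avg4_scale: "avg4 \<rho> p q (\<lambda>x y. c * \<phi> x y) = c * avg4 \<rho> p q \<phi>"
  unfolding avg4_def by (simp add: sum_distrib_left mult_ac)

lemma avg4_diff: "avg4 \<rho> p q (\<lambda>x y. \<phi> x y - \<psi> x y) = avg4 \<rho> p q \<phi> - avg4 \<rho> p q \<psi>"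
  using avg4_add[of \<rho> p q \<phi> "\<lambda>x y. -1 * \<psi> x y"] avg4_scale[of \<rho> p q "-1" \<psi>] by simp

lemma avg4_ln_tilt_le:
  assumes "\<bar>\<rho>\<bar> < 1" "\<bar>p\<bar> \<le> 1" "\<bar>q\<bar> \<le> 1"
  shows "avg4 \<rho> p q (\<lambda>x y. ln (1 + \<rho> * p * y)) \<le> 4 * \<rho> * p * q + 4 * \<rho>\<^sup>2 * p\<^sup>2"
    and "avg4 \<rho> p q (\<lambda>x y. ln (1 + \<rho> * q * x)) \<le> 4 * \<rho> * p * q + 4 * \<rho>\<^sup>2 * q\<^sup>2"
proof -
  have ln: "ln (1 + \<rho> * r * pm b) \<le> \<rho> * r * pm b" if "\<bar>r\<bar> \<le> 1" for r b
    using ln_le_minus_one[OF one_plus_bound[OF assms(1) that]] by simp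
  have "avg4 \<rho> p q (\<lambda>x y. ln (1 + \<rho> * p * y)) \<le> avg4 \<rho> p q (\<lambda>x y. \<rho> * p * y)"
    by (intro avg4_mono assms ln)
  also have "\<dots> = 4 * \<rho> * p * q + 4 * \<rho>\<^sup>2 * p\<^sup>2"
    by (simp add: avg4_def sum_bool algebra_simps power2_eq_square)
  finally show "avg4 \<rho> p q (\<lambda>x y. ln (1 + \<rho> * p * y)) \<le> \<dots>" .
  have "avg4 \<rho> p q (\<lambda>x y. ln (1 + \<rho> * q * x)) \<le> avg4 \<rho> p q (\<lambda>x y. \<rho> * q * x)"
    by (intro avg4_mono assms ln)
  also have "\<dots> = 4 * \<rho> * p * q + 4 * \<rho>\<^sup>2 * q\<^sup>2"
    by (simp add: avg4_def sum_bool algebra_simps power2_eq_square)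
  finally show "avg4 \<rho> p q (\<lambda>x y. ln (1 + \<rho> * q * x)) \<le> \<dots>" .
qed

text \<open>To first order the left side is 4 \<rho> p q: the first two logarithms contribute this
  term once each and the third takes it back once. The factor
  \<open>\<rho> / (1 - \<rho>\<^sup>2)\<close> makes the last term on the right exactly 4 \<rho> p
  q. The remaining 4 \<rho>^2 (p^2 + q^2) is covered by the information terms, whose sum is at least
  (p^2 + q^2) / 2; hence the constant 8.\<close>

lemma avg4_main:
  assumes \<rho>: "0 \<le> \<rho>" "\<rho> \<le> 1 / 100" and p: "\<bar>p\<bar> \<le> 1" and q: "\<bar>q\<bar> \<le> 1"
  shows "avg4 \<rho> p q (\<lambda>x y. ln (1 + \<rho> * p * y) + ln (1 + \<rho> * q * x) - ln (1 + \<rho> * p * q))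
    \<le> avg4 \<rho> p q (\<lambda>x y. 8 * \<rho>\<^sup>2 * ((ln (1 + p * x) - ln (1 + \<rho> * p * y)) + (ln (1 + q * y) - ln (1 + \<rho> * q * x)))
        + \<rho> / (1 - \<rho>\<^sup>2) * (x * y - \<rho>))"
proof -
  have \<rho>1: "\<bar>\<rho>\<bar> < 1" using \<rho> by simp
  have "\<bar>p * q\<bar> \<le> 1" using p q by (simp add: abs_mult mult_le_one)
  then have pq: "1 + \<rho> * p * q > 0"
    using one_plus_bound[OF \<rho>1, of "p * q" True] by simp
  have ln: "- ln (1 + \<rho> * p * q) \<le> - (\<rho> * p * q) / (1 + \<rho> * p * q)"
  proof -
    have "ln (1 / (1 + \<rho> * p * q)) \<le> 1 / (1 + \<rho> * p * q) - 1"
      using pq by (intro ln_le_minus_one) simp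
    then show ?thesis using pq by (simp add: ln_div field_simps)
  qed
  let ?L1 = "avg4 \<rho> p q (\<lambda>x y. ln (1 + \<rho> * p * y))" and ?L2 = "avg4 \<rho> p q (\<lambda>x y. ln (1 + \<rho> * q * x))"
  let ?M1 = "avg4 \<rho> p q (\<lambda>x y. ln (1 + p * x))" and ?M2 = "avg4 \<rho> p q (\<lambda>x y. ln (1 + q * y))"
  have "avg4 \<rho> p q (\<lambda>x y. ln (1 + \<rho> * p * y) + ln (1 + \<rho> * q * x) - ln (1 + \<rho> * p * q))
     = ?L1 + ?L2 + 4 * (1 + \<rho> * p * q) * (- ln (1 + \<rho> * p * q))"
    by (simp add: avg4_def sum_bool algebra_simps)
  also have "4 * (1 + \<rho> * p * q) * (- ln (1 + \<rho> * p * q)) \<le> 4 * (1 + \<rho> * p * q) * (- (\<rho> * p * q) / (1 + \<rho> * p * q))"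
    using pq by (intro mult_left_mono ln) simp
  also have "\<dots> = - 4 * \<rho> * p * q" using pq by (simp add: field_simps)
  finally have 1: "avg4 \<rho> p q (\<lambda>x y. ln (1 + \<rho> * p * y) + ln (1 + \<rho> * q * x) - ln (1 + \<rho> * p * q))
     \<le> 4 * \<rho> * p * q + 4 * \<rho>\<^sup>2 * (p\<^sup>2 + q\<^sup>2)"
    using avg4_ln_tilt_le[OF \<rho>1 p q] by (simp add: algebra_simps)
  have amgm: "2 * \<bar>p * q\<bar> \<le> p\<^sup>2 + q\<^sup>2"
    using sum_squares_bound[of "\<bar>p\<bar>" "\<bar>q\<bar>"] by (simp add: abs_mult)
  have A: "\<rho> * \<bar>p * q\<bar> \<le> (p\<^sup>2 + q\<^sup>2) / 200"
    using mult_mono[OF \<rho>(2) amgm] \<rho> by simp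
  have "\<rho> * p * q \<le> \<rho> * \<bar>p * q\<bar>" using \<rho> by (simp add: mult.assoc mult_left_mono)
  then have L: "?L1 + ?L2 \<le> 8 * (\<rho> * \<bar>p * q\<bar>) + 4 * (\<rho>\<^sup>2 * (p\<^sup>2 + q\<^sup>2))"
    using avg4_ln_tilt_le[OF \<rho>1 p q] by (simp add: distrib_left)
  have "\<rho>\<^sup>2 * (p\<^sup>2 + q\<^sup>2) \<le> (1/100)\<^sup>2 * (p\<^sup>2 + q\<^sup>2)"
    using \<rho> by (intro mult_right_mono power_mono) auto
  then have B: "\<rho>\<^sup>2 * (p\<^sup>2 + q\<^sup>2) \<le> (p\<^sup>2 + q\<^sup>2) / 10000"
    by (simp add: power2_eq_square[of "1/100"])
  have M: "?M1 + ?M2 \<ge> 2 / 3 * (p\<^sup>2 + q\<^sup>2) - 12 * (\<rho> * \<bar>p * q\<bar>)"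
    using avg4_ln_ge[OF \<rho>(1) p q] by (simp add: field_simps)
  \<comment> \<open>Of the gain 2 / 3, the cross terms cost at most 20 / 200 and the quadratic ones
    4 / 10000, which leaves more than 1 / 2.\<close>
  have H: "?M1 + ?M2 - ?L1 - ?L2 \<ge> (p\<^sup>2 + q\<^sup>2) / 2"
  proof -
    have "s / 2 \<le> m1 + m2 - l1 - l2"
      if "a \<le> s / 200" "l1 + l2 \<le> 8 * a + 4 * b" "b \<le> s / 10000" "2 / 3 * s - 12 * a \<le> m1 + m2" "0 \<le> s"
      for a b s l1 l2 m1 m2 :: real
      using that by linarith
    from this[OF A L B M sum_power2_ge_zero] show ?thesis .
  qed
  have "1 - \<rho>\<^sup>2 > 0" using \<rho>1 by (simp add: abs_square_less_1)
  then have "4 * \<rho> * p * q = \<rho> / (1 - \<rho>\<^sup>2) * (4 * p * q * (1 - \<rho>\<^sup>2))" by simp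
  also have "4 * p * q * (1 - \<rho>\<^sup>2) = avg4 \<rho> p q (\<lambda>x y. x * y - \<rho>)"
    by (simp add: avg4_def sum_bool algebra_simps power2_eq_square)
  finally have "4 * \<rho> * p * q + 4 * \<rho>\<^sup>2 * (p\<^sup>2 + q\<^sup>2) \<le>
      \<rho> / (1 - \<rho>\<^sup>2) * avg4 \<rho> p q (\<lambda>x y. x * y - \<rho>) + 8 * \<rho>\<^sup>2 * (?M1 + ?M2 - ?L1 - ?L2)"
    using mult_left_mono[OF H, of "8 * \<rho>\<^sup>2"] by simp
  also have "\<dots> = avg4 \<rho> p q (\<lambda>x y. 8 * \<rho>\<^sup>2 * ((ln (1 + p * x) - ln (1 + \<rho> * p * y)) + (ln (1 + q * y) - ln (1 + \<rho> * q * x)))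
        + \<rho> / (1 - \<rho>\<^sup>2) * (x * y - \<rho>))"
    by (simp only: avg4_add avg4_diff avg4_scale) (simp add: algebra_simps)
  finally show ?thesis using 1 by linarith
qed

section \<open>Divergence of the transcript laws\<close>

lemma tilt_commute: "tilt \<rho> x y = tilt \<rho> y x"
  by (induction \<rho> x y rule: tilt.induct) (simp_all add: mult_ac)

text \<open>A log-sum inequality: the quotient on the left is the mean, under the normalized weight
  \<open>\<beta>\<close>, of the ratio inside the logarithm on the right, and z ln z is convex. The
  proof uses ln z \<le> z - 1 at \<open>Q / (B * S y)\<close>.\<close>

lemma log_sum_tilt:
  fixes N :: nat and \<rho> :: real and \<alpha> \<beta> :: "bool list \<Rightarrow> real"
  assumes \<rho>: "\<bar>\<rho>\<bar> < 1" and \<alpha>: "\<And>x. \<alpha> x \<ge> 0" and \<beta>: "\<And>y. \<beta> y \<ge> 0"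
  defines "Q \<equiv> (\<Sum>x\<in>cube N. \<Sum>y\<in>cube N. \<alpha> x * \<beta> y * tilt \<rho> x y)"
  shows "Q * ln (Q / ((\<Sum>x\<in>cube N. \<alpha> x) * (\<Sum>y\<in>cube N. \<beta> y))) \<le>
     (\<Sum>x\<in>cube N. \<Sum>y\<in>cube N. \<alpha> x * \<beta> y * tilt \<rho> x y *
        ln ((\<Sum>x\<in>cube N. \<alpha> x * tilt \<rho> x y) / (\<Sum>x\<in>cube N. \<alpha> x)))"
proof -
  define S where "S y = (\<Sum>x\<in>cube N. \<alpha> x * tilt \<rho> x y)" for y
  define A where "A = (\<Sum>x\<in>cube N. \<alpha> x)"
  define B where "B = (\<Sum>y\<in>cube N. \<beta> y)"
  have AB: "A \<ge> 0" "B \<ge> 0" unfolding A_def B_def using \<alpha> \<beta> by (auto intro: sum_nonneg)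
  have w: "\<alpha> x * \<beta> y * tilt \<rho> x y \<ge> 0" for x y
    using \<alpha> \<beta> tilt_pos[OF \<rho>, of x y] by simp
  then have Q0: "Q \<ge> 0" unfolding Q_def by (intro sum_nonneg) auto
  have "\<alpha> x * \<beta> y * tilt \<rho> x y * (ln (Q / (A * B)) - ln (S y / A))
      \<le> \<alpha> x * \<beta> y * tilt \<rho> x y * (Q / (B * S y) - 1)" if xy: "x \<in> cube N" "y \<in> cube N" for x y
  proof (cases "\<alpha> x = 0 \<or> \<beta> y = 0")
    case False
    have "S y > 0" unfolding S_def using sum_cube_tilt_pos(1)[of \<rho> \<alpha> x N y] \<rho> \<alpha> False xy by auto
    moreover have "A > 0" unfolding A_def using \<alpha> False xy
      by (intro sum_pos2[of _ x]) (auto simp: less_le)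
    moreover have "B > 0" unfolding B_def using \<beta> False xy
      by (intro sum_pos2[of _ y]) (auto simp: less_le)
    moreover have "Q > 0"
      unfolding Q_def using w False xy \<alpha> \<beta> tilt_pos[OF \<rho>, of x y]
      by (intro sum_pos2[of _ x] sum_pos2[of _ y] sum_nonneg) (auto simp: less_le)
    ultimately have "ln (Q / (A * B)) - ln (S y / A) = ln (Q / (B * S y))" "Q / (B * S y) > 0"
      by (auto simp: ln_div ln_mult)
    then show ?thesis using w by (auto intro!: mult_left_mono ln_le_minus_one)
  qed auto
  then have "(\<Sum>x\<in>cube N. \<Sum>y\<in>cube N. \<alpha> x * \<beta> y * tilt \<rho> x y * (ln (Q / (A * B)) - ln (S y / A)))
     \<le> (\<Sum>x\<in>cube N. \<Sum>y\<in>cube N. \<alpha> x * \<beta> y * tilt \<rho> x y * (Q / (B * S y) - 1))"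
    by (intro sum_mono)
  also have "\<dots> = (\<Sum>x\<in>cube N. \<Sum>y\<in>cube N. \<alpha> x * tilt \<rho> x y * (\<beta> y * Q / (B * S y))) - Q"
    unfolding Q_def by (simp add: algebra_simps sum_subtractf)
  also have "(\<Sum>x\<in>cube N. \<Sum>y\<in>cube N. \<alpha> x * tilt \<rho> x y * (\<beta> y * Q / (B * S y)))
     = (\<Sum>y\<in>cube N. S y * (\<beta> y * Q / (B * S y)))"
    by (subst sum.swap) (simp only: S_def sum_distrib_right)
  also have "\<dots> \<le> (\<Sum>y\<in>cube N. \<beta> y * Q / B)"
    using Q0 AB \<beta> by (intro sum_mono) (auto simp: field_simps)
  also have "\<dots> = B * Q / B" by (simp add: B_def sum_distrib_right sum_divide_distrib)
  also have "\<dots> \<le> Q" using Q0 by simp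
  finally have "(\<Sum>x\<in>cube N. \<Sum>y\<in>cube N. \<alpha> x * \<beta> y * tilt \<rho> x y * ln (Q / (A * B)))
     - (\<Sum>x\<in>cube N. \<Sum>y\<in>cube N. \<alpha> x * \<beta> y * tilt \<rho> x y * ln (S y / A)) \<le> 0"
    by (simp add: right_diff_distrib sum_subtractf)
  moreover have "(\<Sum>x\<in>cube N. \<Sum>y\<in>cube N. \<alpha> x * \<beta> y * tilt \<rho> x y * ln (Q / (A * B))) = Q * ln (Q / (A * B))"
    unfolding Q_def by (simp only: sum_distrib_right)
  ultimately show ?thesis unfolding A_def B_def S_def by simp
qed

text \<open>\<open>\<alpha>\<close> and \<open>\<beta>\<close> stand for the two factors of the
  probability of one transcript, and \<open>P\<close>, \<open>Q\<close> for its probabilities under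
  the uniform and the tilted law, up to scaling. The bound is \<open>avg4_main\<close> summed over
  the coordinates. Its last term has no definite sign here and cancels only in the sum over all
  transcripts.\<close>

lemma rectangle_divergence_bound:
  fixes N :: nat and \<rho> :: real and \<alpha> \<beta> :: "bool list \<Rightarrow> real"
  assumes \<rho>: "0 \<le> \<rho>" "\<rho> \<le> 1 / 100" and \<alpha>: "\<And>x. \<alpha> x \<ge> 0" and \<beta>: "\<And>y. \<beta> y \<ge> 0"
  defines "Q \<equiv> (\<Sum>x\<in>cube N. \<Sum>y\<in>cube N. \<alpha> x * \<beta> y * tilt \<rho> x y)"
    and "P \<equiv> (\<Sum>x\<in>cube N. \<alpha> x) * (\<Sum>y\<in>cube N. \<beta> y)"
  shows "Q * ln (Q / P) \<le> 8 * \<rho>\<^sup>2 *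
      ((\<Sum>x\<in>cube N. \<Sum>y\<in>cube N. \<alpha> x * \<beta> y * tilt \<rho> x y * ln (4 ^ N * \<alpha> x * \<beta> y / P)) - 2 * (Q * ln (Q / P)))
    + \<rho> / (1 - \<rho>\<^sup>2) * (\<Sum>x\<in>cube N. \<Sum>y\<in>cube N. \<alpha> x * \<beta> y * tilt \<rho> x y * (corr x y - real N * \<rho>))"
proof -
  have \<rho>1: "\<bar>\<rho>\<bar> < 1" using \<rho> by simp
  let ?S = "\<lambda>y. \<Sum>x\<in>cube N. \<alpha> x * tilt \<rho> x y" and ?T = "\<lambda>x. \<Sum>y\<in>cube N. \<beta> y * tilt \<rho> x y"
  let ?w = "\<lambda>x y. \<alpha> x * \<beta> y * tilt \<rho> x y"
  define A where "A = (\<Sum>x\<in>cube N. \<alpha> x)"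
  define B where "B = (\<Sum>y\<in>cube N. \<beta> y)"
  have P: "P = A * B" unfolding P_def A_def B_def ..
  have E1: "Q * ln (Q / P) \<le> (\<Sum>x\<in>cube N. \<Sum>y\<in>cube N. ?w x y * ln (?S y / A))"
    unfolding Q_def P_def A_def by (rule log_sum_tilt[OF \<rho>1 \<alpha> \<beta>])
  have E2: "Q * ln (Q / P) \<le> (\<Sum>x\<in>cube N. \<Sum>y\<in>cube N. ?w x y * ln (?T x / B))"
  proof -
    have "(\<Sum>x\<in>cube N. \<Sum>y\<in>cube N. ?w x y) = (\<Sum>y\<in>cube N. \<Sum>x\<in>cube N. \<beta> y * \<alpha> x * tilt \<rho> y x)"
      by (subst sum.swap) (simp add: mult_ac tilt_commute)
    moreover have "(\<Sum>x\<in>cube N. \<Sum>y\<in>cube N. ?w x y * ln (?T x / B))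
      = (\<Sum>y\<in>cube N. \<Sum>x\<in>cube N. \<beta> y * \<alpha> x * tilt \<rho> y x * ln ((\<Sum>y\<in>cube N. \<beta> y * tilt \<rho> y x) / B))"
      by (subst sum.swap) (simp add: mult_ac tilt_commute)
    ultimately show ?thesis
      using log_sum_tilt[where \<alpha> = \<beta> and \<beta> = \<alpha> and N = N, OF \<rho>1 \<beta> \<alpha>] unfolding Q_def P_def B_def by (simp add: mult.commute)
  qed
  \<comment> \<open>Together the two chain rules give the log-likelihood of the pair minus two
    log-ratios, whose means are each at least \<open>Q * ln (Q / P)\<close> by \<open>E1\<close> and
    \<open>E2\<close>.\<close>
  have "hybrid \<rho> (\<lambda>p q x y. ln (1 + p * x) - ln (1 + \<rho> * p * y)) N \<alpha> \<beta>
      + hybrid \<rho> (\<lambda>p q x y. ln (1 + q * y) - ln (1 + \<rho> * q * x)) N \<alpha> \<beta>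
    = (\<Sum>x\<in>cube N. \<Sum>y\<in>cube N. ?w x y * ln (4 ^ N * \<alpha> x * \<beta> y / P))
      - (\<Sum>x\<in>cube N. \<Sum>y\<in>cube N. ?w x y * ln (?S y / A)) - (\<Sum>x\<in>cube N. \<Sum>y\<in>cube N. ?w x y * ln (?T x / B))"
    unfolding hybrid_left[OF \<rho>1 \<alpha> \<beta>] hybrid_right[OF \<rho>1 \<alpha> \<beta>] sum.distrib[symmetric] sum_subtractf[symmetric]
  proof (intro sum.cong refl)
    fix x y assume xy: "x \<in> cube N" "y \<in> cube N"
    show "?w x y * ln (2 ^ N * \<alpha> x / ?S y) + ?w x y * ln (2 ^ N * \<beta> y / ?T x) =
      ?w x y * ln (4 ^ N * \<alpha> x * \<beta> y / P) - ?w x y * ln (?S y / A) - ?w x y * ln (?T x / B)"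
    proof (cases "\<alpha> x = 0 \<or> \<beta> y = 0")
      case False
      have ab: "\<alpha> x > 0" "\<beta> y > 0" using False \<alpha>[of x] \<beta>[of y] by (auto simp: less_le)
      have "?S y > 0" "?T x > 0"
        using sum_cube_tilt_pos(1)[of \<rho> \<alpha> x N y] sum_cube_tilt_pos(2)[of \<rho> \<beta> y N x] \<rho>1 \<alpha> \<beta> False xy by auto
      moreover have "A > 0" "B > 0"
        unfolding A_def B_def using \<alpha> \<beta> ab xy sum_pos2[of "cube N" x \<alpha>] sum_pos2[of "cube N" y \<beta>] by auto
      moreover have "ln (4 ^ N :: real) = ln (2 ^ N) + ln (2 ^ N)"
        by (simp add: ln_realpow) (metis (no_types) distrib_left ln_mult mult_2 numeral_Bit0 zero_less_numeral zero_neq_numeral  numeral_times_numeral num_double mult_numeral_1)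
      ultimately show ?thesis
        using ab unfolding P by (simp add: ln_mult ln_div algebra_simps)
    qed auto
  qed
  then have H: "hybrid \<rho> (\<lambda>p q x y. ln (1 + p * x) - ln (1 + \<rho> * p * y)) N \<alpha> \<beta>
      + hybrid \<rho> (\<lambda>p q x y. ln (1 + q * y) - ln (1 + \<rho> * q * x)) N \<alpha> \<beta>
    \<le> (\<Sum>x\<in>cube N. \<Sum>y\<in>cube N. ?w x y * ln (4 ^ N * \<alpha> x * \<beta> y / P)) - 2 * (Q * ln (Q / P))"
    using E1 E2 by linarith
  have "Q * ln (Q / P) \<le> hybrid \<rho> (\<lambda>p q x y. ln (1 + \<rho> * p * y) + ln (1 + \<rho> * q * x) - ln (1 + \<rho> * p * q)) N \<alpha> \<beta>"
    using E1 hybrid_entropy_bound[where \<alpha> = \<alpha> and \<beta> = \<beta> and N = N, OF \<rho>1 \<alpha> \<beta>] unfolding A_def by linarith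
  also have "\<dots> \<le> hybrid \<rho> (\<lambda>p q x y. 8 * \<rho>\<^sup>2 * ((ln (1 + p * x) - ln (1 + \<rho> * p * y)) + (ln (1 + q * y) - ln (1 + \<rho> * q * x)))
        + \<rho> / (1 - \<rho>\<^sup>2) * (x * y - \<rho>)) N \<alpha> \<beta>"
    by (intro hybrid_mono \<rho>1 \<alpha> \<beta> avg4_main \<rho>)
  also have "\<dots> = 8 * \<rho>\<^sup>2 * (hybrid \<rho> (\<lambda>p q x y. ln (1 + p * x) - ln (1 + \<rho> * p * y)) N \<alpha> \<beta>
      + hybrid \<rho> (\<lambda>p q x y. ln (1 + q * y) - ln (1 + \<rho> * q * x)) N \<alpha> \<beta>)
    + \<rho> / (1 - \<rho>\<^sup>2) * hybrid \<rho> (\<lambda>p q x y. x * y - \<rho>) N \<alpha> \<beta>"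
    by (simp only: hybrid_add[where \<phi>="\<lambda>p q x y. 8 * \<rho>\<^sup>2 * (_ p q x y)"] hybrid_add[of \<rho> "\<lambda>p q x y. ln (1 + p * x) - ln (1 + \<rho> * p * y)"] hybrid_scale)
  also have "\<dots> \<le> 8 * \<rho>\<^sup>2 * ((\<Sum>x\<in>cube N. \<Sum>y\<in>cube N. ?w x y * ln (4 ^ N * \<alpha> x * \<beta> y / P)) - 2 * (Q * ln (Q / P)))
    + \<rho> / (1 - \<rho>\<^sup>2) * (\<Sum>x\<in>cube N. \<Sum>y\<in>cube N. ?w x y * (corr x y - real N * \<rho>))"
    unfolding hybrid_corr by (intro add_right_mono mult_left_mono H) simp
  finally show ?thesis .
qed

lemma gibbs_ge_diff:
  fixes u v :: real
  assumes "u \<ge> 0" "v \<ge> 0" "v = 0 \<Longrightarrow> u = 0"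
  shows "u * ln (u / v) \<ge> u - v"
proof (cases "u = 0")
  case False
  then have uv: "u > 0" "v > 0" using assms by (auto simp: less_le)
  have "ln (v / u) \<le> v / u - 1" using uv by (intro ln_le_minus_one) simp
  then have "u * ln (v / u) \<le> u * (v / u - 1)" using uv by (intro mult_left_mono) auto
  then show ?thesis using uv by (simp add: ln_div algebra_simps)
qed (use assms in auto)

section \<open>Two-party transcripts and their information\<close>

text \<open>\<open>T\<close> is the finite set of transcripts and \<open>a t x * b t y\<close> the
  probability of \<open>t\<close> on the input pair. This product form is all that the lower bound
  takes from a protocol.\<close>

locale two_party =
  fixes T :: "'p set" and a b :: "'p \<Rightarrow> bool list \<Rightarrow> real" and N :: nat
  assumes finite_T: "finite T"
    and a_nonneg: "\<And>t x. a t x \<ge> 0" and b_nonneg: "\<And>t y. b t y \<ge> 0"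
    and sum_ab: "\<And>x y. x \<in> cube N \<Longrightarrow> y \<in> cube N \<Longrightarrow> (\<Sum>t\<in>T. a t x * b t y) = 1"
begin

definition marg :: "'p \<Rightarrow> real" where
  "marg t = (\<Sum>x\<in>cube N. a t x) * (\<Sum>y\<in>cube N. b t y) / 4 ^ N"

definition marg_tilt :: "real \<Rightarrow> 'p \<Rightarrow> real" where
  "marg_tilt \<rho> t = (\<Sum>x\<in>cube N. \<Sum>y\<in>cube N. a t x * b t y * tilt \<rho> x y) / 4 ^ N"

definition divergence :: "bool list \<Rightarrow> bool list \<Rightarrow> real" where
  "divergence x y = (\<Sum>t\<in>T. a t x * b t y * ln (a t x * b t y / marg t))"

text \<open>The mutual information, in nats, between a uniform pair and its transcript, as the mean
  divergence of the law on one pair from the average law \<open>marg\<close>.\<close>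

definition info :: real where
  "info = (\<Sum>x\<in>cube N. \<Sum>y\<in>cube N. divergence x y) / 4 ^ N"

lemma marg_eq: "marg t = (\<Sum>x\<in>cube N. \<Sum>y\<in>cube N. a t x * b t y) / 4 ^ N"
  by (simp add: marg_def sum_product)

lemma marg_tilt_0: "marg_tilt 0 t = marg t"
  by (simp add: marg_tilt_def marg_eq)

lemma marg_tilt_nonneg: "\<bar>\<rho>\<bar> < 1 \<Longrightarrow> marg_tilt \<rho> t \<ge> 0"
  unfolding marg_tilt_def using tilt_pos[of \<rho>]
  by (intro divide_nonneg_nonneg sum_nonneg mult_nonneg_nonneg a_nonneg b_nonneg) (auto intro: less_imp_le)

lemma marg_nonneg: "marg t \<ge> 0"
  using marg_tilt_nonneg[of 0] by (simp add: marg_tilt_0)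

text \<open>One pair has the share 1 / 4^N in the average law. This gives absolute continuity with
  respect to \<open>marg\<close> and the uniform bound on \<open>divergence\<close>.\<close>

lemma ab_le_marg:
  assumes "x \<in> cube N" "y \<in> cube N"
  shows "a t x * b t y \<le> 4 ^ N * marg t"
proof -
  have "a t x \<le> (\<Sum>x\<in>cube N. a t x)" "b t y \<le> (\<Sum>y\<in>cube N. b t y)"
    using assms a_nonneg b_nonneg by (auto intro!: member_le_sum)
  then have "a t x * b t y \<le> (\<Sum>x\<in>cube N. a t x) * (\<Sum>y\<in>cube N. b t y)"
    using a_nonneg b_nonneg by (intro mult_mono sum_nonneg) auto
  then show ?thesis by (simp add: marg_def)
qed

lemma marg_tilt_eq_0: "marg t = 0 \<Longrightarrow> marg_tilt \<rho> t = 0"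
proof -
  assume "marg t = 0"
  then have "a t x * b t y = 0" if "x \<in> cube N" "y \<in> cube N" for x y
    using ab_le_marg[OF that, of t] a_nonneg[of t x] b_nonneg[of t y]
    by (metis mult_nonneg_nonneg mult_zero_right order_antisym)
  then have "(\<Sum>x\<in>cube N. \<Sum>y\<in>cube N. a t x * b t y * tilt \<rho> x y) = 0"
    by (intro sum.neutral ballI) (metis mult_zero_left)
  then show ?thesis unfolding marg_tilt_def by simp
qed

lemma sum_T_swap:
  "(\<Sum>t\<in>T. \<Sum>x\<in>cube N. \<Sum>y\<in>cube N. a t x * b t y * f x y) = (\<Sum>x\<in>cube N. \<Sum>y\<in>cube N. f x y)"
proof -
  have "(\<Sum>t\<in>T. \<Sum>x\<in>cube N. \<Sum>y\<in>cube N. a t x * b t y * f x y)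
      = (\<Sum>x\<in>cube N. \<Sum>y\<in>cube N. (\<Sum>t\<in>T. a t x * b t y) * f x y)"
    unfolding sum_distrib_right
    by (subst sum.swap, rule sum.cong[OF refl], subst sum.swap) simp
  then show ?thesis using sum_ab by simp
qed

lemma sum_marg_tilt: "(\<Sum>t\<in>T. marg_tilt \<rho> t) = 1"
  by (simp add: marg_tilt_def sum_T_swap sum_tilt flip: sum_divide_distrib)

lemma sum_marg: "(\<Sum>t\<in>T. marg t) = 1"
  using sum_marg_tilt[of 0] by (simp add: marg_tilt_0)

lemma divergence_nonneg:
  assumes "x \<in> cube N" "y \<in> cube N"
  shows "divergence x y \<ge> 0"
proof -
  have "(\<Sum>t\<in>T. a t x * b t y - marg t) \<le> divergence x y"
    unfolding divergence_def
    using ab_le_marg[OF assms] a_nonneg b_nonneg marg_nonneg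
    by (intro sum_mono gibbs_ge_diff mult_nonneg_nonneg) (metis mult_nonneg_nonneg mult_zero_right order_antisym)+
  then show ?thesis using assms by (simp add: sum_subtractf sum_marg sum_ab)
qed

lemma divergence_le:
  assumes "x \<in> cube N" "y \<in> cube N"
  shows "divergence x y \<le> real N * ln 4"
proof -
  have "divergence x y \<le> (\<Sum>t\<in>T. a t x * b t y * (real N * ln 4))"
    unfolding divergence_def
  proof (intro sum_mono)
    fix t
    show "a t x * b t y * ln (a t x * b t y / marg t) \<le> a t x * b t y * (real N * ln 4)"
    proof (cases "a t x * b t y = 0")
      case False
      then have pos: "a t x * b t y > 0" using a_nonneg[of t x] b_nonneg[of t y] by (simp add: less_le)
      then have m: "marg t > 0" using ab_le_marg[OF assms, of t] marg_nonneg[of t]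
        by (cases "marg t = 0") auto
      have "ln (a t x * b t y / marg t) \<le> ln (4 ^ N)"
        using ab_le_marg[OF assms, of t] pos m by (subst ln_le_cancel_iff) (auto simp: field_simps)
      also have "\<dots> = real N * ln 4" by (simp add: ln_realpow)
      finally show ?thesis using pos by (intro mult_left_mono) auto
    qed auto
  qed
  also have "\<dots> = real N * ln 4" using sum_ab[OF assms] by (simp flip: sum_distrib_right)
  finally show ?thesis .
qed

text \<open>\<open>rectangle_divergence_bound\<close> summed over the transcripts. The correlation
  terms add up to the centred mean of \<open>corr\<close> under the tilted law, which is zero; the
  subtracted divergence is nonnegative and may be dropped.\<close>

lemma marg_divergence_bound:
  assumes \<rho>: "0 \<le> \<rho>" "\<rho> \<le> 1 / 100"
  shows "(\<Sum>t\<in>T. marg_tilt \<rho> t * ln (marg_tilt \<rho> t / marg t))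
     \<le> 8 * \<rho>\<^sup>2 * ((\<Sum>x\<in>cube N. \<Sum>y\<in>cube N. tilt \<rho> x y * divergence x y) / 4 ^ N)"
proof -
  let ?D = "\<Sum>t\<in>T. marg_tilt \<rho> t * ln (marg_tilt \<rho> t / marg t)"
  have \<rho>1: "\<bar>\<rho>\<bar> < 1" using \<rho> by simp
  have D0: "?D \<ge> 0"
  proof -
    have "(\<Sum>t\<in>T. marg_tilt \<rho> t - marg t) \<le> ?D"
      by (intro sum_mono gibbs_ge_diff marg_nonneg marg_tilt_nonneg marg_tilt_eq_0 \<rho>1)
    then show ?thesis by (simp add: sum_subtractf sum_marg_tilt sum_marg)
  qed
  let ?J = "\<lambda>t. (\<Sum>x\<in>cube N. \<Sum>y\<in>cube N. a t x * b t y * tilt \<rho> x y * ln (a t x * b t y / marg t)) / 4 ^ N"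
  let ?C = "\<lambda>t. (\<Sum>x\<in>cube N. \<Sum>y\<in>cube N. a t x * b t y * (tilt \<rho> x y * (corr x y - real N * \<rho>))) / 4 ^ N"
  have "marg_tilt \<rho> t * ln (marg_tilt \<rho> t / marg t) \<le>
     8 * \<rho>\<^sup>2 * (?J t - 2 * (marg_tilt \<rho> t * ln (marg_tilt \<rho> t / marg t))) + \<rho> / (1 - \<rho>\<^sup>2) * ?C t" for t
  proof -
    \<comment> \<open>The factors 1 / 2^N absorb the uniform weights of \<open>x\<close> and
      \<open>y\<close>, so that the two masses of the rectangle become \<open>marg t\<close> and
      \<open>marg_tilt \<rho> t\<close>.\<close>
    define \<alpha> where "\<alpha> x = a t x / 2 ^ N" for x
    define \<beta> where "\<beta> y = b t y / 2 ^ N" for y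
    have nn: "\<alpha> x \<ge> 0" "\<beta> y \<ge> 0" for x y
      by (auto simp: \<alpha>_def \<beta>_def a_nonneg b_nonneg)
    have four: "2 ^ N * 2 ^ N = (4 ^ N :: real)" by (simp flip: power_mult_distrib)
    have ab: "\<alpha> x * \<beta> y = a t x * b t y / 4 ^ N" for x y
      unfolding \<alpha>_def \<beta>_def by (simp add: four)
    have m: "(\<Sum>x\<in>cube N. \<alpha> x) * (\<Sum>y\<in>cube N. \<beta> y) = marg t"
      unfolding sum_product ab marg_eq by (simp add: sum_divide_distrib)
    have mt: "(\<Sum>x\<in>cube N. \<Sum>y\<in>cube N. \<alpha> x * \<beta> y * tilt \<rho> x y) = marg_tilt \<rho> t"
      unfolding ab marg_tilt_def by (simp add: sum_divide_distrib)
    have J: "(\<Sum>x\<in>cube N. \<Sum>y\<in>cube N. \<alpha> x * \<beta> y * tilt \<rho> x y * ln (4 ^ N * \<alpha> x * \<beta> y / marg t)) = ?J t"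
      unfolding mult.assoc[of "4 ^ N"] ab by (simp add: sum_divide_distrib)
    have C: "(\<Sum>x\<in>cube N. \<Sum>y\<in>cube N. \<alpha> x * \<beta> y * tilt \<rho> x y * (corr x y - real N * \<rho>)) = ?C t"
      unfolding ab by (simp add: sum_divide_distrib mult.assoc)
    show ?thesis
      using rectangle_divergence_bound[where \<alpha> = \<alpha> and \<beta> = \<beta> and N = N, OF \<rho> nn] unfolding m mt J C .
  qed
  then have "?D \<le> (\<Sum>t\<in>T. 8 * \<rho>\<^sup>2 * (?J t - 2 * (marg_tilt \<rho> t * ln (marg_tilt \<rho> t / marg t))) + \<rho> / (1 - \<rho>\<^sup>2) * ?C t)"
    by (rule sum_mono)
  also have "\<dots> = 8 * \<rho>\<^sup>2 * ((\<Sum>t\<in>T. ?J t) - 2 * ?D) + \<rho> / (1 - \<rho>\<^sup>2) * (\<Sum>t\<in>T. ?C t)"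
    by (simp only: sum.distrib sum_subtractf flip: sum_distrib_left)
  also have "(\<Sum>t\<in>T. ?C t) = 0"
    by (simp add: sum_T_swap sum_tilt_corr flip: sum_divide_distrib)
  also have "(\<Sum>t\<in>T. ?J t) = (\<Sum>x\<in>cube N. \<Sum>y\<in>cube N. tilt \<rho> x y * divergence x y) / 4 ^ N"
    unfolding divergence_def sum_distrib_left sum_divide_distrib[symmetric]
    by (subst sum.swap, intro arg_cong2[where f="(/)"] sum.cong refl, subst sum.swap) (simp add: mult_ac)
  finally have "?D \<le> 8 * \<rho>\<^sup>2 * ((\<Sum>x\<in>cube N. \<Sum>y\<in>cube N. tilt \<rho> x y * divergence x y) / 4 ^ N) - 16 * \<rho>\<^sup>2 * ?D"
    by (simp add: algebra_simps)
  moreover have "16 * \<rho>\<^sup>2 * ?D \<ge> 0" using D0 by simp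
  ultimately show ?thesis by linarith
qed

end

section \<open>Change of measure and concentration\<close>

lemma le_add_square_div:
  fixes L K :: real
  assumes "K > 0"
  shows "L \<le> K + L\<^sup>2 / K"
proof (cases "L \<le> K")
  case False
  then have "L * K \<le> L * L" using assms by (intro mult_left_mono) auto
  then have "L \<le> L\<^sup>2 / K" using assms by (simp add: field_simps power2_eq_square)
  then show ?thesis using assms by simp
qed (use assms in \<open>simp add: add_increasing2\<close>)

text \<open>Change of measure by truncation at \<open>K\<close>: the density is at most K plus its
  square divided by K. The first part gives K times the uniform mean, the second at most B / K times
  the second moment (1 + \<rho>^2)^N \<le> exp (N \<rho>^2).\<close>

lemma sum_tilt_weighted_le:
  fixes f :: "bool list \<Rightarrow> bool list \<Rightarrow> real"
  assumes K: "K > 0" and f: "\<And>x y. x \<in> cube N \<Longrightarrow> y \<in> cube N \<Longrightarrow> 0 \<le> f x y \<and> f x y \<le> B"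
  shows "(\<Sum>x\<in>cube N. \<Sum>y\<in>cube N. tilt \<rho> x y * f x y) / 4 ^ N
    \<le> K * ((\<Sum>x\<in>cube N. \<Sum>y\<in>cube N. f x y) / 4 ^ N) + B * exp (real N * \<rho>\<^sup>2) / K"
proof -
  have B: "B \<ge> 0" using f[of "replicate N True" "replicate N True"] by (auto simp: cube_def)
  have "(\<Sum>x\<in>cube N. \<Sum>y\<in>cube N. tilt \<rho> x y * f x y)
     \<le> (\<Sum>x\<in>cube N. \<Sum>y\<in>cube N. K * f x y + B / K * (tilt \<rho> x y)\<^sup>2)"
  proof (intro sum_mono)
    fix x y assume "x \<in> cube N" "y \<in> cube N"
    note f = f[OF this]
    have "tilt \<rho> x y * f x y \<le> (K + (tilt \<rho> x y)\<^sup>2 / K) * f x y"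
      using f by (intro mult_right_mono le_add_square_div K) auto
    also have "\<dots> = K * f x y + (tilt \<rho> x y)\<^sup>2 / K * f x y" by (simp add: distrib_right)
    also have "(tilt \<rho> x y)\<^sup>2 / K * f x y \<le> (tilt \<rho> x y)\<^sup>2 / K * B"
      using f K by (intro mult_left_mono) auto
    finally show "tilt \<rho> x y * f x y \<le> K * f x y + B / K * (tilt \<rho> x y)\<^sup>2"
      by (simp add: mult_ac)
  qed
  also have "\<dots> = K * (\<Sum>x\<in>cube N. \<Sum>y\<in>cube N. f x y) + B / K * (4 * (1 + \<rho>\<^sup>2)) ^ N"
    by (simp only: sum.distrib sum_tilt_sq flip: sum_distrib_left)
  finally have "(\<Sum>x\<in>cube N. \<Sum>y\<in>cube N. tilt \<rho> x y * f x y) \<le>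
      K * (\<Sum>x\<in>cube N. \<Sum>y\<in>cube N. f x y) + B / K * (4 * (1 + \<rho>\<^sup>2)) ^ N" .
  moreover have "(4 * (1 + \<rho>\<^sup>2)) ^ N \<le> 4 ^ N * exp (real N * \<rho>\<^sup>2)"
    unfolding power_mult_distrib exp_of_nat_mult
    by (intro mult_left_mono power_mono exp_ge_add_one_self) auto
  then have "B / K * (4 * (1 + \<rho>\<^sup>2)) ^ N \<le> B / K * (4 ^ N * exp (real N * \<rho>\<^sup>2))"
    using B K by (intro mult_left_mono) auto
  ultimately have "(\<Sum>x\<in>cube N. \<Sum>y\<in>cube N. tilt \<rho> x y * f x y) \<le>
      K * (\<Sum>x\<in>cube N. \<Sum>y\<in>cube N. f x y) + B / K * (4 ^ N * exp (real N * \<rho>\<^sup>2))"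
    by linarith
  then show ?thesis by (simp add: field_simps)
qed

text \<open>Chebyshev's inequality under the tilted law, where \<open>corr\<close> has mean N \<rho>
  and variance at most N.\<close>

lemma chebyshev_corr:
  assumes "\<bar>\<rho>\<bar> < 1" "r > 0" "N > 0"
    and "\<And>x y. x \<in> cube N \<Longrightarrow> y \<in> cube N \<Longrightarrow> R x y \<Longrightarrow> (corr x y - real N * \<rho>)\<^sup>2 \<ge> r * real N"
  shows "(\<Sum>x\<in>cube N. \<Sum>y\<in>cube N. tilt \<rho> x y * of_bool (R x y)) / 4 ^ N \<le> 1 / r"
proof -
  have "(\<Sum>x\<in>cube N. \<Sum>y\<in>cube N. tilt \<rho> x y * of_bool (R x y)) \<le>
      (\<Sum>x\<in>cube N. \<Sum>y\<in>cube N. 1 / (r * real N) * (tilt \<rho> x y * (corr x y - real N * \<rho>)\<^sup>2))"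
  proof (intro sum_mono)
    fix x y assume xy: "x \<in> cube N" "y \<in> cube N"
    have t: "tilt \<rho> x y > 0" by (rule tilt_pos[OF assms(1)])
    show "tilt \<rho> x y * of_bool (R x y) \<le> 1 / (r * real N) * (tilt \<rho> x y * (corr x y - real N * \<rho>)\<^sup>2)"
      using assms(4)[OF xy] t assms(2,3)
      by (cases "R x y") (auto simp: field_simps)
  qed
  also have "\<dots> = 1 / (r * real N) * (4 ^ N * (real N * (1 - \<rho>\<^sup>2)))"
    by (simp only: sum_tilt_corr_sq flip: sum_distrib_left)
  also have "\<dots> \<le> 4 ^ N / r"
    using assms(2,3) by (simp add: field_simps)
  finally show ?thesis by (simp add: field_simps)
qed

section \<open>From small error to large information\<close>

context two_party
begin

text \<open>\<open>out\<close> reads the answer off the transcript, \<open>True\<close> claiming a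
  large inner product. Strictly between the two thresholds every answer counts as correct.\<close>

definition tilt_error :: "real \<Rightarrow> ('p \<Rightarrow> bool) \<Rightarrow> real" where
  "tilt_error \<rho> out = (\<Sum>x\<in>cube N. \<Sum>y\<in>cube N. tilt \<rho> x y * (\<Sum>t\<in>T. a t x * b t y *
     of_bool (if out t then \<bar>corr x y\<bar> \<le> 2 * sqrt (real N) else \<bar>corr x y\<bar> \<ge> 4 * sqrt (real N)))) / 4 ^ N"

text \<open>The variational bound of Donsker and Varadhan for the function equal to ln 2 on
  \<open>out\<close> and 0 elsewhere. Its exponential moment under \<open>marg\<close> is
  \<open>c\<close>, and ln c \<le> c - 1 turns the logarithm into the probability of
  \<open>out\<close>.\<close>

lemma binary_divergence_bound:
  assumes "\<bar>\<rho>\<bar> < 1"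
  shows "(\<Sum>t\<in>T. marg_tilt \<rho> t * of_bool (out t)) * ln 2 \<le>
    (\<Sum>t\<in>T. marg_tilt \<rho> t * ln (marg_tilt \<rho> t / marg t)) + (\<Sum>t\<in>T. marg t * of_bool (out t))"
proof -
  define c where "c = 1 + (\<Sum>t\<in>T. marg t * of_bool (out t))"
  have c: "c \<ge> 1" unfolding c_def using marg_nonneg by (simp add: sum_nonneg)
  have "marg_tilt \<rho> t * (of_bool (out t) * ln 2 - ln (marg_tilt \<rho> t / marg t)) \<le>
      (1 + of_bool (out t)) * marg t / c - marg_tilt \<rho> t + marg_tilt \<rho> t * ln c" for t
  proof (cases "marg_tilt \<rho> t = 0")
    case False
    then have pos: "marg_tilt \<rho> t > 0" "marg t > 0"
      using marg_tilt_nonneg[OF assms, of t] marg_nonneg[of t] marg_tilt_eq_0[of t \<rho>] by (auto simp: less_le)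
    define v :: real where "v = 1 + of_bool (out t)"
    have v: "v > 0" "ln v = of_bool (out t) * ln 2" by (auto simp: v_def)
    have "ln (v * marg t / (c * marg_tilt \<rho> t)) \<le> v * marg t / (c * marg_tilt \<rho> t) - 1"
      using pos c v by (intro ln_le_minus_one) auto
    also have "ln (v * marg t / (c * marg_tilt \<rho> t)) = of_bool (out t) * ln 2 - ln (marg_tilt \<rho> t / marg t) - ln c"
      using pos c v by (simp add: ln_div ln_mult)
    finally have "marg_tilt \<rho> t * (of_bool (out t) * ln 2 - ln (marg_tilt \<rho> t / marg t) - ln c) \<le>
       marg_tilt \<rho> t * (v * marg t / (c * marg_tilt \<rho> t) - 1)"
      using pos by (intro mult_left_mono) auto
    also have "\<dots> = v * marg t / c - marg_tilt \<rho> t" using pos c by (simp add: field_simps)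
    finally show ?thesis by (simp add: v_def algebra_simps)
  qed (use c marg_nonneg in auto)
  then have "(\<Sum>t\<in>T. marg_tilt \<rho> t * (of_bool (out t) * ln 2 - ln (marg_tilt \<rho> t / marg t))) \<le>
     (\<Sum>t\<in>T. (1 + of_bool (out t)) * marg t / c - marg_tilt \<rho> t + marg_tilt \<rho> t * ln c)"
    by (rule sum_mono)
  also have "\<dots> = (\<Sum>t\<in>T. (1 + of_bool (out t)) * marg t) / c - 1 + ln c"
    by (simp add: sum.distrib sum_subtractf sum_marg_tilt flip: sum_distrib_right sum_divide_distrib)
  also have "(\<Sum>t\<in>T. (1 + of_bool (out t)) * marg t) = c"
    by (simp add: c_def distrib_right sum.distrib sum_marg mult.commute[of "marg _"])
  also have "c / c - 1 + ln c \<le> c - 1" using c ln_le_minus_one[of c] by simp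
  finally show ?thesis
    by (simp add: c_def right_diff_distrib sum_subtractf sum_distrib_left mult_ac)
qed

lemma marg_tilt_out:
  "(\<Sum>t\<in>T. marg_tilt \<rho> t * of_bool (out t)) =
     (\<Sum>x\<in>cube N. \<Sum>y\<in>cube N. tilt \<rho> x y * (\<Sum>t\<in>T. a t x * b t y * of_bool (out t))) / 4 ^ N"
  unfolding marg_tilt_def sum_divide_distrib sum_distrib_right sum_distrib_left
  by (subst sum.swap, rule sum.cong[OF refl], subst sum.swap) (simp add: mult_ac)

text \<open>Under the uniform law a yes is either an error or comes with |corr| above 2 sqrt N, two
  standard deviations from the mean 0.\<close>

lemma marg_out_le:
  assumes "N > 0"
  shows "(\<Sum>t\<in>T. marg t * of_bool (out t)) \<le> tilt_error 0 out + 1 / 4"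
proof -
  have "(\<Sum>t\<in>T. marg t * of_bool (out t)) =
     (\<Sum>x\<in>cube N. \<Sum>y\<in>cube N. (\<Sum>t\<in>T. a t x * b t y * of_bool (out t))) / 4 ^ N"
    using marg_tilt_out[of 0 out] by (simp add: marg_tilt_0)
  also have "\<dots> \<le> (\<Sum>x\<in>cube N. \<Sum>y\<in>cube N. (\<Sum>t\<in>T. a t x * b t y *
     of_bool (if out t then \<bar>corr x y\<bar> \<le> 2 * sqrt (real N) else \<bar>corr x y\<bar> \<ge> 4 * sqrt (real N)))
     + of_bool (\<bar>corr x y\<bar> > 2 * sqrt (real N))) / 4 ^ N"
  proof (intro divide_right_mono sum_mono)
    fix x y assume xy: "x \<in> cube N" "y \<in> cube N"
    have "(\<Sum>t\<in>T. a t x * b t y * of_bool (out t)) \<le> (\<Sum>t\<in>T. a t x * b t y *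
     of_bool (if out t then \<bar>corr x y\<bar> \<le> 2 * sqrt (real N) else \<bar>corr x y\<bar> \<ge> 4 * sqrt (real N))
     + a t x * b t y * of_bool (\<bar>corr x y\<bar> > 2 * sqrt (real N)))"
      using a_nonneg b_nonneg by (intro sum_mono) auto
    then show "(\<Sum>t\<in>T. a t x * b t y * of_bool (out t)) \<le> (\<Sum>t\<in>T. a t x * b t y *
     of_bool (if out t then \<bar>corr x y\<bar> \<le> 2 * sqrt (real N) else \<bar>corr x y\<bar> \<ge> 4 * sqrt (real N)))
     + of_bool (\<bar>corr x y\<bar> > 2 * sqrt (real N))"
      by (simp only: sum.distrib sum_ab[OF xy] mult_1 flip: sum_distrib_right)
  qed simp
  also have "\<dots> = tilt_error 0 out + (\<Sum>x\<in>cube N. \<Sum>y\<in>cube N. tilt 0 x y * of_bool (\<bar>corr x y\<bar> > 2 * sqrt (real N))) / 4 ^ N"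
    by (simp only: tilt_error_def sum.distrib add_divide_distrib tilt_0 mult_1)
  also have "(\<Sum>x\<in>cube N. \<Sum>y\<in>cube N. tilt 0 x y * of_bool (\<bar>corr x y\<bar> > 2 * sqrt (real N))) / 4 ^ N \<le> 1 / 4"
  proof (intro chebyshev_corr)
    fix x y assume "\<bar>corr x y\<bar> > 2 * sqrt (real N)"
    then have "(2 * sqrt (real N))\<^sup>2 \<le> \<bar>corr x y\<bar>\<^sup>2" by (intro power_mono) auto
    then show "4 * real N \<le> (corr x y - real N * 0)\<^sup>2" by (simp add: power_mult_distrib)
  qed (use assms in auto)
  finally show ?thesis by simp
qed

text \<open>For this \<rho> the mean of \<open>corr\<close> is 8 sqrt N, so a value below 4 sqrt N
  is at least four standard deviations off. In all other cases a no is an error.\<close>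

lemma marg_tilt_out_ge:
  assumes \<rho>: "\<rho> = 8 / sqrt (real N)" "\<bar>\<rho>\<bar> < 1" and "N > 0"
  shows "(\<Sum>t\<in>T. marg_tilt \<rho> t * of_bool (out t)) \<ge> 1 - tilt_error \<rho> out - 1 / 16"
proof -
  have "4 ^ N = (\<Sum>x\<in>cube N. \<Sum>y\<in>cube N. tilt \<rho> x y * (\<Sum>t\<in>T. a t x * b t y))"
    by (simp add: sum_ab sum_tilt)
  also have "\<dots> \<le> (\<Sum>x\<in>cube N. \<Sum>y\<in>cube N. tilt \<rho> x y * (\<Sum>t\<in>T. a t x * b t y * of_bool (out t))
      + tilt \<rho> x y * (\<Sum>t\<in>T. a t x * b t y *
     of_bool (if out t then \<bar>corr x y\<bar> \<le> 2 * sqrt (real N) else \<bar>corr x y\<bar> \<ge> 4 * sqrt (real N)))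
     + tilt \<rho> x y * of_bool (\<bar>corr x y\<bar> < 4 * sqrt (real N)))"
    (is "_ \<le> (\<Sum>x\<in>cube N. \<Sum>y\<in>cube N. ?f x y + ?g x y + ?h x y)")
  proof (intro sum_mono)
    fix x y assume xy: "x \<in> cube N" "y \<in> cube N"
    have "tilt \<rho> x y * (\<Sum>t\<in>T. a t x * b t y) \<le> tilt \<rho> x y * (\<Sum>t\<in>T. a t x * b t y * of_bool (out t)
     + a t x * b t y *
     of_bool (if out t then \<bar>corr x y\<bar> \<le> 2 * sqrt (real N) else \<bar>corr x y\<bar> \<ge> 4 * sqrt (real N))
     + a t x * b t y * of_bool (\<bar>corr x y\<bar> < 4 * sqrt (real N)))"
      using a_nonneg b_nonneg tilt_pos[OF \<rho>(2), of x y] by (intro mult_left_mono sum_mono) auto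
    then show "tilt \<rho> x y * (\<Sum>t\<in>T. a t x * b t y) \<le> ?f x y + ?g x y + ?h x y"
      by (simp only: sum.distrib sum_ab[OF xy] mult_1 distrib_left[of "tilt \<rho> x y"] flip: sum_distrib_right)
  qed
  also have "\<dots> = 4 ^ N * ((\<Sum>t\<in>T. marg_tilt \<rho> t * of_bool (out t)) + tilt_error \<rho> out
      + (\<Sum>x\<in>cube N. \<Sum>y\<in>cube N. ?h x y) / 4 ^ N)"
    unfolding marg_tilt_out tilt_error_def
    by (simp add: sum.distrib distrib_left)
  finally have "1 \<le> (\<Sum>t\<in>T. marg_tilt \<rho> t * of_bool (out t)) + tilt_error \<rho> out
      + (\<Sum>x\<in>cube N. \<Sum>y\<in>cube N. ?h x y) / 4 ^ N" by simp
  moreover have "(\<Sum>x\<in>cube N. \<Sum>y\<in>cube N. ?h x y) / 4 ^ N \<le> 1 / 16"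
  proof (intro chebyshev_corr \<rho>)
    fix x y assume c: "\<bar>corr x y\<bar> < 4 * sqrt (real N)"
    have "real N * \<rho> = 8 * sqrt (real N)" unfolding \<rho>
      using real_div_sqrt[of "real N"] by (simp flip: times_divide_eq_left add: mult.commute)
    then have "(4 * sqrt (real N))\<^sup>2 \<le> (real N * \<rho> - corr x y)\<^sup>2"
      using c by (intro power_mono) auto
    then show "16 * real N \<le> (corr x y - real N * \<rho>)\<^sup>2"
      by (simp add: power_mult_distrib power2_commute)
  qed (use assms in auto)
  ultimately show ?thesis by linarith
qed

theorem info_lower_bound:
  assumes N: "N \<ge> 640000" and err: "tilt_error 0 out \<le> 1 / (10 ^ 6 * exp 64)"
  shows "info \<ge> real N / (10 ^ 8 * exp 64)"
proof -
  define \<rho> where "\<rho> = 8 / sqrt (real N)"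
  \<comment> \<open>Since N \<rho>^2 = 64, the second moment of the density is at most exp 64; this
    \<open>K\<close> makes the truncated part of the error at most 1 / 10^4.\<close>
  define K :: real where "K = 10 ^ 4 * exp 64"
  have K: "K > 0" by (simp add: K_def)
  \<comment> \<open>640000 = 800^2 is what brings \<rho> down to 1 / 100, as
    \<open>marg_divergence_bound\<close> demands.\<close>
  have "sqrt (real N) \<ge> sqrt (800\<^sup>2)" using N by (intro real_sqrt_le_mono) simp
  then have s: "sqrt (real N) \<ge> 800" by simp
  have "8 / sqrt (real N) \<le> 8 / 800" using s N by (intro divide_left_mono) auto
  then have \<rho>: "0 \<le> \<rho>" "\<rho> \<le> 1 / 100" unfolding \<rho>_def by auto
  have N\<rho>: "real N * \<rho>\<^sup>2 = 64" unfolding \<rho>_def using N by (simp add: power_divide)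
  define f where "f x y = (\<Sum>t\<in>T. a t x * b t y *
     of_bool (if out t then \<bar>corr x y\<bar> \<le> 2 * sqrt (real N) else \<bar>corr x y\<bar> \<ge> 4 * sqrt (real N)))" for x y
  have f: "tilt_error \<rho> out = (\<Sum>x\<in>cube N. \<Sum>y\<in>cube N. tilt \<rho> x y * f x y) / 4 ^ N"
    "tilt_error 0 out = (\<Sum>x\<in>cube N. \<Sum>y\<in>cube N. f x y) / 4 ^ N"
    by (simp_all only: tilt_error_def f_def tilt_0 mult_1)
  have "tilt_error \<rho> out \<le> K * tilt_error 0 out + 1 * exp (real N * \<rho>\<^sup>2) / K"
    unfolding f
  proof (intro sum_tilt_weighted_le K conjI)
    fix x y assume xy: "x \<in> cube N" "y \<in> cube N"
    show "0 \<le> f x y" unfolding f_def using a_nonneg b_nonneg by (intro sum_nonneg) auto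
    have "f x y \<le> (\<Sum>t\<in>T. a t x * b t y)"
      unfolding f_def using a_nonneg b_nonneg by (intro sum_mono) auto
    then show "f x y \<le> 1" using sum_ab[OF xy] by simp
  qed
  also have "\<dots> = K * tilt_error 0 out + 1 / 10 ^ 4" unfolding N\<rho> K_def by simp
  also have "K * tilt_error 0 out \<le> K * (1 / (10 ^ 6 * exp 64))"
    using err K by (intro mult_left_mono) auto
  also have "\<dots> = 1 / 100" by (simp add: K_def)
  finally have "tilt_error \<rho> out \<le> 11 / 1000" by simp
  then have q: "(\<Sum>t\<in>T. marg_tilt \<rho> t * of_bool (out t)) \<ge> 9 / 10"
    using marg_tilt_out_ge[OF \<rho>_def, of out] \<rho> N by simp
  have "20 * 1 \<le> (10 ^ 6 * exp 64 :: real)" by (intro mult_mono) auto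
  then have "(1::real) / (10 ^ 6 * exp 64) \<le> 1 / 20" by (intro divide_left_mono) auto
  moreover have "(\<Sum>t\<in>T. marg t * of_bool (out t)) \<le> tilt_error 0 out + 1 / 4"
    using N by (intro marg_out_le) simp
  ultimately have p: "(\<Sum>t\<in>T. marg t * of_bool (out t)) \<le> 3 / 10"
    using err by linarith
  \<comment> \<open>The answer is yes with probability at least 9 / 10 under the tilted law and at
    most 3 / 10 under the uniform one, so the divergence is at least 9 / 10 * 2 / 3 - 3 / 10 = 3 /
    10.\<close>
  define D where "D = (\<Sum>t\<in>T. marg_tilt \<rho> t * ln (marg_tilt \<rho> t / marg t))"
  have "9 / 10 * (2 / 3) \<le> (\<Sum>t\<in>T. marg_tilt \<rho> t * of_bool (out t)) * ln 2"
    using q ln2_ge_two_thirds by (intro mult_mono) auto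
  also have "\<dots> \<le> D + 3 / 10"
    using binary_divergence_bound[of \<rho> out] p \<rho> unfolding D_def by linarith
  finally have D1: "D \<ge> 3 / 10" by simp
  have ln4: "ln (4::real) \<le> 2" using ln_2_less_1 ln_realpow[of 2 2] by simp
  \<comment> \<open>Here 8 \<rho>^2 = 512 / N. Truncation costs at most 1024 / 10^4 of the 3 / 10,
    and the rest forces \<open>info\<close> to be of order N.\<close>
  have "D \<le> 8 * \<rho>\<^sup>2 * ((\<Sum>x\<in>cube N. \<Sum>y\<in>cube N. tilt \<rho> x y * divergence x y) / 4 ^ N)"
    unfolding D_def by (rule marg_divergence_bound[OF \<rho>])
  also have "\<dots> \<le> 8 * \<rho>\<^sup>2 * (K * info + real N * ln 4 * exp (real N * \<rho>\<^sup>2) / K)"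
    unfolding info_def
    by (intro mult_left_mono sum_tilt_weighted_le K conjI divergence_nonneg divergence_le) auto
  also have "\<dots> = 512 * (K * info) / real N + 512 * ln 4 / 10 ^ 4"
    using N unfolding N\<rho> K_def \<rho>_def by (simp add: power_divide field_simps)
  also have "512 * ln 4 / 10 ^ 4 \<le> (512 * 2 / 10 ^ 4 :: real)" using ln4 by simp
  finally have "3 / 10 - 1024 / 10 ^ 4 \<le> 512 * (K * info) / real N" using D1 by simp
  then have "real N * (1 / 10 ^ 4 * 512) \<le> 512 * (K * info)"
    using N by (simp add: field_simps)
  then have "real N / 10 ^ 4 \<le> K * info" by simp
  then show ?thesis unfolding K_def by (simp add: field_simps)
qed

end

section \<open>The input distribution\<close>

text \<open>The coordinates are independent and each is read from one copy only. This replaces one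
  family of coins or noise bits by two independent copies, one for each half.\<close>

lemma Pi_pmf_mix:
  assumes "finite A"
  shows "Pi_pmf A d p = map_pmf (\<lambda>(f, g) x. if P x then f x else g x)
           (pair_pmf (Pi_pmf A d p) (Pi_pmf A d p))"
proof -
  have "A = {x \<in> A. P x} \<union> {x \<in> A. \<not> P x}" by auto
  then have "Pi_pmf A d p = Pi_pmf ({x \<in> A. P x} \<union> {x \<in> A. \<not> P x}) d p" by simp
  also have "\<dots> = map_pmf (\<lambda>(f, g) x. if x \<in> {x \<in> A. P x} then f x else g x)
      (pair_pmf (Pi_pmf {x \<in> A. P x} d p) (Pi_pmf {x \<in> A. \<not> P x} d p))"
    using assms by (intro Pi_pmf_union) auto
  also have "Pi_pmf {x \<in> A. P x} d p =
      map_pmf (\<lambda>f x. if x \<in> {x \<in> A. P x} then f x else d) (Pi_pmf A d p)"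
    by (rule Pi_pmf_subset[OF assms]) auto
  also have "Pi_pmf {x \<in> A. \<not> P x} d p =
      map_pmf (\<lambda>f x. if x \<in> {x \<in> A. \<not> P x} then f x else d) (Pi_pmf A d p)"
    by (rule Pi_pmf_subset[OF assms]) auto
  also have "map_pmf (\<lambda>(f, g) x. if x \<in> {x \<in> A. P x} then f x else g x)
      (pair_pmf (map_pmf (\<lambda>f x. if x \<in> {x \<in> A. P x} then f x else d) (Pi_pmf A d p))
         (map_pmf (\<lambda>f x. if x \<in> {x \<in> A. \<not> P x} then f x else d) (Pi_pmf A d p))) =
      map_pmf (\<lambda>(f, g) x. if P x then f x else g x) (pair_pmf (Pi_pmf A d p) (Pi_pmf A d p))"
    unfolding map_pair[symmetric] map_pmf_comp
    by (intro map_pmf_cong refl) (use set_Pi_pmf_subset[OF assms] in \<open>fastforce simp: fun_eq_iff\<close>)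
  finally show ?thesis .
qed

lemma Pi_pmf_pair:
  assumes "finite A"
  shows "Pi_pmf A (d, e) (\<lambda>x. pair_pmf (p x) (q x)) =
    map_pmf (\<lambda>(f, g) x. (f x, g x)) (pair_pmf (Pi_pmf A d p) (Pi_pmf A e q))"
proof (rule pmf_eqI)
  fix h :: "'a \<Rightarrow> 'b \<times> 'c"
  let ?F = "\<lambda>(f, g) x. (f x, g x)"
  have inj: "inj (?F :: ('a \<Rightarrow> 'b) \<times> ('a \<Rightarrow> 'c) \<Rightarrow> _)" by (auto simp: inj_def fun_eq_iff)
  have h: "h = ?F (fst \<circ> h, snd \<circ> h)" by (auto simp: fun_eq_iff)
  have "pmf (map_pmf ?F (pair_pmf (Pi_pmf A d p) (Pi_pmf A e q))) h =
      pmf (pair_pmf (Pi_pmf A d p) (Pi_pmf A e q)) (fst \<circ> h, snd \<circ> h)"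
    by (subst h, rule pmf_map_inj'[OF inj])
  also have "\<dots> = pmf (Pi_pmf A (d, e) (\<lambda>x. pair_pmf (p x) (q x))) h"
  proof -
    have "pmf (pair_pmf (p x) (q x)) (h x) = pmf (p x) (fst (h x)) * pmf (q x) (snd (h x))" for x
      by (cases "h x") (simp add: pmf_pair)
    then show ?thesis
      using assms by (auto simp: pmf_pair pmf_Pi prod.distrib prod_eq_iff)
  qed
  finally show "pmf (Pi_pmf A (d, e) (\<lambda>x. pair_pmf (p x) (q x))) h =
    pmf (map_pmf ?F (pair_pmf (Pi_pmf A d p) (Pi_pmf A e q))) h" by simp
qed

text \<open>
  Drawing the bits of the two halves of the sites from separate copies \<open>uA\<close>, \<open>uB\<close> does not change
  the law, as only one site reads the bit of a given coordinate, but makes the halves independent.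
\<close>

fun mk_block :: "nat \<Rightarrow> (nat \<Rightarrow> nat) \<times> ((nat \<Rightarrow> bool) \<times> (nat \<Rightarrow> bool)) \<times> nat \<times> bool \<times> bool \<Rightarrow> block" where
  "mk_block k (d, (uA, uB), m, x, y) = \<lparr> Dir = d, Special = m,
       Bits = (\<lambda>i l. if l = m then (if i < k div 2 then x else y)
                     else i = d l \<and> (if i < k div 2 then uA l else uB l)) \<rparr>"

lemma block_dist_eq:
  "block_dist k n = map_pmf (mk_block k)
     (pair_pmf (Pi_pmf {..<n} 0 (\<lambda>_. pmf_of_set {..<k}))
       (pair_pmf (pair_pmf (Pi_pmf {..<n} False (\<lambda>_. bernoulli_pmf (1/2)))
                           (Pi_pmf {..<n} False (\<lambda>_. bernoulli_pmf (1/2))))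
         (pair_pmf (pmf_of_set {..<n}) (pair_pmf (bernoulli_pmf (1/2)) (bernoulli_pmf (1/2))))))"
proof -
  let ?U = "Pi_pmf {..<n} False (\<lambda>_. bernoulli_pmf (1/2))"
  have "bind_pmf ?U (\<lambda>u. g (\<lambda>i l. i = d l \<and> u l)) = bind_pmf ?U (\<lambda>uA. bind_pmf ?U (\<lambda>uB.
      g (\<lambda>i l. i = d l \<and> (if i < k div 2 then uA l else uB l))))" for d :: "nat \<Rightarrow> nat" and g :: "_ \<Rightarrow> block pmf"
  proof -
    have "bind_pmf ?U (\<lambda>u. g (\<lambda>i l. i = d l \<and> u l)) =
       bind_pmf (map_pmf (\<lambda>(f, g) l. if d l < k div 2 then f l else g l) (pair_pmf ?U ?U)) (\<lambda>u. g (\<lambda>i l. i = d l \<and> u l))"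
      by (subst Pi_pmf_mix[where P="\<lambda>l. d l < k div 2"]) auto
    also have "\<dots> = bind_pmf ?U (\<lambda>uA. bind_pmf ?U (\<lambda>uB.
      g (\<lambda>i l. i = d l \<and> (if d l < k div 2 then uA l else uB l))))"
      by (simp add: map_pmf_def pair_pmf_def bind_assoc_pmf bind_return_pmf)
    \<comment> \<open>The bit matters only if \<open>i = d l\<close>, so the test on
      \<open>d l\<close> may be made on the reading site \<open>i\<close> instead.\<close>
    also have "(\<lambda>uA uB i l. i = d l \<and> (if d l < k div 2 then uA l else uB l)) =
        (\<lambda>uA uB i l. i = d l \<and> (if i < k div 2 then uA l else uB l))"
      by (auto simp: fun_eq_iff)
    finally show ?thesis by meson
  qed
  from this[where g="\<lambda>B. bind_pmf (pmf_of_set {..<n}) (\<lambda>m. bind_pmf (bernoulli_pmf (1/2)) (\<lambda>x. bind_pmf (bernoulli_pmf (1/2)) (\<lambda>y.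
     return_pmf \<lparr> Dir = _, Special = m, Bits = (\<lambda>i l. if l = m then (if i < k div 2 then x else y) else B i l) \<rparr>)))"]
  show ?thesis
    by (simp add: block_dist_def map_pmf_def pair_pmf_def bind_assoc_pmf bind_return_pmf)
qed

definition dir_dist where "dir_dist k n N = Pi_pmf {..<N} (\<lambda>_. 0) (\<lambda>_. Pi_pmf {..<n} 0 (\<lambda>_. pmf_of_set {..<k}))"
definition noise_dist where "noise_dist n N = Pi_pmf {..<N} (\<lambda>_. False) (\<lambda>_. Pi_pmf {..<n} False (\<lambda>_. bernoulli_pmf (1/2)))"
definition special_dist where "special_dist n N = Pi_pmf {..<N} 0 (\<lambda>_. pmf_of_set {..<n})"
definition bit_dist where "bit_dist N = Pi_pmf {..<N} False (\<lambda>_. bernoulli_pmf (1/2))"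

text \<open>Independent blocks of independent components are regrouped into independent families, so
  that directions and special coordinates can be fixed while signs and noise stay random.\<close>

lemma nu_eq:
  "nu k n N = map_pmf (\<lambda>(d, (uA, uB), m, x, y) j. mk_block k (d j, (uA j, uB j), m j, x j, y j))
     (pair_pmf (dir_dist k n N) (pair_pmf (pair_pmf (noise_dist n N) (noise_dist n N))
       (pair_pmf (special_dist n N) (pair_pmf (bit_dist N) (bit_dist N)))))"
proof -
  have "nu k n N = map_pmf ((\<circ>) (mk_block k)) (Pi_pmf {..<N} (\<lambda>_. 0, (\<lambda>_. False, \<lambda>_. False), 0, False, False)
      (\<lambda>_. pair_pmf (Pi_pmf {..<n} 0 (\<lambda>_. pmf_of_set {..<k}))
       (pair_pmf (pair_pmf (Pi_pmf {..<n} False (\<lambda>_. bernoulli_pmf (1/2)))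
                           (Pi_pmf {..<n} False (\<lambda>_. bernoulli_pmf (1/2))))
         (pair_pmf (pmf_of_set {..<n}) (pair_pmf (bernoulli_pmf (1/2)) (bernoulli_pmf (1/2)))))))"
    unfolding nu_def block_dist_eq by (rule Pi_pmf_map) (auto simp: fun_eq_iff)
  then show ?thesis
    unfolding Pi_pmf_pair[OF finite_lessThan]
    by (simp add: dir_dist_def noise_dist_def special_dist_def bit_dist_def
       map_pmf_def pair_pmf_def bind_assoc_pmf bind_return_pmf o_def)
qed

section \<open>Factorization of the transcript probabilities\<close>

text \<open>The sites in \<open>S\<close> write the bits of \<open>t\<close>, provided that the other sites do so.\<close>

primrec consistent :: "nat set \<Rightarrow> ptree \<Rightarrow> bool list \<Rightarrow> inputs \<Rightarrow> (nat \<Rightarrow> nat) \<Rightarrow> bool" where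
  "consistent S (Output v) t B r \<longleftrightarrow> t = []"
| "consistent S (Speak i f t\<^sub>0 t\<^sub>1) t B r \<longleftrightarrow> (case t of [] \<Rightarrow> False | c # t' \<Rightarrow>
     (i \<in> S \<longrightarrow> f (B i) (r i) = c) \<and> (if c then consistent S t\<^sub>1 t' B r else consistent S t\<^sub>0 t' B r))"

text \<open>The rectangle property: each bit is written by a site of \<open>S\<close> or of its
  complement, and each of the two conditions looks only at its own sites.\<close>

lemma board_eq_iff: "board T B r = t \<longleftrightarrow> consistent S T t B r \<and> consistent (- S) T t B r"
  by (induction T arbitrary: t) (auto split: list.splits)

lemma consistent_cong:
  assumes "\<And>i. i \<in> S \<Longrightarrow> B i = B' i" "\<And>i. i \<in> S \<Longrightarrow> r i = r' i"
  shows "consistent S T t B r \<longleftrightarrow> consistent S T t B' r'"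
  using assms by (induction T arbitrary: t) (auto split: list.splits)

primrec paths :: "ptree \<Rightarrow> bool list set" where
  "paths (Output v) = {[]}"
| "paths (Speak i f t\<^sub>0 t\<^sub>1) = (#) False ` paths t\<^sub>0 \<union> (#) True ` paths t\<^sub>1"

lemma finite_paths: "finite (paths T)"
  by (induction T) auto

lemma board_in_paths: "board T B r \<in> paths T"
  by (induction T) auto

text \<open>Shows the answer to be a function of the board. The value for an exhausted list is a
  placeholder, as no board stops at an inner node.\<close>

primrec verdict :: "ptree \<Rightarrow> bool list \<Rightarrow> bool" where
  "verdict (Output v) t = v"
| "verdict (Speak i f t\<^sub>0 t\<^sub>1) t =
     (case t of [] \<Rightarrow> False | c # t' \<Rightarrow> if c then verdict t\<^sub>1 t' else verdict t\<^sub>0 t')"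

lemma answer_eq_verdict: "answer T B r = verdict T (board T B r)"
  by (induction T) auto

section \<open>Conditioning on directions, special coordinates and public coins\<close>

text \<open>Once \<open>d\<close> and \<open>m\<close> are fixed, the sites of the first half depend
  only on \<open>x\<close> and \<open>uA\<close>, the others only on \<open>y\<close> and
  \<open>uB\<close>.\<close>

definition site_bits :: "nat \<Rightarrow> (nat \<Rightarrow> nat \<Rightarrow> nat) \<Rightarrow> (nat \<Rightarrow> nat) \<Rightarrow> (nat \<Rightarrow> bool) \<Rightarrow> (nat \<Rightarrow> bool)
    \<Rightarrow> (nat \<Rightarrow> nat \<Rightarrow> bool) \<Rightarrow> (nat \<Rightarrow> nat \<Rightarrow> bool) \<Rightarrow> inputs" where
  "site_bits k d m x y uA uB = (\<lambda>i j l. if l = m j then (if i < k div 2 then x j else y j)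
     else i = d j l \<and> (if i < k div 2 then uA j l else uB j l))"

definition of_list :: "nat \<Rightarrow> bool list \<Rightarrow> nat \<Rightarrow> bool" where
  "of_list N xs = (\<lambda>j. if j < N then xs ! j else False)"

lemma bit_dist_eq: "bit_dist N = map_pmf (of_list N) (pmf_of_set (cube N))"
proof -
  have "bij_betw (of_list N) (cube N) (PiE_dflt {..<N} False (\<lambda>_. UNIV))"
  proof (rule bij_betwI')
    fix x y assume "x \<in> cube N" "y \<in> cube N"
    then show "(of_list N x = of_list N y) = (x = y)"
      unfolding cube_def of_list_def by (auto simp: fun_eq_iff intro!: nth_equalityI)
  next
    fix x show "of_list N x \<in> PiE_dflt {..<N} False (\<lambda>_. UNIV)"
      by (auto simp: of_list_def PiE_dflt_def)
  next
    fix f :: "nat \<Rightarrow> bool" assume "f \<in> PiE_dflt {..<N} False (\<lambda>_. UNIV)"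
    then have "f = of_list N (map f [0..<N])" "map f [0..<N] \<in> cube N"
      by (auto simp: of_list_def PiE_dflt_def cube_def fun_eq_iff)
    then show "\<exists>x\<in>cube N. f = of_list N x" by blast
  qed
  moreover have "cube N \<noteq> {}" by (auto simp: cube_def intro: exI[of _ "replicate N True"])
  ultimately have "map_pmf (of_list N) (pmf_of_set (cube N)) = pmf_of_set (PiE_dflt {..<N} False (\<lambda>_. UNIV))"
    by (intro map_pmf_of_set_bij_betw) auto
  then show ?thesis
    unfolding bit_dist_def bernoulli_pmf_half_conv_pmf_of_set by (subst Pi_pmf_of_set) auto
qed

text \<open>The list form of \<open>Mvar\<close> and \<open>Dvar\<close>. Outside the index ranges
  the decoders return the default values of the product laws, which makes decoding exact on their
  supports.\<close>

definition enc :: "nat \<Rightarrow> nat \<Rightarrow> (nat \<Rightarrow> nat \<Rightarrow> nat) \<Rightarrow> (nat \<Rightarrow> nat) \<Rightarrow> nat list \<times> nat list list" where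
  "enc n N d m = (map m [0..<N], map (\<lambda>j. map (d j) [0..<n]) [0..<N])"

definition dec_dir :: "nat \<Rightarrow> nat \<Rightarrow> nat list \<times> nat list list \<Rightarrow> nat \<Rightarrow> nat \<Rightarrow> nat" where
  "dec_dir n N z = (\<lambda>j. if j < N then (\<lambda>l. if l < n then snd z ! j ! l else 0) else (\<lambda>_. 0))"

definition dec_special :: "nat \<Rightarrow> nat list \<times> nat list list \<Rightarrow> nat \<Rightarrow> nat" where
  "dec_special N z = (\<lambda>j. if j < N then fst z ! j else 0)"

lemma dec_enc:
  assumes "d \<in> set_pmf (dir_dist k n N)" "m \<in> set_pmf (special_dist n N)"
  shows "dec_dir n N (enc n N d m) = d" "dec_special N (enc n N d m) = m"
proof -
  have "\<forall>j. j \<notin> {..<N} \<longrightarrow> d j = (\<lambda>_. 0)" "\<forall>j<N. d j \<in> set_pmf (Pi_pmf {..<n} 0 (\<lambda>_. pmf_of_set {..<k}))"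
    using assms(1) by (auto simp: dir_dist_def set_Pi_pmf PiE_dflt_def)
  moreover have "\<forall>j. j \<notin> {..<N} \<longrightarrow> m j = 0"
    using assms(2) by (auto simp: special_dist_def set_Pi_pmf PiE_dflt_def)
  moreover have "\<forall>l. l \<notin> {..<n} \<longrightarrow> d j l = 0" if "j < N" for j
  proof -
    have "d j \<in> set_pmf (Pi_pmf {..<n} 0 (\<lambda>_. pmf_of_set {..<k}))"
      using calculation(2) that by simp
    from subsetD[OF set_Pi_pmf_subset[OF finite_lessThan] this] show ?thesis by simp
  qed
  ultimately show "dec_dir n N (enc n N d m) = d" "dec_special N (enc n N d m) = m"
    by (auto simp: dec_dir_def dec_special_def enc_def fun_eq_iff)
qed

text \<open>The public coins count as part of the transcript, but they join M and D here because the
  two halves are independent once all three are fixed.\<close>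

definition context_dist :: "nat \<Rightarrow> nat \<Rightarrow> nat \<Rightarrow> protocol \<Rightarrow> ((nat list \<times> nat list list) \<times> nat) pmf" where
  "context_dist k n N P = bind_pmf (dir_dist k n N) (\<lambda>d. bind_pmf (special_dist n N) (\<lambda>m.
     bind_pmf (Public P) (\<lambda>s. return_pmf (enc n N d m, s))))"

definition coin_dist :: "nat \<Rightarrow> protocol \<Rightarrow> (nat \<Rightarrow> nat) pmf" where
  "coin_dist k P = Pi_pmf {..<k} 0 (Private P)"

text \<open>The law of the board given the context and the signs. Each half has its own copy of all
  noise bits and all private coins and reads only those of its own sites.\<close>

definition kernel :: "nat \<Rightarrow> nat \<Rightarrow> nat \<Rightarrow> protocol \<Rightarrow> (nat list \<times> nat list list) \<times> nat
    \<Rightarrow> bool list \<times> bool list \<Rightarrow> bool list pmf" where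
  "kernel k n N P = (\<lambda>(z, s) (x, y).
     map_pmf (\<lambda>((uA, rA), (uB, rB)). board (Tree P s)
         (site_bits k (dec_dir n N z) (dec_special N z) (of_list N x) (of_list N y) uA uB)
         (\<lambda>i. if i < k div 2 then rA i else rB i))
       (pair_pmf (pair_pmf (noise_dist n N) (coin_dist k P)) (pair_pmf (noise_dist n N) (coin_dist k P))))"

lemma execution_eq:
  "execution k n N P = bind_pmf (dir_dist k n N) (\<lambda>d. bind_pmf (special_dist n N) (\<lambda>m.
     bind_pmf (Public P) (\<lambda>s. bind_pmf (pmf_of_set (cube N)) (\<lambda>x. bind_pmf (pmf_of_set (cube N)) (\<lambda>y.
     bind_pmf (coin_dist k P) (\<lambda>rA. bind_pmf (coin_dist k P) (\<lambda>rB.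
     bind_pmf (noise_dist n N) (\<lambda>uA. bind_pmf (noise_dist n N) (\<lambda>uB.
       return_pmf (\<lambda>j. mk_block k (d j, (uA j, uB j), m j, of_list N x j, of_list N y j), s,
         \<lambda>i. if i < k div 2 then rA i else rB i))))))))))"
proof -
  have R: "Pi_pmf {..<k} 0 (Private P) = map_pmf (\<lambda>(f, g) x. if x < k div 2 then f x else g x)
      (pair_pmf (coin_dist k P) (coin_dist k P))"
    unfolding coin_dist_def by (rule Pi_pmf_mix) simp
  have "execution k n N P = bind_pmf (dir_dist k n N) (\<lambda>d.
     bind_pmf (noise_dist n N) (\<lambda>uA. bind_pmf (noise_dist n N) (\<lambda>uB.
     bind_pmf (special_dist n N) (\<lambda>m.
     bind_pmf (pmf_of_set (cube N)) (\<lambda>x. bind_pmf (pmf_of_set (cube N)) (\<lambda>y.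
     bind_pmf (Public P) (\<lambda>s.
     bind_pmf (coin_dist k P) (\<lambda>rA. bind_pmf (coin_dist k P) (\<lambda>rB.
       return_pmf (\<lambda>j. mk_block k (d j, (uA j, uB j), m j, of_list N x j, of_list N y j), s,
         \<lambda>i. if i < k div 2 then rA i else rB i))))))))))"
    unfolding execution_def nu_eq R bit_dist_eq
    by (simp add: map_pmf_def pair_pmf_def bind_assoc_pmf bind_return_pmf del: mk_block.simps)
  also have "\<dots> = bind_pmf (dir_dist k n N) (\<lambda>d. bind_pmf (special_dist n N) (\<lambda>m.
     bind_pmf (Public P) (\<lambda>s. bind_pmf (pmf_of_set (cube N)) (\<lambda>x. bind_pmf (pmf_of_set (cube N)) (\<lambda>y.
     bind_pmf (coin_dist k P) (\<lambda>rA. bind_pmf (coin_dist k P) (\<lambda>rB.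
     bind_pmf (noise_dist n N) (\<lambda>uA. bind_pmf (noise_dist n N) (\<lambda>uB.
       return_pmf (\<lambda>j. mk_block k (d j, (uA j, uB j), m j, of_list N x j, of_list N y j), s,
         \<lambda>i. if i < k div 2 then rA i else rB i))))))))))"
    by (simp only: bind_commute_pmf[of "noise_dist n N" "special_dist n N"]
        bind_commute_pmf[of "noise_dist n N" "pmf_of_set (cube N)"]
        bind_commute_pmf[of "noise_dist n N" "Public P"]
        bind_commute_pmf[of "noise_dist n N" "coin_dist k P"]
        bind_commute_pmf[of "pmf_of_set (cube N)" "Public P"])
  finally show ?thesis .
qed

text \<open>With \<open>k\<close> at least 4 both halves are nonempty, so \<open>Xvar\<close> and
  \<open>Yvar\<close> return the common bit of a half instead of holding vacuously; the rest is
  reordering of independent draws.\<close>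

lemma joint_dist_eq:
  assumes k: "4 \<le> k"
  shows "map_pmf (\<lambda>\<omega>. (case \<omega> of (w, s, r) \<Rightarrow> (Xvar k N w, Yvar k N w), transcript P \<omega>,
      case \<omega> of (w, s, r) \<Rightarrow> (Mvar N w, Dvar n N w))) (execution k n N P) =
    bind_pmf (context_dist k n N P) (\<lambda>zs. bind_pmf (pair_pmf (pmf_of_set (cube N)) (pmf_of_set (cube N))) (\<lambda>xy.
      bind_pmf (kernel k n N P zs xy) (\<lambda>t. return_pmf (xy, (snd zs, t), fst zs))))"
proof -
  have cube_ne: "cube N \<noteq> {}" by (auto simp: cube_def intro: exI[of _ "replicate N True"])
  have k2: "0 < k div 2" "\<exists>i\<ge>k div 2. i < k" using k by (auto intro: exI[of _ "k div 2"])
  have "bind_pmf (context_dist k n N P) (\<lambda>zs. bind_pmf (pair_pmf (pmf_of_set (cube N)) (pmf_of_set (cube N))) (\<lambda>xy.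
      bind_pmf (kernel k n N P zs xy) (\<lambda>t. return_pmf (xy, (snd zs, t), fst zs)))) =
    bind_pmf (dir_dist k n N) (\<lambda>d. bind_pmf (special_dist n N) (\<lambda>m.
     bind_pmf (Public P) (\<lambda>s. bind_pmf (pmf_of_set (cube N)) (\<lambda>x. bind_pmf (pmf_of_set (cube N)) (\<lambda>y.
     bind_pmf (coin_dist k P) (\<lambda>rA. bind_pmf (coin_dist k P) (\<lambda>rB.
     bind_pmf (noise_dist n N) (\<lambda>uA. bind_pmf (noise_dist n N) (\<lambda>uB.
       return_pmf ((x, y), (s, board (Tree P s)
         (site_bits k (dec_dir n N (enc n N d m)) (dec_special N (enc n N d m)) (of_list N x) (of_list N y) uA uB)
         (\<lambda>i. if i < k div 2 then rA i else rB i)), enc n N d m))))))))))"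
    by (simp add: context_dist_def kernel_def map_pmf_def pair_pmf_def bind_assoc_pmf bind_return_pmf)
      (simp only: bind_commute_pmf[of "noise_dist n N" "coin_dist k P"])
  also have "\<dots> = map_pmf (\<lambda>\<omega>. (case \<omega> of (w, s, r) \<Rightarrow> (Xvar k N w, Yvar k N w), transcript P \<omega>,
      case \<omega> of (w, s, r) \<Rightarrow> (Mvar N w, Dvar n N w))) (execution k n N P)"
    unfolding execution_eq map_bind_pmf map_return_pmf
  proof (intro bind_pmf_cong refl arg_cong[where f=return_pmf])
    fix d m s x y rA rB uA uB
    assume dm: "d \<in> set_pmf (dir_dist k n N)" "m \<in> set_pmf (special_dist n N)"
      and "x \<in> set_pmf (pmf_of_set (cube N))" "y \<in> set_pmf (pmf_of_set (cube N))"
    then have "x \<in> cube N" "y \<in> cube N" using cube_ne by auto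
    then have xy: "length x = N" "length y = N" by (auto simp: cube_def)
    let ?w = "\<lambda>j. mk_block k (d j, (uA j, uB j), m j, of_list N x j, of_list N y j)"
    have "Xvar k N ?w = x" "Yvar k N ?w = y"
      using xy k2 by (auto simp: Xvar_def Yvar_def of_list_def intro!: nth_equalityI)
    moreover have "(Mvar N ?w, Dvar n N ?w) = enc n N d m"
      by (simp add: Mvar_def Dvar_def enc_def)
    moreover have "inputs_of ?w = site_bits k d m (of_list N x) (of_list N y) uA uB"
      by (simp add: inputs_of_def site_bits_def fun_eq_iff)
    ultimately show "((x, y), (s, board (Tree P s)
         (site_bits k (dec_dir n N (enc n N d m)) (dec_special N (enc n N d m)) (of_list N x) (of_list N y) uA uB)
         (\<lambda>i. if i < k div 2 then rA i else rB i)), enc n N d m) =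
      (case (?w, s, \<lambda>i. if i < k div 2 then rA i else rB i) of (w, s, r) \<Rightarrow> (Xvar k N w, Yvar k N w),
       transcript P (?w, s, \<lambda>i. if i < k div 2 then rA i else rB i),
       case (?w, s, \<lambda>i. if i < k div 2 then rA i else rB i) of (w, s, r) \<Rightarrow> (Mvar N w, Dvar n N w))"
      unfolding dec_enc[OF dm] transcript_def by simp
  qed
  finally show ?thesis ..
qed

section \<open>Product form of the transcript law\<close>

lemma prob_pair_pmf_Times:
  "measure_pmf.prob (pair_pmf A B) (S \<times> T) = measure_pmf.prob A S * measure_pmf.prob B T"
proof -
  have "emeasure (pair_pmf A B) (S \<times> T) = (\<integral>\<^sup>+a. \<integral>\<^sup>+b. indicator S a * indicator T b \<partial>B \<partial>A)"
    by (subst nn_integral_indicator[symmetric], simp, subst nn_integral_pair_pmf')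
      (simp add: indicator_times)
  also have "\<dots> = emeasure A S * emeasure B T"
    by (simp add: nn_integral_cmult nn_integral_multc)
  finally show ?thesis
    by (simp add: measure_def enn2real_mult)
qed

text \<open>The contribution of the first half to the probability of \<open>t\<close>. The
  \<open>False\<close> entries stand in for signs and noise of the other half, which
  \<open>consistent {..<k div 2}\<close> never reads.\<close>

definition alice :: "nat \<Rightarrow> nat \<Rightarrow> nat \<Rightarrow> protocol \<Rightarrow> (nat list \<times> nat list list) \<times> nat
    \<Rightarrow> bool list \<Rightarrow> bool list \<Rightarrow> real" where
  "alice k n N P zs t x = measure_pmf.prob (pair_pmf (noise_dist n N) (coin_dist k P))
     {(u, r). consistent {..<k div 2} (Tree P (snd zs)) t
        (site_bits k (dec_dir n N (fst zs)) (dec_special N (fst zs)) (of_list N x) (\<lambda>_. False) u (\<lambda>_ _. False)) r}"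

definition bob :: "nat \<Rightarrow> nat \<Rightarrow> nat \<Rightarrow> protocol \<Rightarrow> (nat list \<times> nat list list) \<times> nat
    \<Rightarrow> bool list \<Rightarrow> bool list \<Rightarrow> real" where
  "bob k n N P zs t y = measure_pmf.prob (pair_pmf (noise_dist n N) (coin_dist k P))
     {(u, r). consistent (- {..<k div 2}) (Tree P (snd zs)) t
        (site_bits k (dec_dir n N (fst zs)) (dec_special N (fst zs)) (\<lambda>_. False) (of_list N y) (\<lambda>_ _. False) u) r}"

text \<open>By \<open>board_eq_iff\<close> the event is a product of an event about
  \<open>(uA, rA)\<close> and one about \<open>(uB, rB)\<close>, and these pairs are
  independent.\<close>

lemma pmf_kernel:
  "pmf (kernel k n N P zs (x, y)) t = alice k n N P zs t x * bob k n N P zs t y"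
proof -
  obtain z s where zs: "zs = (z, s)" by (cases zs)
  let ?d = "dec_dir n N z" and ?m = "dec_special N z"
  let ?f = "\<lambda>((uA, rA), (uB, rB)). board (Tree P s)
         (site_bits k ?d ?m (of_list N x) (of_list N y) uA uB)
         (\<lambda>i. if i < k div 2 then rA i else rB i)"
  have "?f -` {t} = {(u, r). consistent {..<k div 2} (Tree P s) t
        (site_bits k ?d ?m (of_list N x) (\<lambda>_. False) u (\<lambda>_ _. False)) r} \<times>
     {(u, r). consistent (- {..<k div 2}) (Tree P s) t
        (site_bits k ?d ?m (\<lambda>_. False) (of_list N y) (\<lambda>_ _. False) u) r}"
  proof -
    have "board (Tree P s) (site_bits k ?d ?m (of_list N x) (of_list N y) uA uB)
         (\<lambda>i. if i < k div 2 then rA i else rB i) = t \<longleftrightarrow>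
       consistent {..<k div 2} (Tree P s) t
        (site_bits k ?d ?m (of_list N x) (\<lambda>_. False) uA (\<lambda>_ _. False)) rA \<and>
       consistent (- {..<k div 2}) (Tree P s) t
        (site_bits k ?d ?m (\<lambda>_. False) (of_list N y) (\<lambda>_ _. False) uB) rB" for uA uB rA rB
      unfolding board_eq_iff[where S="{..<k div 2}"]
      by (intro arg_cong2[where f="(\<and>)"] consistent_cong) (auto simp: site_bits_def fun_eq_iff)
    then show ?thesis by auto
  qed
  then show ?thesis
    unfolding zs kernel_def alice_def bob_def by (simp add: pmf_map prob_pair_pmf_Times)
qed

lemma set_kernel: "set_pmf (kernel k n N P zs xy) \<subseteq> paths (Tree P (snd zs))"
  by (cases zs; cases xy) (auto simp: kernel_def board_in_paths)

lemma two_party_kernel: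
  "two_party (paths (Tree P (snd zs))) (alice k n N P zs) (bob k n N P zs) N"
proof
  fix x y :: "bool list"
  show "(\<Sum>t\<in>paths (Tree P (snd zs)). alice k n N P zs t x * bob k n N P zs t y) = 1"
    unfolding pmf_kernel[symmetric] by (intro sum_pmf_eq_1 finite_paths set_kernel)
qed (auto simp: finite_paths alice_def bob_def)

section \<open>k-BTX as a gap problem for the inner product\<close>

lemma corr_eq_sum:
  assumes "length x = N" "length y = N"
  shows "corr x y = real N - 2 * (\<Sum>j<N. of_bool (x ! j \<noteq> y ! j))"
  using assms
proof (induction N arbitrary: x y)
  case (Suc N)
  then obtain a x' b y' where "x = a # x'" "y = b # y'" "length x' = N" "length y' = N"
    by (auto simp: length_Suc_conv)
  then show ?case
    using Suc.IH[of x' y'] by (cases a; cases b) (simp_all add: sum.lessThan_Suc_shift del: sum.lessThan_Suc)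
qed simp

text \<open>An ordinary coordinate has at most one site with a 1, fewer than k / 2. So only the
  special coordinate can count, and it has k / 2 ones exactly when one half holds ones and the other
  zeros.\<close>

lemma kXOR_site_bits:
  assumes k: "4 \<le> k" "even k" and m: "m j < n"
  shows "kXOR k n (\<lambda>i. site_bits k d m x y uA uB i j) \<longleftrightarrow> x j \<noteq> y j"
proof -
  let ?S = "\<lambda>l. {i. i < k \<and> site_bits k d m x y uA uB i j l}"
  have ne: "card (?S l) \<noteq> k div 2" if "l \<noteq> m j" for l
  proof -
    have "card (?S l) \<le> card {d j l}"
      using that by (intro card_mono) (auto simp: site_bits_def)
    then show ?thesis using k by auto
  qed
  define S where "S = ?S (m j)"
  have "S = (if x j then {..<k div 2} else {}) \<union> (if y j then {k div 2..<k} else {})"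
    by (auto simp: S_def site_bits_def)
  moreover have "{..<k div 2} \<union> {k div 2..<k} = {..<k}" by auto
  ultimately have S: "card S = k div 2 \<longleftrightarrow> x j \<noteq> y j"
    using k(1) even_two_times_div_two[OF k(2)] by (cases "x j"; cases "y j") auto
  show ?thesis
    unfolding kXOR_def
  proof
    assume "\<exists>l<n. card (?S l) = k div 2"
    then obtain l where "card (?S l) = k div 2" by blast
    moreover from this ne have "l = m j" by blast
    ultimately show "x j \<noteq> y j" using S by (simp add: S_def)
  next
    assume "x j \<noteq> y j"
    then show "\<exists>l<n. card (?S l) = k div 2" using S m unfolding S_def by blast
  qed
qed

text \<open>The sum of the block values is (N - corr) / 2 and N = 1 / \<epsilon>^2, so the deviation
  is |corr| / 2; the thresholds follow from 1 / \<epsilon> = sqrt N.\<close>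

lemma kBTX_site_bits:
  assumes k: "4 \<le> k" "even k" and m: "\<And>j. j < N \<Longrightarrow> m j < n"
    and xy: "x \<in> cube N" "y \<in> cube N" and \<epsilon>: "0 < \<epsilon>" "real N = 1 / \<epsilon>\<^sup>2"
  shows "kBTX \<epsilon> k n N (site_bits k d m (of_list N x) (of_list N y) uA uB) = Some v \<longleftrightarrow>
    (if v then \<bar>corr x y\<bar> \<ge> 4 * sqrt (real N) else \<bar>corr x y\<bar> \<le> 2 * sqrt (real N))"
proof -
  have len: "length x = N" "length y = N" using xy by (auto simp: cube_def)
  have "(\<Sum>j<N. of_bool (kXOR k n (\<lambda>i. site_bits k d m (of_list N x) (of_list N y) uA uB i j)))
      = (\<Sum>j<N. of_bool (x ! j \<noteq> y ! j) :: real)"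
    by (intro sum.cong refl arg_cong[where f=of_bool])
      (use kXOR_site_bits[where m = m, OF k m] in \<open>auto simp: of_list_def\<close>)
  also have "\<dots> = (real N - corr x y) / 2" using corr_eq_sum[OF len] by simp
  finally have sum: "(\<Sum>j<N. of_bool (kXOR k n (\<lambda>i. site_bits k d m (of_list N x) (of_list N y) uA uB i j)))
      = (real N - corr x y) / 2" .
  have sq: "sqrt (real N) = 1 / \<epsilon>" using \<epsilon> by (simp add: real_sqrt_divide)
  have dev: "\<bar>(real N - corr x y) / 2 - 1 / (2 * \<epsilon>\<^sup>2)\<bar> = \<bar>corr x y\<bar> / 2"
    using \<epsilon>(2) by (simp add: field_simps)
  define c where "c = 1 / \<epsilon>"
  have c: "c > 0" "2 / \<epsilon> = 2 * c" using \<epsilon> by (auto simp: c_def)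
  show ?thesis
    unfolding kBTX_def Let_def sum dev sq c(2) c_def[symmetric] using c(1) by auto
qed

definition erroneous :: "nat \<Rightarrow> protocol \<Rightarrow> (bool list \<times> bool list) \<times> (nat \<times> bool list) \<times> 'z \<Rightarrow> bool" where
  "erroneous N P = (\<lambda>((x, y), (s, t), z). if verdict (Tree P s) t then \<bar>corr x y\<bar> \<le> 2 * sqrt (real N)
     else \<bar>corr x y\<bar> \<ge> 4 * sqrt (real N))"

lemma error_prob_eq:
  assumes k: "4 \<le> k" "even k" and n: "1 \<le> n" and \<epsilon>: "0 < \<epsilon>" "real N = 1 / \<epsilon>\<^sup>2"
  shows "error_prob \<epsilon> k n N P = measure_pmf.prob
    (bind_pmf (context_dist k n N P) (\<lambda>zs. bind_pmf (pair_pmf (pmf_of_set (cube N)) (pmf_of_set (cube N))) (\<lambda>xy.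
      bind_pmf (kernel k n N P zs xy) (\<lambda>t. return_pmf (xy, (snd zs, t), fst zs))))) {e. erroneous N P e}"
proof -
  have cube_ne: "cube N \<noteq> {}" by (auto simp: cube_def intro: exI[of _ "replicate N True"])
  have k2: "0 < k div 2" "\<exists>i\<ge>k div 2. i < k" using k by (auto intro: exI[of _ "k div 2"])
  have "(case \<omega> of (w, s, r) \<Rightarrow> kBTX \<epsilon> k n N (inputs_of w) = Some (\<not> answer (Tree P s) (inputs_of w) r)) \<longleftrightarrow>
     erroneous N P (case \<omega> of (w, s, r) \<Rightarrow> (Xvar k N w, Yvar k N w), transcript P \<omega>,
      case \<omega> of (w, s, r) \<Rightarrow> (Mvar N w, Dvar n N w))"
    if "\<omega> \<in> set_pmf (execution k n N P)" for \<omega>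
  proof -
    from that obtain d m s x y rA rB uA uB where
      m: "m \<in> set_pmf (special_dist n N)"
      and xy: "x \<in> set_pmf (pmf_of_set (cube N))" "y \<in> set_pmf (pmf_of_set (cube N))"
      and \<omega>: "\<omega> = (\<lambda>j. mk_block k (d j, (uA j, uB j), m j, of_list N x j, of_list N y j), s,
         \<lambda>i. if i < k div 2 then rA i else rB i)"
      unfolding execution_eq by (auto simp del: mk_block.simps)
    let ?w = "\<lambda>j. mk_block k (d j, (uA j, uB j), m j, of_list N x j, of_list N y j)"
    have xy: "x \<in> cube N" "y \<in> cube N" using xy cube_ne by auto
    then have len: "length x = N" "length y = N" by (auto simp: cube_def)
    have m: "m j < n" if "j < N" for j
    proof -
      have "m j \<in> set_pmf (pmf_of_set {..<n})"
        using m that by (auto simp: special_dist_def set_Pi_pmf PiE_dflt_def)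
      moreover have "{..<n} \<noteq> {}" using n by (auto simp: lessThan_empty_iff)
      ultimately show ?thesis by simp
    qed
    have XY: "Xvar k N ?w = x" "Yvar k N ?w = y"
      using len k2 by (auto simp: Xvar_def Yvar_def of_list_def intro!: nth_equalityI)
    have inp: "inputs_of ?w = site_bits k d m (of_list N x) (of_list N y) uA uB"
      by (simp add: inputs_of_def site_bits_def fun_eq_iff)
    have kBTX: "kBTX \<epsilon> k n N (site_bits k d m (of_list N x) (of_list N y) uA uB) = Some v \<longleftrightarrow>
      (if v then \<bar>corr x y\<bar> \<ge> 4 * sqrt (real N) else \<bar>corr x y\<bar> \<le> 2 * sqrt (real N))" for v
      by (rule kBTX_site_bits[OF k _ xy \<epsilon>]) (rule m)
    show ?thesis
      unfolding \<omega> transcript_def prod.case erroneous_def XY inp kBTX answer_eq_verdict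
      by simp
  qed
  then have "error_prob \<epsilon> k n N P = measure_pmf.prob (execution k n N P)
     ((\<lambda>\<omega>. (case \<omega> of (w, s, r) \<Rightarrow> (Xvar k N w, Yvar k N w), transcript P \<omega>,
      case \<omega> of (w, s, r) \<Rightarrow> (Mvar N w, Dvar n N w))) -` {e. erroneous N P e})"
    unfolding error_prob_def
    by (intro measure_pmf.finite_measure_eq_AE) (auto simp: AE_measure_pmf_iff)
  also have "\<dots> = measure_pmf.prob (map_pmf (\<lambda>\<omega>. (case \<omega> of (w, s, r) \<Rightarrow> (Xvar k N w, Yvar k N w), transcript P \<omega>,
      case \<omega> of (w, s, r) \<Rightarrow> (Mvar N w, Dvar n N w))) (execution k n N P)) {e. erroneous N P e}"
    by simp
  also note joint_dist_eq[OF k(1)]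
  finally show ?thesis .
qed

section \<open>Information of discrete random variables\<close>

lemma expectation_bind_pmf:
  fixes f :: "'a \<Rightarrow> real"
  assumes "\<And>x. x \<in> set_pmf (bind_pmf M K) \<Longrightarrow> \<bar>f x\<bar> \<le> B"
  shows "measure_pmf.expectation (bind_pmf M K) f =
    measure_pmf.expectation M (\<lambda>x. measure_pmf.expectation (K x) f)"
proof -
  \<comment> \<open>The integration rule wants a bound at every point, while \<open>f\<close> is
    bounded only on the support; \<open>g\<close> vanishes elsewhere.\<close>
  define g where "g x = (if x \<in> set_pmf (bind_pmf M K) then f x else 0)" for x
  obtain x0 where "x0 \<in> set_pmf (bind_pmf M K)" using set_pmf_not_empty[of "bind_pmf M K"] by blast
  then have "B \<ge> 0" using assms[of x0] by linarith
  then have g: "\<bar>g x\<bar> \<le> B" for x using assms by (auto simp: g_def)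
  have "measure_pmf.expectation (bind_pmf M K) f = measure_pmf.expectation (bind_pmf M K) g"
    by (intro integral_cong_AE) (auto simp: AE_measure_pmf_iff g_def)
  also have "\<dots> = measure_pmf.expectation M (\<lambda>x. measure_pmf.expectation (K x) g)"
    unfolding measure_pmf_bind using g
    by (intro integral_bind[where K="count_space UNIV" and B=B and B'=1])
      (auto simp: measure_pmf.finite_measure_axioms measure_pmf.emeasure_space_1
        measure_pmf_in_subprob_space)
  also have "\<dots> = measure_pmf.expectation M (\<lambda>x. measure_pmf.expectation (K x) f)"
  proof (intro integral_cong_AE)
    show "AE x in measure_pmf M. measure_pmf.expectation (K x) g = measure_pmf.expectation (K x) f"
      unfolding AE_measure_pmf_iff
      by (intro ballI integral_cong_AE) (auto simp: AE_measure_pmf_iff g_def)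
  qed auto
  finally show ?thesis .
qed

text \<open>On countable types the product sigma-algebra contains every set, so it suffices to
  compare the measures on rectangles.\<close>

lemma pair_measure_pmf:
  fixes p :: "'a :: countable pmf" and q :: "'b :: countable pmf"
  shows "measure_pmf p \<Otimes>\<^sub>M measure_pmf q = measure_pmf (pair_pmf p q)"
proof (rule pair_measure_eqI)
  show "sets (measure_pmf p \<Otimes>\<^sub>M measure_pmf q) = sets (measure_pmf (pair_pmf p q))"
  proof -
    have "sets (measure_pmf p \<Otimes>\<^sub>M measure_pmf q) = sets (count_space (UNIV :: 'a set) \<Otimes>\<^sub>M count_space (UNIV :: 'b set))"
      by (intro sets_pair_measure_cong) auto
    also have "\<dots> = sets (measure_pmf (pair_pmf p q))" by (subst pair_measure_countable) auto
    finally show ?thesis .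
  qed
  fix A B
  show "emeasure p A * emeasure q B = emeasure (pair_pmf p q) (A \<times> B)"
    using prob_pair_pmf_Times[of p q A B] by (simp add: measure_pmf.emeasure_eq_measure ennreal_mult)
qed (auto intro: prob_space_imp_sigma_finite measure_pmf.prob_space_axioms)

text \<open>\<open>f\<close> is the density of the joint law relative to the product of the
  marginals. Where that product vanishes so does the joint law, so the value 0 of the quotient does
  no harm.\<close>

lemma mutual_information_pmf:
  fixes X :: "'w \<Rightarrow> 'a :: countable" and Y :: "'w \<Rightarrow> 'b :: countable" and E :: "'w pmf"
  assumes "1 < b"
  defines "f \<equiv> \<lambda>(x, y). pmf (map_pmf (\<lambda>\<omega>. (X \<omega>, Y \<omega>)) E) (x, y) / (pmf (map_pmf X E) x * pmf (map_pmf Y E) y)"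
  shows "prob_space.mutual_information (measure_pmf E) b (count_space UNIV) (count_space UNIV) X Y =
     measure_pmf.expectation (pair_pmf (map_pmf X E) (map_pmf Y E)) (\<lambda>v. f v * log b (f v))"
proof -
  let ?J = "map_pmf (\<lambda>\<omega>. (X \<omega>, Y \<omega>)) E" and ?Q = "pair_pmf (map_pmf X E) (map_pmf Y E)"
  have cs: "count_space (UNIV :: 'a set) \<Otimes>\<^sub>M count_space (UNIV :: 'b set) = count_space UNIV"
    by (subst pair_measure_countable) auto
  have f_nonneg: "f v \<ge> 0" for v by (cases v) (auto simp: f_def)
  have J: "measure_pmf ?J = density (measure_pmf ?Q) f"
  proof -
    have "pmf ?J v = pmf ?Q v * f v" for v
    proof (cases "pmf ?Q v = 0")
      case True
      obtain x y where v: "v = (x, y)" by (cases v)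
      have "pmf ?J v = 0"
      proof (rule ccontr)
        assume "pmf ?J v \<noteq> 0"
        then have "v \<in> set_pmf ?J" by (simp only: set_pmf_iff not_False_eq_True)
        then have "x \<in> set_pmf (map_pmf X E)" "y \<in> set_pmf (map_pmf Y E)" unfolding v by auto
        then show False using True unfolding v pmf_pair by (simp only: set_pmf_iff mult_eq_0_iff simp_thms)
      qed
      then show ?thesis using True by simp
    next
      case False
      then show ?thesis by (cases v) (auto simp: f_def pmf_pair)
    qed
    then have "ennreal (pmf ?J v) = ennreal (pmf ?Q v) * ennreal (f v)" for v
      using f_nonneg by (simp add: ennreal_mult)
    then have "measure_pmf ?J = density (count_space UNIV) (\<lambda>v. ennreal (pmf ?Q v) * ennreal (f v))"
      by (subst measure_pmf_eq_density) (rule arg_cong[where f="density (count_space UNIV)"], rule ext)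
    also have "\<dots> = density (density (count_space UNIV) (pmf ?Q)) f"
      by (rule density_density_eq[symmetric]) auto
    also have "density (count_space UNIV) (pmf ?Q) = measure_pmf ?Q"
      by (rule measure_pmf_eq_density[symmetric])
    finally show ?thesis .
  qed
  have "prob_space.mutual_information (measure_pmf E) b (count_space UNIV) (count_space UNIV) X Y =
     KL_divergence b (measure_pmf ?Q) (measure_pmf ?J)"
  proof -
    have "distr (measure_pmf E) (count_space UNIV) X = measure_pmf (map_pmf X E)"
      "distr (measure_pmf E) (count_space UNIV) Y = measure_pmf (map_pmf Y E)"
      "distr (measure_pmf E) (count_space UNIV) (\<lambda>\<omega>. (X \<omega>, Y \<omega>)) = measure_pmf ?J"
      by (rule map_pmf_rep_eq[symmetric])+
    then show ?thesis
      by (subst prob_space.mutual_information_def[OF measure_pmf.prob_space_axioms])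
        (simp only: cs pair_measure_pmf)
  qed
  also have "\<dots> = measure_pmf.expectation ?Q (\<lambda>v. f v * log b (f v))"
    unfolding J using f_nonneg
    by (intro sigma_finite_measure.KL_density prob_space_imp_sigma_finite measure_pmf.prob_space_axioms assms(1)) auto
  finally show ?thesis .
qed


lemma pmf_bind_map_Pair: "pmf (bind_pmf A (\<lambda>a. map_pmf (Pair a) (B a))) (a, b) = pmf A a * pmf (B a) b"
proof -
  have "pmf (map_pmf (Pair a') (B a')) (a, b) = (if a' = a then pmf (B a) b else 0)" for a'
    by (auto simp: inj_def pmf_map_inj' pmf_eq_0_set_pmf)
  then show ?thesis
    unfolding pmf_bind by (subst integral_measure_pmf_real[where A="{a}"]) (auto split: if_splits)
qed

text \<open>Supplies the bound under which an expectation may be split along a mixture. From 1 on q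
  log q is increasing; below 1, q ln q lies between -1 and 0.\<close>

lemma mult_log_bounded:
  assumes "0 \<le> q" "q \<le> B" "1 \<le> B"
  shows "\<bar>q * log 2 q\<bar> \<le> B * log 2 B + 1 / ln 2"
proof (cases "q \<ge> 1")
  case True
  have "q * log 2 q \<le> B * log 2 B" using assms True by (intro mult_mono) auto
  moreover have "q * log 2 q \<ge> 0" "1 / ln 2 \<ge> (0::real)" using True by auto
  ultimately show ?thesis by linarith
next
  case False
  have "q * ln q \<ge> q - 1" using gibbs_ge_diff[of q 1] assms by simp
  moreover have "q * ln q \<le> 0"
    using assms False by (cases "q = 0") (auto intro!: mult_nonneg_nonpos)
  ultimately have "\<bar>q * ln q\<bar> \<le> 1" using assms by auto
  then have "\<bar>q * ln q\<bar> / ln 2 \<le> 1 / ln 2" by (intro divide_right_mono) auto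
  moreover have "\<bar>q * log 2 q\<bar> = \<bar>q * ln q\<bar> / ln 2" by (simp add: log_def abs_mult)
  moreover have "B * log 2 B \<ge> 0" using assms by auto
  ultimately show ?thesis by linarith
qed

text \<open>Conditional information is defined as I(X; Y, Z) - I(X; Z). Since \<open>X\<close> is
  independent of the pair \<open>(z, s)\<close>, the second term vanishes and the first is the mean
  over that pair of the information between \<open>X\<close> and \<open>t\<close> alone. The
  constant \<open>B\<close> bounds the ratio of \<open>K zs x\<close> to the mixture over
  \<open>x\<close>, and so the integrand.\<close>

lemma conditional_mutual_information_pmf:
  fixes X :: "'w \<Rightarrow> 'a :: countable" and Y :: "'w \<Rightarrow> 's :: countable \<times> 't :: countable"
    and Z :: "'w \<Rightarrow> 'z :: countable" and E :: "'w pmf"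
    and C :: "('z \<times> 's) pmf" and U :: "'a pmf" and K :: "'z \<times> 's \<Rightarrow> 'a \<Rightarrow> 't pmf" and B :: real
  assumes joint: "map_pmf (\<lambda>\<omega>. (X \<omega>, Y \<omega>, Z \<omega>)) E =
      bind_pmf C (\<lambda>zs. bind_pmf U (\<lambda>x. bind_pmf (K zs x) (\<lambda>t. return_pmf (x, (snd zs, t), fst zs))))"
    and U: "finite (set_pmf U)" "\<And>x. x \<in> set_pmf U \<Longrightarrow> 1 \<le> B * pmf U x"
    and T: "\<And>zs x. set_pmf (K zs x) \<subseteq> T zs" "\<And>zs. finite (T zs)"
  shows "prob_space.conditional_mutual_information (measure_pmf E) 2
      (count_space UNIV) (count_space UNIV) (count_space UNIV) X Y Z =
    measure_pmf.expectation C (\<lambda>zs. \<Sum>x\<in>set_pmf U. \<Sum>t\<in>T zs. pmf U x * (pmf (K zs x) t *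
      log 2 (pmf (K zs x) t / pmf (bind_pmf U (K zs)) t)))"
proof -
  define Kb where "Kb zs = bind_pmf U (K zs)" for zs
  have B: "B \<ge> 1"
  proof -
    obtain x where x: "x \<in> set_pmf U" using set_pmf_not_empty[of U] by blast
    have "B > 0"
    proof (rule ccontr)
      assume "\<not> B > 0"
      then have "B * pmf U x \<le> 0" by (intro mult_nonpos_nonneg) auto
      then show False using U(2)[OF x] by simp
    qed
    then have "B * pmf U x \<le> B * 1" by (intro mult_left_mono pmf_le_1) auto
    then show ?thesis using U(2)[OF x] by simp
  qed
  have q_le: "pmf (K zs x) t \<le> B * pmf (Kb zs) t" if x: "x \<in> set_pmf U" for zs x t
  proof -
    have "pmf (K zs x) t * pmf U x \<le> (\<Sum>x\<in>set_pmf U. pmf (K zs x) t * pmf U x)"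
      using U(1) x by (intro member_le_sum) auto
    also have "\<dots> = pmf (Kb zs) t"
      unfolding Kb_def pmf_bind using U(1) by (subst integral_measure_pmf_real[where A="set_pmf U"]) auto
    finally have "B * (pmf (K zs x) t * pmf U x) \<le> B * pmf (Kb zs) t" using B by (intro mult_left_mono) auto
    moreover have "pmf (K zs x) t * 1 \<le> pmf (K zs x) t * (B * pmf U x)"
      using U(2)[OF x] by (intro mult_left_mono) auto
    ultimately show ?thesis by (simp add: mult_ac)
  qed
  have mX: "map_pmf X E = U"
  proof -
    have "map_pmf X E = map_pmf fst (map_pmf (\<lambda>\<omega>. (X \<omega>, Y \<omega>, Z \<omega>)) E)" by (simp add: pmf.map_comp o_def)
    then show ?thesis unfolding joint by (simp add: map_bind_pmf bind_return_pmf')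
  qed
  have mXZ: "map_pmf (\<lambda>\<omega>. (X \<omega>, Z \<omega>)) E = pair_pmf U (map_pmf fst C)"
  proof -
    have "map_pmf (\<lambda>\<omega>. (X \<omega>, Z \<omega>)) E = map_pmf (\<lambda>(x, y, z). (x, z)) (map_pmf (\<lambda>\<omega>. (X \<omega>, Y \<omega>, Z \<omega>)) E)"
      by (simp add: pmf.map_comp o_def)
    also have "\<dots> = bind_pmf C (\<lambda>zs. bind_pmf U (\<lambda>x. return_pmf (x, fst zs)))"
      unfolding joint by (simp add: map_bind_pmf)
    also have "\<dots> = pair_pmf U (map_pmf fst C)"
      by (subst bind_commute_pmf) (simp add: pair_pmf_def map_pmf_def bind_assoc_pmf bind_return_pmf)
    finally show ?thesis .
  qed
  have mYZ: "map_pmf (\<lambda>\<omega>. (Y \<omega>, Z \<omega>)) E = bind_pmf C (\<lambda>zs. bind_pmf (Kb zs) (\<lambda>t. return_pmf ((snd zs, t), fst zs)))"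
  proof -
    have "map_pmf (\<lambda>\<omega>. (Y \<omega>, Z \<omega>)) E = map_pmf snd (map_pmf (\<lambda>\<omega>. (X \<omega>, Y \<omega>, Z \<omega>)) E)"
      by (simp add: pmf.map_comp o_def)
    then show ?thesis unfolding joint Kb_def by (simp add: map_bind_pmf bind_assoc_pmf)
  qed
  have mZ: "map_pmf Z E = map_pmf fst C"
  proof -
    have "map_pmf Z E = map_pmf snd (map_pmf (\<lambda>\<omega>. (X \<omega>, Z \<omega>)) E)"
      by (simp add: pmf.map_comp o_def)
    then show ?thesis unfolding mXZ by (simp add: map_snd_pair_pmf)
  qed
  have pYZ: "pmf (map_pmf (\<lambda>\<omega>. (Y \<omega>, Z \<omega>)) E) ((s, t), z) = pmf C (z, s) * pmf (Kb (z, s)) t" for s t z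
  proof -
    let ?g = "\<lambda>(zs, t). ((snd zs, t), fst zs) :: ('s \<times> 't) \<times> 'z"
    have "map_pmf (\<lambda>\<omega>. (Y \<omega>, Z \<omega>)) E = map_pmf ?g (bind_pmf C (\<lambda>zs. map_pmf (Pair zs) (Kb zs)))"
      unfolding mYZ by (simp add: map_bind_pmf map_pmf_def bind_assoc_pmf bind_return_pmf)
    moreover have "inj ?g" by (auto simp: inj_def)
    ultimately show ?thesis
      using pmf_map_inj'[of ?g _ "((z, s), t)"] by (simp add: pmf_bind_map_Pair)
  qed
  have pXYZ: "pmf (map_pmf (\<lambda>\<omega>. (X \<omega>, Y \<omega>, Z \<omega>)) E) (x, (s, t), z) = pmf C (z, s) * (pmf U x * pmf (K (z, s) x) t)"
    for x s t z
  proof -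
    let ?g = "\<lambda>(zs, x, t). (x, (snd zs, t), fst zs) :: 'a \<times> ('s \<times> 't) \<times> 'z"
    have "map_pmf (\<lambda>\<omega>. (X \<omega>, Y \<omega>, Z \<omega>)) E = map_pmf ?g (bind_pmf C (\<lambda>zs. map_pmf (Pair zs)
        (bind_pmf U (\<lambda>x. map_pmf (Pair x) (K zs x)))))"
      unfolding joint by (simp add: map_bind_pmf map_pmf_def bind_assoc_pmf bind_return_pmf)
    moreover have "inj ?g" by (auto simp: inj_def)
    ultimately show ?thesis
      using pmf_map_inj'[of ?g _ "((z, s), x, t)"] by (simp add: pmf_bind_map_Pair)
  qed
  have I0: "prob_space.mutual_information (measure_pmf E) 2 (count_space UNIV) (count_space UNIV) X Z = 0"
    unfolding mutual_information_pmf[where b = 2 and X = X and Y = Z, simplified] mX mZ mXZ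
    by (intro integral_eq_zero_AE) (auto simp: AE_measure_pmf_iff pmf_pair set_pmf_iff)
  define q where "q zs x t = pmf (K zs x) t / pmf (Kb zs) t" for zs x t
  have q_bd: "0 \<le> q zs x t \<and> q zs x t \<le> B" if "x \<in> set_pmf U" for zs x t
    unfolding q_def using q_le[OF that, of zs t] B by (cases "pmf (Kb zs) t = 0") (auto simp: field_simps less_le)
  define f where "f = (\<lambda>(x, yz). pmf (map_pmf (\<lambda>\<omega>. (X \<omega>, Y \<omega>, Z \<omega>)) E) (x, yz) /
      (pmf (map_pmf X E) x * pmf (map_pmf (\<lambda>\<omega>. (Y \<omega>, Z \<omega>)) E) yz))"
  have f: "f (x, ((s, t), z)) = q (z, s) x t" if "x \<in> set_pmf U" "(z, s) \<in> set_pmf C" for x s t z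
    using that unfolding f_def by (simp add: pXYZ pYZ mX q_def set_pmf_iff)
  let ?h = "\<lambda>v. f v * log 2 (f v)"
  have dist: "pair_pmf (map_pmf X E) (map_pmf (\<lambda>\<omega>. (Y \<omega>, Z \<omega>)) E) =
     bind_pmf C (\<lambda>zs. map_pmf (\<lambda>(x, t). (x, (snd zs, t), fst zs)) (pair_pmf U (Kb zs)))"
    unfolding mX mYZ
    by (simp add: pair_pmf_def map_pmf_def bind_assoc_pmf bind_return_pmf bind_commute_pmf[of C U])
  have "prob_space.conditional_mutual_information (measure_pmf E) 2
      (count_space UNIV) (count_space UNIV) (count_space UNIV) X Y Z =
     prob_space.mutual_information (measure_pmf E) 2 (count_space UNIV) (count_space UNIV) X (\<lambda>\<omega>. (Y \<omega>, Z \<omega>))"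
    unfolding prob_space.conditional_mutual_information_def[OF measure_pmf.prob_space_axioms] I0
    by (subst pair_measure_countable) auto
  also have "\<dots> = measure_pmf.expectation (pair_pmf (map_pmf X E) (map_pmf (\<lambda>\<omega>. (Y \<omega>, Z \<omega>)) E)) ?h"
    unfolding f_def by (subst mutual_information_pmf) (auto simp: case_prod_beta')
  also have "\<dots> = measure_pmf.expectation C (\<lambda>zs. measure_pmf.expectation
      (map_pmf (\<lambda>(x, t). (x, (snd zs, t), fst zs)) (pair_pmf U (Kb zs))) ?h)"
    unfolding dist
  proof (rule expectation_bind_pmf)
    fix v assume "v \<in> set_pmf (bind_pmf C (\<lambda>zs. map_pmf (\<lambda>(x, t). (x, (snd zs, t), fst zs)) (pair_pmf U (Kb zs))))"
    then obtain z s x t where v: "v = (x, (s, t), z)" "(z, s) \<in> set_pmf C" "x \<in> set_pmf U" by auto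
    then show "\<bar>?h v\<bar> \<le> B * log 2 B + 1 / ln 2"
      using f q_bd B by (simp add: mult_log_bounded)
  qed
  also have "\<dots> = measure_pmf.expectation C (\<lambda>zs. \<Sum>x\<in>set_pmf U. \<Sum>t\<in>T zs. pmf U x * (pmf (K zs x) t *
      log 2 (pmf (K zs x) t / pmf (Kb zs) t)))"
  proof (intro integral_cong_AE)
    show "AE zs in measure_pmf C. measure_pmf.expectation
      (map_pmf (\<lambda>(x, t). (x, (snd zs, t), fst zs)) (pair_pmf U (Kb zs))) ?h =
      (\<Sum>x\<in>set_pmf U. \<Sum>t\<in>T zs. pmf U x * (pmf (K zs x) t * log 2 (pmf (K zs x) t / pmf (Kb zs) t)))"
      unfolding AE_measure_pmf_iff
    proof
      fix zs assume zs: "zs \<in> set_pmf C"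
      have KbT: "set_pmf (Kb zs) \<subseteq> T zs" unfolding Kb_def using T(1)[of zs] by (simp add: UN_subset_iff)
      have "measure_pmf.expectation (map_pmf (\<lambda>(x, t). (x, (snd zs, t), fst zs)) (pair_pmf U (Kb zs))) ?h
        = measure_pmf.expectation (pair_pmf U (Kb zs)) (\<lambda>(x, t). ?h (x, (snd zs, t), fst zs))"
        by (simp add: case_prod_beta')
      also have "\<dots> = (\<Sum>v\<in>set_pmf U \<times> T zs. (case v of (x, t) \<Rightarrow> ?h (x, (snd zs, t), fst zs)) * pmf (pair_pmf U (Kb zs)) v)"
        using U(1) T(2)[of zs] KbT by (intro integral_measure_pmf_real) auto
      also have "\<dots> = (\<Sum>x\<in>set_pmf U. \<Sum>t\<in>T zs. pmf U x * (pmf (K zs x) t * log 2 (pmf (K zs x) t / pmf (Kb zs) t)))"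
        unfolding sum.cartesian_product
      proof (intro sum.cong refl, clarify)
        fix x t assume x: "x \<in> set_pmf U"
        have fq: "f (x, (snd zs, t), fst zs) = q zs x t" using f[OF x, of "fst zs" "snd zs" t] zs by simp
        show "?h (x, (snd zs, t), fst zs) * pmf (pair_pmf U (Kb zs)) (x, t) =
          pmf U x * (pmf (K zs x) t * log 2 (pmf (K zs x) t / pmf (Kb zs) t))"
        proof (cases "pmf (Kb zs) t = 0")
          case True
          then have "pmf (K zs x) t = 0" using q_le[OF x, of zs t] by (simp add: order_antisym)
          then show ?thesis using True by (simp add: pmf_pair)
        next
          case False
          then show ?thesis unfolding fq q_def by (simp add: pmf_pair)
        qed
      qed
      finally show "measure_pmf.expectation
      (map_pmf (\<lambda>(x, t). (x, (snd zs, t), fst zs)) (pair_pmf U (Kb zs))) ?h = \<dots>" .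
    qed
  qed auto
  finally show ?thesis unfolding Kb_def .
qed

section \<open>Lower bound for protocols\<close>

lemma set_pmf_cube: "set_pmf (pmf_of_set (cube N)) = cube N"
  and pmf_cube: "x \<in> cube N \<Longrightarrow> pmf (pmf_of_set (cube N)) x = 1 / 2 ^ N"
proof -
  have "cube N \<noteq> {}" by (auto simp: cube_def intro: exI[of _ "replicate N True"])
  then show "set_pmf (pmf_of_set (cube N)) = cube N"
    "x \<in> cube N \<Longrightarrow> pmf (pmf_of_set (cube N)) x = 1 / 2 ^ N"
    by (simp_all add: card_cube)
qed

lemma set_pmf_cube_pair:
    "set_pmf (pair_pmf (pmf_of_set (cube N)) (pmf_of_set (cube N))) = cube N \<times> cube N"
  and pmf_cube_pair: "x \<in> cube N \<Longrightarrow> y \<in> cube N \<Longrightarrow>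
    pmf (pair_pmf (pmf_of_set (cube N)) (pmf_of_set (cube N))) (x, y) = 1 / 4 ^ N"
  by (simp_all add: set_pmf_cube pmf_pair pmf_cube flip: power_mult_distrib)

abbreviation context_info :: "nat \<Rightarrow> nat \<Rightarrow> nat \<Rightarrow> protocol \<Rightarrow> (nat list \<times> nat list list) \<times> nat \<Rightarrow> real" where
  "context_info k n N P zs \<equiv> two_party.info (paths (Tree P (snd zs))) (alice k n N P zs) (bob k n N P zs) N"

abbreviation context_error :: "nat \<Rightarrow> nat \<Rightarrow> nat \<Rightarrow> protocol \<Rightarrow> (nat list \<times> nat list list) \<times> nat \<Rightarrow> real" where
  "context_error k n N P zs \<equiv> two_party.tilt_error (paths (Tree P (snd zs))) (alice k n N P zs) (bob k n N P zs) N
     0 (verdict (Tree P (snd zs)))"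

text \<open>Each pair has probability 1 / 4^N, whence the bound 4^N on likelihood ratios; the
  mixture of the kernels is \<open>marg\<close>, and the division by ln 2 converts nats into
  bits.\<close>

lemma transcript_information_eq:
  assumes k: "4 \<le> k"
  shows "transcript_information k n N P =
    measure_pmf.expectation (context_dist k n N P) (\<lambda>zs. context_info k n N P zs / ln 2)"
proof -
  let ?U = "pair_pmf (pmf_of_set (cube N)) (pmf_of_set (cube N))"
  have "transcript_information k n N P = measure_pmf.expectation (context_dist k n N P)
     (\<lambda>zs. \<Sum>xy\<in>set_pmf ?U. \<Sum>t\<in>paths (Tree P (snd zs)). pmf ?U xy * (pmf (kernel k n N P zs xy) t *
      log 2 (pmf (kernel k n N P zs xy) t / pmf (bind_pmf ?U (kernel k n N P zs)) t)))"
    unfolding transcript_information_def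
  proof (rule conditional_mutual_information_pmf[where B="4 ^ N"])
    show "map_pmf (\<lambda>\<omega>. (case \<omega> of (w, s, r) \<Rightarrow> (Xvar k N w, Yvar k N w), transcript P \<omega>,
        case \<omega> of (w, s, r) \<Rightarrow> (Mvar N w, Dvar n N w))) (execution k n N P) =
      bind_pmf (context_dist k n N P) (\<lambda>zs. bind_pmf ?U (\<lambda>xy.
        bind_pmf (kernel k n N P zs xy) (\<lambda>t. return_pmf (xy, (snd zs, t), fst zs))))"
      by (rule joint_dist_eq[OF k])
  qed (auto simp: set_kernel finite_paths set_pmf_cube pmf_cube_pair)
  also have "\<dots> = measure_pmf.expectation (context_dist k n N P) (\<lambda>zs. context_info k n N P zs / ln 2)"
  proof (intro Bochner_Integration.integral_cong refl)
    fix zs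
    interpret two_party "paths (Tree P (snd zs))" "alice k n N P zs" "bob k n N P zs" N
      by (rule two_party_kernel)
    have marg: "pmf (bind_pmf ?U (kernel k n N P zs)) t = marg t" for t
    proof -
      have "pmf (bind_pmf ?U (kernel k n N P zs)) t =
          (\<Sum>xy\<in>cube N \<times> cube N. pmf (kernel k n N P zs xy) t * pmf ?U xy)"
        unfolding pmf_bind by (rule integral_measure_pmf_real) (auto simp: set_pmf_cube)
      also have "\<dots> = (\<Sum>(x, y)\<in>cube N \<times> cube N. alice k n N P zs t x * bob k n N P zs t y / 4 ^ N)"
        by (intro sum.cong refl) (auto simp: pmf_kernel pmf_cube_pair)
      finally show ?thesis
        by (simp add: marg_eq sum_divide_distrib flip: sum.cartesian_product)
    qed
    have "(\<Sum>xy\<in>set_pmf ?U. \<Sum>t\<in>paths (Tree P (snd zs)). pmf ?U xy * (pmf (kernel k n N P zs xy) t *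
      log 2 (pmf (kernel k n N P zs xy) t / pmf (bind_pmf ?U (kernel k n N P zs)) t))) =
     (\<Sum>(x, y)\<in>cube N \<times> cube N. divergence x y / 4 ^ N / ln 2)"
      unfolding set_pmf_cube_pair
      by (intro sum.cong refl)
        (auto simp: marg divergence_def pmf_kernel pmf_cube_pair log_def sum_divide_distrib intro!: sum.cong)
    also have "\<dots> = info / ln 2"
      by (simp add: info_def sum_divide_distrib flip: sum.cartesian_product)
    finally show "(\<Sum>xy\<in>set_pmf ?U. \<Sum>t\<in>paths (Tree P (snd zs)). pmf ?U xy * (pmf (kernel k n N P zs xy) t *
      log 2 (pmf (kernel k n N P zs xy) t / pmf (bind_pmf ?U (kernel k n N P zs)) t))) = info / ln 2" .
  qed
  finally show ?thesis .
qed

lemma error_prob_eq_expectation: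
  assumes k: "4 \<le> k" "even k" and n: "1 \<le> n" and \<epsilon>: "0 < \<epsilon>" "real N = 1 / \<epsilon>\<^sup>2"
  shows "error_prob \<epsilon> k n N P = measure_pmf.expectation (context_dist k n N P) (context_error k n N P)"
proof -
  let ?U = "pair_pmf (pmf_of_set (cube N)) (pmf_of_set (cube N))"
  let ?i = "\<lambda>e :: (bool list \<times> bool list) \<times> (nat \<times> bool list) \<times> nat list \<times> nat list list.
    of_bool (erroneous N P e) :: real"
  let ?D = "\<lambda>zs. bind_pmf ?U (\<lambda>xy. bind_pmf (kernel k n N P zs xy) (\<lambda>t. return_pmf (xy, (snd zs, t), fst zs)))"
  have "?i = indicator {e. erroneous N P e}" by (auto simp: indicator_def fun_eq_iff)
  then have "error_prob \<epsilon> k n N P = measure_pmf.expectation (bind_pmf (context_dist k n N P) ?D) ?i"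
    unfolding error_prob_eq[OF assms] by simp
  also have "\<dots> = measure_pmf.expectation (context_dist k n N P) (\<lambda>zs. measure_pmf.expectation (?D zs) ?i)"
    by (rule expectation_bind_pmf[where B=1]) auto
  also have "\<dots> = measure_pmf.expectation (context_dist k n N P) (context_error k n N P)"
  proof (intro Bochner_Integration.integral_cong refl)
    fix zs
    interpret two_party "paths (Tree P (snd zs))" "alice k n N P zs" "bob k n N P zs" N
      by (rule two_party_kernel)
    have "measure_pmf.expectation (?D zs) ?i = measure_pmf.expectation ?U (\<lambda>xy.
        measure_pmf.expectation (map_pmf (\<lambda>t. (xy, (snd zs, t), fst zs)) (kernel k n N P zs xy)) ?i)"
      unfolding map_pmf_def by (rule expectation_bind_pmf[where B=1]) auto
    also have "\<dots> = measure_pmf.expectation ?U (\<lambda>xy.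
        \<Sum>t\<in>paths (Tree P (snd zs)). ?i (xy, (snd zs, t), fst zs) * pmf (kernel k n N P zs xy) t)"
      unfolding integral_map_pmf
      by (intro Bochner_Integration.integral_cong refl integral_measure_pmf_real finite_paths subsetD[OF set_kernel])
    also have "\<dots> = (\<Sum>xy\<in>cube N \<times> cube N. (\<Sum>t\<in>paths (Tree P (snd zs)).
        ?i (xy, (snd zs, t), fst zs) * pmf (kernel k n N P zs xy) t) * pmf ?U xy)"
      by (rule integral_measure_pmf_real) (auto simp: set_pmf_cube)
    also have "\<dots> = (\<Sum>(x, y)\<in>cube N \<times> cube N. (\<Sum>t\<in>paths (Tree P (snd zs)).
        ?i ((x, y), (snd zs, t), fst zs) * (alice k n N P zs t x * bob k n N P zs t y)) / 4 ^ N)"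
      by (intro sum.cong refl) (auto simp: pmf_kernel pmf_cube_pair)
    also have "\<dots> = tilt_error 0 (verdict (Tree P (snd zs)))"
      by (simp add: tilt_error_def erroneous_def sum_divide_distrib mult.commute flip: sum.cartesian_product)
    finally show "measure_pmf.expectation (?D zs) ?i = tilt_error 0 (verdict (Tree P (snd zs)))" .
  qed
  finally show ?thesis .
qed

theorem theorem6:
  shows "\<exists>\<delta>>0. \<exists>c>0. \<exists>\<epsilon>\<^sub>0>0. \<forall>(\<epsilon>::real) (N::nat) (k::nat) (n::nat) (P::protocol).
           0 < \<epsilon> \<and> \<epsilon> \<le> \<epsilon>\<^sub>0 \<and> real N = 1 / \<epsilon>\<^sup>2 \<and>
           (\<exists>p. k = 2 ^ p) \<and> 4 \<le> k \<and> 1 \<le> n \<and>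
           blackboard_protocol k P \<and> error_prob \<epsilon> k n N P \<le> \<delta> \<longrightarrow>
           transcript_information k n N P \<ge> c * (1 / \<epsilon>\<^sup>2)"
proof -
  \<comment> \<open>The constants of \<open>info_lower_bound\<close>. The theorem takes half of
    each: an average error of at most \<delta> / 2 leaves the factor 1 - 1 / 2.\<close>
  define \<delta> :: real where "\<delta> = 1 / (10 ^ 6 * exp 64)"
  define c :: real where "c = 1 / (10 ^ 8 * exp 64)"
  have pos: "\<delta> > 0" "c > 0" by (auto simp: \<delta>_def c_def)
  have main: "transcript_information k n N P \<ge> c / 2 * (1 / \<epsilon>\<^sup>2)"
    if \<epsilon>: "0 < \<epsilon>" "\<epsilon> \<le> 1 / 800" "real N = 1 / \<epsilon>\<^sup>2" and k: "k = 2 ^ p" "4 \<le> k" and n: "1 \<le> n"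
      and err: "error_prob \<epsilon> k n N P \<le> \<delta> / 2" for \<epsilon> N k n P p
  proof -
    let ?C = "context_dist k n N P"
    have "even k" using k by (cases p) auto
    have N: "N \<ge> 640000"
    proof -
      have "\<epsilon>\<^sup>2 \<le> (1 / 800)\<^sup>2" using \<epsilon> by (intro power_mono) auto
      then have "1 / (1 / 800)\<^sup>2 \<le> 1 / \<epsilon>\<^sup>2" using \<epsilon> by (intro divide_left_mono) auto
      then have "real 640000 \<le> real N" using \<epsilon>(3) by (simp add: power2_eq_square)
      then show ?thesis by (simp only: of_nat_le_iff)
    qed
    \<comment> \<open>The bound \<open>lower\<close> is linear in the error, so it can be averaged
      over the contexts. For error at most \<delta> it follows from \<open>info_lower_bound\<close>;
      beyond that its left side is not positive.\<close>
    have info: "0 \<le> context_info k n N P zs" "context_info k n N P zs \<le> real N * ln 4"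
      and error: "0 \<le> context_error k n N P zs" "context_error k n N P zs \<le> 1"
      and lower: "c * real N * (1 - context_error k n N P zs / \<delta>) \<le> context_info k n N P zs" for zs
    proof -
      interpret two_party "paths (Tree P (snd zs))" "alice k n N P zs" "bob k n N P zs" N
        by (rule two_party_kernel)
      show i0: "0 \<le> info" unfolding info_def
        by (intro divide_nonneg_nonneg sum_nonneg divergence_nonneg) auto
      have "(\<Sum>x\<in>cube N. \<Sum>y\<in>cube N. divergence x y) \<le> (\<Sum>x\<in>cube N. \<Sum>y\<in>cube N. real N * ln 4)"
        by (intro sum_mono divergence_le)
      also have "\<dots> = 4 ^ N * (real N * ln 4)"
        by (simp add: card_cube flip: power_mult_distrib)
      finally show "info \<le> real N * ln 4" unfolding info_def by (simp add: field_simps)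
      let ?f = "\<lambda>x y. \<Sum>t\<in>paths (Tree P (snd zs)). alice k n N P zs t x * bob k n N P zs t y *
        of_bool (if verdict (Tree P (snd zs)) t then \<bar>corr x y\<bar> \<le> 2 * sqrt (real N) else \<bar>corr x y\<bar> \<ge> 4 * sqrt (real N))"
      show e0: "0 \<le> tilt_error 0 (verdict (Tree P (snd zs)))" unfolding tilt_error_def tilt_0 mult_1
        using a_nonneg b_nonneg by (intro divide_nonneg_nonneg sum_nonneg) auto
      have "(\<Sum>x\<in>cube N. \<Sum>y\<in>cube N. ?f x y) \<le> (\<Sum>x\<in>cube N. \<Sum>y\<in>cube N. 1)"
      proof (intro sum_mono)
        fix x y assume "x \<in> cube N" "y \<in> cube N"
        have "?f x y \<le> (\<Sum>t\<in>paths (Tree P (snd zs)). alice k n N P zs t x * bob k n N P zs t y)"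
          using a_nonneg b_nonneg by (intro sum_mono) auto
        then show "?f x y \<le> 1" using sum_ab \<open>x \<in> cube N\<close> \<open>y \<in> cube N\<close> by simp
      qed
      also have "\<dots> = 4 ^ N" by (simp add: card_cube flip: power_mult_distrib)
      finally show "tilt_error 0 (verdict (Tree P (snd zs))) \<le> 1"
        unfolding tilt_error_def tilt_0 mult_1 by simp
      show "c * real N * (1 - tilt_error 0 (verdict (Tree P (snd zs))) / \<delta>) \<le> info"
      proof (cases "tilt_error 0 (verdict (Tree P (snd zs))) \<le> \<delta>")
        case True
        have "c * real N * (1 - tilt_error 0 (verdict (Tree P (snd zs))) / \<delta>) \<le> c * real N * 1"
          using pos e0 by (intro mult_left_mono) auto
        also have "\<dots> \<le> info" using info_lower_bound[OF N] True unfolding \<delta>_def c_def by simp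
        finally show ?thesis .
      next
        case False
        then have "c * real N * (1 - tilt_error 0 (verdict (Tree P (snd zs))) / \<delta>) \<le> 0"
          using pos by (intro mult_nonneg_nonpos) auto
        then show ?thesis using i0 by simp
      qed
    qed
    have int: "integrable ?C (context_error k n N P)"
      using error by (intro measure_pmf.integrable_const_bound[where B=1] AE_pmfI) auto
    have int': "integrable ?C (\<lambda>zs. context_info k n N P zs / ln 2)"
      using info
      by (intro measure_pmf.integrable_const_bound[where B="real N * ln 4 / ln 2"] AE_pmfI)
        (auto intro: divide_right_mono)
    have "c / 2 * (1 / \<epsilon>\<^sup>2) = c * real N * (1 - \<delta> / 2 / \<delta>)" using pos \<epsilon>(3) by simp
    also have "\<dots> \<le> c * real N * (1 - error_prob \<epsilon> k n N P / \<delta>)"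
      using pos err by (intro mult_left_mono diff_left_mono divide_right_mono) auto
    also have "\<dots> = measure_pmf.expectation ?C (\<lambda>zs. c * real N * (1 - context_error k n N P zs / \<delta>))"
      unfolding error_prob_eq_expectation[OF k(2) \<open>even k\<close> n \<epsilon>(1,3)]
      using int by simp
    also have "\<dots> \<le> measure_pmf.expectation ?C (\<lambda>zs. context_info k n N P zs / ln 2)"
    proof (intro integral_mono)
      \<comment> \<open>Passing from nats to bits only increases the value, since ln 2 < 1.\<close>
      show "c * real N * (1 - context_error k n N P zs / \<delta>) \<le> context_info k n N P zs / ln 2" for zs
      proof -
        have "context_info k n N P zs * ln 2 \<le> context_info k n N P zs * 1"
          using info(1)[of zs] ln_2_less_1 by (intro mult_left_mono) auto
        then have "context_info k n N P zs \<le> context_info k n N P zs / ln 2" by (simp add: field_simps)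
        then show ?thesis using lower[of zs] by linarith
      qed
    qed (use int int' in auto)
    also have "\<dots> = transcript_information k n N P"
      by (rule transcript_information_eq[OF k(2), symmetric])
    finally show ?thesis .
  qed
  show ?thesis
    using pos main by (intro exI[of _ "\<delta> / 2"] exI[of _ "c / 2"] exI[of _ "1 / 800"] conjI allI impI) auto
qed

end
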